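(* Let $p$ be a prime, $n\ge1$, $F$ a field with $\mathrm{char}\,F\ne p$, and $K/F$ cyclic Galois of degree $p^n$ with group $G=\langle\sigma\rangle$. Suppose $\xi_p\in F$ and, if $p=2$, that either $n>1$ or $-1\in N_{K/F}(K^\times)$. Let $\delta\in K^\times$ be any exceptional element of $K/F$ and $m=i(K/F)$. Then the $\mathbb{F}_p[G]$-module $J$ decomposes as \[ J=X\oplus Y,\qquad Y=Y_n\oplus Y_{n-1}\oplus\cdots\oplus Y_0,\] where (1) $X$ is the cyclic $\mathbb{F}_p[G]$-submodule generated by $[\delta]$ and has $\mathbb{F}_p$-dimension $p^m+1$; (2) each $Y_i$ is a direct sum of cyclic $\mathbb{F}_p[G]$-modules of dimension $p^i$; and (3) for $i\in\{0,\dots,n-1\}$, \[ [K_i^\times]=\begin{cases} X^{(\sigma-1)}\oplus Y^{H_i}, & m\le i,\\ X^{(\sigma-1)(\sigma^{p^i}-1)^{p^{m-i}-1}}\oplus Y^{H_i}, & i<m.\end{cases}\]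
   Context: $K_i$ ($0\le i\le n$) is the intermediate field with $[K_i:F]=p^i$, $H_i=\mathrm{Gal}(K/K_i)$; $K_{-\infty}^\times:=\{1\}$ and $p^{-\infty}:=0$, with $-\infty<0<1<\cdots$. $J=K^\times/K^{\times p}$, multiplicative $\mathbb{F}_p[G]$-module; $[\gamma]$ is the class of $\gamma$; $[A]=AK^{\times p}/K^{\times p}$ for subgroups $A\subset K^\times$; $[f]_F$ is the class of $f$ in $F^\times/F^{\times p}$. For a submodule $X$ and $f\in\mathbb{F}_p[G]$ (or $\mathbb{Z}[G]$), $X^{f}$ denotes the image of $X$ under $f$; $Y^{H_i}$ denotes $H_i$-fixed elements. $\xi_p$ is a primitive $p$-th root of unity. Define $i(K/F)=\min\{i\in\{-\infty,0,1,\dots,n\}:\exists\,\delta\in K^\times$ with $[N_{K/F}(\delta)]_F\neq[1]_F$ and $[\delta]^{\tau-1}\in[K_i^\times]$ for all $\tau\in G\}$. An element $\delta\in K^\times$ is exceptional if $[N_{K/F}(\delta)]_F\ne[1]_F$ and $[\delta]^{\tau-1}\in[K_{i(K/F)}^\times]$ for all $\tau\in G$. *)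

theory Defs
  imports "HOL-Algebra.Algebra" "HOL-Number_Theory.Residues" "HOL-Library.Extended"
begin

section \<open>Cyclic Galois extensions\<close>

definition ring_char :: "('a, 'b) ring_scheme \<Rightarrow> nat" where
  "ring_char R = (if \<exists>k::nat. 0 < k \<and> [k] \<cdot>\<^bsub>R\<^esub> \<one>\<^bsub>R\<^esub> = \<zero>\<^bsub>R\<^esub>
                  then LEAST k::nat. 0 < k \<and> [k] \<cdot>\<^bsub>R\<^esub> \<one>\<^bsub>R\<^esub> = \<zero>\<^bsub>R\<^esub> else 0)"

definition primitive_root_of_unity :: "('a, 'b) ring_scheme \<Rightarrow> nat \<Rightarrow> 'a \<Rightarrow> bool" where
  "primitive_root_of_unity R k x \<longleftrightarrow>
     x \<in> carrier R \<and> 0 < k \<and> x [^]\<^bsub>R\<^esub> k = \<one>\<^bsub>R\<^esub> \<and>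
     (\<forall>j::nat. 0 < j \<and> j < k \<longrightarrow> x [^]\<^bsub>R\<^esub> j \<noteq> \<one>\<^bsub>R\<^esub>)"

definition gal_group :: "('a, 'b) ring_scheme \<Rightarrow> 'a set \<Rightarrow> ('a \<Rightarrow> 'a) monoid" where
  "gal_group K F = (BijGroup (carrier K))
     \<lparr>carrier := {\<tau> \<in> Bij (carrier K) \<inter> ring_hom K K. \<forall>x\<in>F. \<tau> x = x}\<rparr>"

text \<open>Artin's form of the definition of a finite Galois extension.\<close>

definition finite_galois :: "('a, 'b) ring_scheme \<Rightarrow> 'a set \<Rightarrow> bool" where
  "finite_galois K F \<longleftrightarrow>
     field K \<and> subfield F K \<and> ring.finite_dimension K F (carrier K) \<and>
     {x \<in> carrier K. \<forall>\<tau>\<in>carrier (gal_group K F). \<tau> x = x} = F"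

text \<open>The norm of a finite Galois extension.\<close>

definition gal_norm :: "('a, 'b) ring_scheme \<Rightarrow> 'a set \<Rightarrow> 'a \<Rightarrow> 'a" where
  "gal_norm K F x = (\<Otimes>\<^bsub>K\<^esub>\<tau>\<in>carrier (gal_group K F). \<tau> x)"

text \<open>\<open>inter_field K F d\<close> is meaningful only if there is exactly one intermediate field of
  degree \<open>d\<close> over \<open>F\<close>, as is the case for \<open>d\<close> dividing the degree of a cyclic extension.
  With \<open>d = p ^ i\<close> it is the field \<open>K\<^sub>i\<close>.\<close>

definition inter_field :: "('a, 'b) ring_scheme \<Rightarrow> 'a set \<Rightarrow> nat \<Rightarrow> 'a set" where
  "inter_field K F d = (THE E. subfield E K \<and> F \<subseteq> E \<and> ring.dimension K d F E)"

text \<open>The groups \<open>K\<^sub>j\<^sup>\<times>\<close> and the numbers \<open>p\<^sup>j\<close> for \<open>j\<close> among \<open>-\<infinity>, 0, 1, \<dots>, n\<close>;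
  the value \<open>Pinf\<close> of the index type is never used.\<close>

definition inter_units :: "('a, 'b) ring_scheme \<Rightarrow> 'a set \<Rightarrow> nat \<Rightarrow> nat extended \<Rightarrow> 'a set" where
  "inter_units K F p j =
     (case j of Fin i \<Rightarrow> inter_field K F (p ^ i) - {\<zero>\<^bsub>K\<^esub>} | _ \<Rightarrow> {\<one>\<^bsub>K\<^esub>})"

definition power_ext :: "nat \<Rightarrow> nat extended \<Rightarrow> nat" where
  "power_ext p j = (case j of Fin i \<Rightarrow> p ^ i | _ \<Rightarrow> 0)"


section \<open>Group rings and their modules\<close>

text \<open>The group ring \<open>R[G]\<close>, for finite \<open>G\<close>: elements are families of coefficients indexed by
  the group, and multiplication is convolution.\<close>

definition group_ring :: "('r, 'b) ring_scheme \<Rightarrow> ('g, 'c) monoid_scheme \<Rightarrow> ('g \<Rightarrow> 'r) ring" where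
  "group_ring R G =
     \<lparr>carrier = carrier G \<rightarrow>\<^sub>E carrier R,
      monoid.mult = \<lambda>f g. \<lambda>x\<in>carrier G. \<Oplus>\<^bsub>R\<^esub>y\<in>carrier G. f y \<otimes>\<^bsub>R\<^esub> g (inv\<^bsub>G\<^esub> y \<otimes>\<^bsub>G\<^esub> x),
      one = \<lambda>x\<in>carrier G. if x = \<one>\<^bsub>G\<^esub> then \<one>\<^bsub>R\<^esub> else \<zero>\<^bsub>R\<^esub>,
      ring.zero = \<lambda>x\<in>carrier G. \<zero>\<^bsub>R\<^esub>,
      ring.add = \<lambda>f g. \<lambda>x\<in>carrier G. f x \<oplus>\<^bsub>R\<^esub> g x\<rparr>"

text \<open>The element \<open>c\<cdot>g\<close> of \<open>R[G]\<close>.\<close>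

definition gr_single ::
  "('r, 'b) ring_scheme \<Rightarrow> ('g, 'c) monoid_scheme \<Rightarrow> 'r \<Rightarrow> 'g \<Rightarrow> 'g \<Rightarrow> 'r" where
  "gr_single R G c g = (\<lambda>x\<in>carrier G. if x = g then c else \<zero>\<^bsub>R\<^esub>)"

definition cyclic_submodule :: "('r, 'b) ring_scheme \<Rightarrow> ('r, 'm) module \<Rightarrow> 'm \<Rightarrow> 'm set" where
  "cyclic_submodule R M x = (\<lambda>r. r \<odot>\<^bsub>M\<^esub> x) ` carrier R"

text \<open>\<open>V\<close> has dimension \<open>d\<close> over the field \<open>k\<close>, where \<open>V\<close> is a subspace of the \<open>k[G]\<close>-module \<open>M\<close>
  and \<open>c \<in> k\<close> acts through \<open>c\<cdot>1 \<in> k[G]\<close>: there is a basis with \<open>d\<close> elements, i.e. every vector is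
  a linear combination of the elements of \<open>B\<close> in exactly one way.\<close>

definition has_dim ::
  "('r, 'b) ring_scheme \<Rightarrow> ('g, 'c) monoid_scheme \<Rightarrow> ('g \<Rightarrow> 'r, 'm) module \<Rightarrow> 'm set \<Rightarrow> nat \<Rightarrow> bool"
where
  "has_dim k G M V d \<longleftrightarrow>
     (\<exists>B\<subseteq>V. finite B \<and> card B = d \<and>
        bij_betw (\<lambda>a. \<Oplus>\<^bsub>M\<^esub>b\<in>B. gr_single k G (a b) \<one>\<^bsub>G\<^esub> \<odot>\<^bsub>M\<^esub> b) (B \<rightarrow>\<^sub>E carrier k) V)"

text \<open>Internal direct sums of submodules: \<open>S = A \<oplus> B\<close>, and \<open>S = \<Oplus>\<^sub>i N\<^sub>i\<close> for a possibly
  infinite family.\<close>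

definition is_direct_sum ::
  "('r, 'b) ring_scheme \<Rightarrow> ('r, 'm) module \<Rightarrow> 'm set \<Rightarrow> 'm set \<Rightarrow> 'm set \<Rightarrow> bool" where
  "is_direct_sum R M A B S \<longleftrightarrow>
     submodule A R M \<and> submodule B R M \<and> A <+>\<^bsub>M\<^esub> B = S \<and> A \<inter> B = {\<zero>\<^bsub>M\<^esub>}"

definition is_direct_sum_family ::
  "('r, 'b) ring_scheme \<Rightarrow> ('r, 'm) module \<Rightarrow> 'i set \<Rightarrow> ('i \<Rightarrow> 'm set) \<Rightarrow> 'm set \<Rightarrow> bool" where
  "is_direct_sum_family R M I N S \<longleftrightarrow>
     (\<forall>i\<in>I. submodule (N i) R M) \<and>
     bij_betw (\<lambda>f. \<Oplus>\<^bsub>M\<^esub>i\<in>{i \<in> I. f i \<noteq> \<zero>\<^bsub>M\<^esub>}. f i)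
       {f \<in> (\<Pi>\<^sub>E i\<in>I. N i). finite {i \<in> I. f i \<noteq> \<zero>\<^bsub>M\<^esub>}} S"


section \<open>Power classes as a Galois module\<close>

definition unit_powers :: "('a, 'b) ring_scheme \<Rightarrow> nat \<Rightarrow> 'a set" where
  "unit_powers L p = (\<lambda>x. x [^]\<^bsub>L\<^esub> p) ` carrier (Multiplicative_Group.mult_of L)"

definition pclass :: "('a, 'b) ring_scheme \<Rightarrow> nat \<Rightarrow> 'a \<Rightarrow> 'a set" where
  "pclass L p x = unit_powers L p #>\<^bsub>Multiplicative_Group.mult_of L\<^esub> x"

definition pclass_group :: "('a, 'b) ring_scheme \<Rightarrow> nat \<Rightarrow> 'a set monoid" where
  "pclass_group L p = Multiplicative_Group.mult_of L Mod unit_powers L p"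

abbreviation Fp :: "nat \<Rightarrow> int ring" where
  "Fp p \<equiv> residue_ring (int p)"

text \<open>The \<open>\<F>\<^sub>p[G]\<close>-module \<open>J\<close>. The module record is additive, so that the sum of two elements of
  \<open>J\<close> is the product of the cosets, zero is the class of \<open>1\<close>, and the scalar multiple of \<open>c\<close> by \<open>f\<close>
  is \<open>c\<^sup>f = \<Prod>\<^sub>\<tau> \<tau>(c)\<^bsup>f \<tau>\<^esup>\<close>. The ring fields \<open>mult\<close> and \<open>one\<close> play no role in a module.\<close>

definition pclass_module ::
  "('a, 'b) ring_scheme \<Rightarrow> 'a set \<Rightarrow> nat \<Rightarrow> (('a \<Rightarrow> 'a) \<Rightarrow> int, 'a set) module" where
  "pclass_module K F p =
     \<lparr>carrier = carrier (pclass_group K p), monoid.mult = undefined, one = undefined,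
      ring.zero = \<one>\<^bsub>pclass_group K p\<^esub>, ring.add = (\<otimes>\<^bsub>pclass_group K p\<^esub>),
      smult = \<lambda>f c. \<Otimes>\<^bsub>pclass_group K p\<^esub>\<tau>\<in>carrier (gal_group K F).
                       (\<tau> ` c) [^]\<^bsub>pclass_group K p\<^esub> f \<tau>\<rparr>"

text \<open>\<open>tau_minus_one K F p \<tau>\<close> is the element \<open>\<tau> - 1\<close> of \<open>\<F>\<^sub>p[G]\<close>.\<close>

definition tau_minus_one ::
  "('a, 'b) ring_scheme \<Rightarrow> 'a set \<Rightarrow> nat \<Rightarrow> ('a \<Rightarrow> 'a) \<Rightarrow> ('a \<Rightarrow> 'a) \<Rightarrow> int" where
  "tau_minus_one K F p \<tau> =
     gr_single (Fp p) (gal_group K F) \<one>\<^bsub>Fp p\<^esub> \<tau>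
       \<ominus>\<^bsub>group_ring (Fp p) (gal_group K F)\<^esub> \<one>\<^bsub>group_ring (Fp p) (gal_group K F)\<^esub>"

definition fixed_classes :: "('a \<Rightarrow> 'a) set \<Rightarrow> 'a set set \<Rightarrow> 'a set set" where
  "fixed_classes H Y = {c \<in> Y. \<forall>\<tau>\<in>H. \<tau> ` c = c}"

text \<open>The condition on \<open>\<delta>\<close> in the definitions of \<open>i(K/F)\<close> and of exceptional elements.\<close>

definition exceptional_at ::
  "('a, 'b) ring_scheme \<Rightarrow> 'a set \<Rightarrow> nat \<Rightarrow> nat extended \<Rightarrow> 'a \<Rightarrow> bool" where
  "exceptional_at K F p j \<delta> \<longleftrightarrow>
     \<delta> \<in> carrier (Multiplicative_Group.mult_of K) \<and>
     pclass (K\<lparr>carrier := F\<rparr>) p (gal_norm K F \<delta>) \<noteq> pclass (K\<lparr>carrier := F\<rparr>) p \<one>\<^bsub>K\<^esub> \<and>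
     (\<forall>\<tau>\<in>carrier (gal_group K F).
        tau_minus_one K F p \<tau> \<odot>\<^bsub>pclass_module K F p\<^esub> pclass K p \<delta>
          \<in> pclass K p ` inter_units K F p j)"

text \<open>The invariant \<open>i(K/F)\<close>. The set is empty only if all norms from \<open>K\<^sup>\<times>\<close> are \<open>p\<close>-th powers in
  \<open>F\<^sup>\<times>\<close>, and then no element is exceptional.\<close>

definition exc_index :: "('a, 'b) ring_scheme \<Rightarrow> 'a set \<Rightarrow> nat \<Rightarrow> nat \<Rightarrow> nat extended" where
  "exc_index K F p n =
     Min {i \<in> insert Minf (Fin ` {0..n}). \<exists>\<delta>. exceptional_at K F p i \<delta>}"

definition exceptional :: "('a, 'b) ring_scheme \<Rightarrow> 'a set \<Rightarrow> nat \<Rightarrow> nat \<Rightarrow> 'a \<Rightarrow> bool" where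
  "exceptional K F p n \<delta> \<longleftrightarrow> exceptional_at K F p (exc_index K F p n) \<delta>"

end

theory Submission
  imports Defs "HOL-Computational_Algebra.Polynomial"
begin

text \<open>
  Write \<open>x = \<sigma> - 1\<close>, \<open>E\<^sub>i = [K\<^sub>i\<^sup>\<times>]\<close>, and let \<open>Q\<close> be the group of classes whose norm to \<open>F\<close> is a
  \<open>p\<close>-th power in \<open>F\<close>. On \<open>J\<close> one has \<open>x\<^bsup>p^i\<^esup> = \<sigma>\<^bsup>p^i\<^esup> - 1\<close>, and the norm from \<open>K\<^sub>j\<close> to \<open>K\<^sub>i\<close> acts as
  \<open>x\<^bsup>p^j - p^i\<^esup>\<close>. Hilbert 90 gives two facts: a class of \<open>Q\<close> killed by \<open>x\<^bsup>p^i\<^esup>\<close> lies in \<open>E\<^sub>i\<close> (\<open>i < n\<close>),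
  and a class of \<open>E\<^sub>i\<close> (of \<open>E\<^sub>n \<inter> Q\<close>, if \<open>i = n\<close>) killed by \<open>x\<^bsup>p^i - 1\<^esup>\<close> lies in \<open>x E\<^sub>i + E\<^bsub>i-1\<^esub>\<close>.
  Let \<open>V\<^sub>i = x\<^bsup>p^i - 1\<^esup> E\<^sub>i\<close>, a decreasing filtration of \<open>[F\<^sup>\<times>]\<close>. Minimality of \<open>m = i(K/F)\<close> forces
  \<open>s = x\<^bsup>p^m\<^esup> [\<delta>]\<close> to lie in \<open>V\<^sub>m\<close> but not in \<open>V\<^bsub>m+1\<^esub>\<close> (if \<open>m = -\<infinity>\<close>, then \<open>s = [\<delta>]\<close> is not in
  \<open>[F\<^sup>\<times>]\<close> and is added to the basis below). Choose a basis of \<open>[F\<^sup>\<times>]\<close> adapted to the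
  filtration and containing \<open>s\<close>, and lift every other basis vector \<open>w \<in> V\<^sub>i - V\<^bsub>i+1\<^esub>\<close> to some
  \<open>\<alpha> \<in> E\<^sub>i\<close> with \<open>x\<^bsup>p^i - 1\<^esup> \<alpha> = w\<close>. The cyclic modules generated by \<open>[\<delta>]\<close> and these \<open>\<alpha>\<close> are
  independent because their socles are, and they span because the second fact gives
  \<open>E\<^sub>i \<subseteq> X + Y + x E\<^sub>i\<close> by induction on \<open>i\<close>.
\<close>

section \<open>Modules over \<open>\<int>[\<sigma>]\<close> with Hilbert 90\<close>

text \<open>The obstacle is that a norm may be a p-th power in K without being one in F; exceptional
  elements turn out to be of this kind. The second Hilbert 90 fact needs a root of the norm inside
  F. At level i < n a root in K is moved into F by an element t with (\<sigma>^(p^i) - 1) t = \<xi>.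
  At level n there is no such t, hence the condition involving Q, and a power of \<delta> does the
  repair instead. For this \<delta> must satisfy x^(p^n - 1) [\<delta>] = 1, which follows from p^m
  + 1 \<le> p^n - 1. An explicit exceptional element shows m \<le> n - 1, and then the inequality
  can fail only for p^n = 2 and m = 0. This is where the hypothesis for p = 2 enters: if -1 is a
  norm, an element with fixed class shows m = -\<infinity>. Minimality of m acts through a descent.
  If s = x^(p^(m+1) - 1) a, dividing [\<delta>] by a suitable x^r a gives a class outside Q killed
  by x^(p^m); the second fact lowers the killing exponent level by level until it contradicts the
  choice of m. In part (3), the components in Y of a class fixed by H_i lie in Q because those from
  level n are multiples of x.\<close>

locale op_group = comm_group A for A (structure) +
  fixes s :: "'a \<Rightarrow> 'a"
  assumes s_hom: "s \<in> hom A A"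
begin

text \<open>Horner evaluation of \<open>f\<close> at the endomorphism \<open>s\<close>, written
  multiplicatively, so that coefficients become exponents. Integer polynomials act on K^x as well as
  on J, and since they form a domain, identities between norms can be proved by cancelling a factor
  \<sigma>^(p^i) - 1.\<close>

definition act :: "int poly \<Rightarrow> 'a \<Rightarrow> 'a" where
  "act f = fold_coeffs (\<lambda>c h a. a [^] c \<otimes> s (h a)) f (\<lambda>a. \<one>)"

lemma s_closed [simp, intro]: "a \<in> carrier A \<Longrightarrow> s a \<in> carrier A"
  using s_hom by (auto simp: hom_def)

lemma s_mult [simp]: "a \<in> carrier A \<Longrightarrow> b \<in> carrier A \<Longrightarrow> s (a \<otimes> b) = s a \<otimes> s b"
  using s_hom by (auto simp: hom_def)

lemma s_one [simp]: "s \<one> = \<one>"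
  using s_hom hom_one is_group by blast

lemma s_int_pow: "a \<in> carrier A \<Longrightarrow> s (a [^] (c::int)) = s a [^] c"
  by (simp add: hom_int_pow[OF s_hom] is_group)

lemma act_0 [simp]: "act 0 a = \<one>"
  by (simp add: act_def)

lemma act_pCons: "act (pCons c f) a = a [^] c \<otimes> s (act f a)"
  by (cases "c = 0 \<and> f = 0") (auto simp: act_def fold_coeffs_pCons_eq)

lemma act_closed [simp, intro]: "a \<in> carrier A \<Longrightarrow> act f a \<in> carrier A"
  by (induction f) (auto simp: act_pCons)

lemma act_const: "a \<in> carrier A \<Longrightarrow> act [:c:] a = a [^] c"
  by (simp add: act_pCons)

lemma act_1 [simp]: "a \<in> carrier A \<Longrightarrow> act 1 a = a"
  by (simp add: one_pCons act_const)

lemma act_one [simp]: "act f \<one> = \<one>"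
  by (induction f) (auto simp: act_pCons)

lemma act_mult: "a \<in> carrier A \<Longrightarrow> b \<in> carrier A \<Longrightarrow> act f (a \<otimes> b) = act f a \<otimes> act f b"
  by (induction f) (auto simp: act_pCons int_pow_distrib m_ac)

lemma act_add: "a \<in> carrier A \<Longrightarrow> act (f + g) a = act f a \<otimes> act g a"
  by (induction f g rule: poly_induct2) (auto simp: act_pCons int_pow_mult m_ac)

lemma act_smult: "a \<in> carrier A \<Longrightarrow> act (Polynomial.smult c f) a = act f a [^] c"
  by (induction f) (auto simp: act_pCons s_int_pow int_pow_distrib int_pow_pow mult.commute)

lemma act_comp: "a \<in> carrier A \<Longrightarrow> act (f * g) a = act f (act g a)"
  by (induction f) (auto simp: act_pCons act_add act_smult)

lemma act_uminus: "a \<in> carrier A \<Longrightarrow> act (- f) a = inv (act f a)"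
  using act_smult[of a "-1" f] by (simp add: int_pow_neg)

lemma act_diff: "a \<in> carrier A \<Longrightarrow> act (f - g) a = act f a \<otimes> inv (act g a)"
  using act_add[of a f "-g"] by (simp add: act_uminus)

lemma act_inv: "a \<in> carrier A \<Longrightarrow> act f (inv a) = inv (act f a)"
  by (rule inv_equality[symmetric]) (auto simp flip: act_mult)

lemma act_int_pow: "a \<in> carrier A \<Longrightarrow> act f (a [^] (c::int)) = act f a [^] c"
  using act_comp[of a f "[:c:]"] act_smult[of a c f] by (simp add: act_const)

lemma act_nat_pow: "a \<in> carrier A \<Longrightarrow> act f (a [^] (c::nat)) = act f a [^] c"
  using act_int_pow[of a f "int c"] by (simp add: int_pow_int)

lemma act_of_nat: "a \<in> carrier A \<Longrightarrow> act (of_nat c) a = a [^] c"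
  by (simp add: of_nat_poly act_const int_pow_int)

lemma act_monom: "a \<in> carrier A \<Longrightarrow> act (monom 1 k) a = (s ^^ k) a"
proof (induction k)
  case (Suc k)
  moreover have "(s ^^ k) a \<in> carrier A" for k
    by (induction k) (use Suc.prems in auto)
  ultimately show ?case by (simp add: monom_Suc act_pCons)
qed (simp add: monom_0 act_const)

lemma act_commute: "a \<in> carrier A \<Longrightarrow> act f (act g a) = act g (act f a)"
  by (metis act_comp mult.commute)

lemma act_dvd_one: "a \<in> carrier A \<Longrightarrow> act g a = \<one> \<Longrightarrow> g dvd f \<Longrightarrow> act f a = \<one>"
  by (metis act_commute act_comp act_one dvdE)

end


text \<open>In \<open>\<int>[\<sigma>]\<close>, \<open>Tp p i\<close> is \<open>\<sigma>\<^bsup>p^i\<^esup>\<close>, and \<open>Nm p i j\<close> is the norm from \<open>K\<^sub>j\<close> to \<open>K\<^sub>i\<close>. The groups \<open>L i\<close>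
  below play the role of \<open>K\<^sub>i\<^sup>\<times>\<close>.\<close>

definition Tp :: "nat \<Rightarrow> nat \<Rightarrow> int poly" where
  "Tp p i = monom 1 (p ^ i)"

definition Nm :: "nat \<Rightarrow> nat \<Rightarrow> nat \<Rightarrow> int poly" where
  "Nm p i j = (\<Sum>k<p ^ (j - i). Tp p i ^ k)"

section \<open>Norm operators of the tower as integer polynomials\<close>

lemma Tp_power: "i \<le> j \<Longrightarrow> Tp p i ^ (p ^ (j - i)) = Tp p j"
  by (simp add: Tp_def monom_power flip: power_add)

lemma Tp_Nm: "i \<le> j \<Longrightarrow> (Tp p i - 1) * Nm p i j = Tp p j - 1"
  using power_diff_1_eq[of "Tp p i" "p ^ (j - i)"] by (simp add: Nm_def Tp_power)

lemma Tp_neq_1: "p > 0 \<Longrightarrow> Tp p i - 1 \<noteq> 0"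
proof
  assume "p > 0" "Tp p i - 1 = 0"
  then have "degree (monom (1::int) (p ^ i)) = degree (1 :: int poly)"
    by (simp add: Tp_def)
  with \<open>p > 0\<close> show False by (simp add: degree_monom_eq)
qed

text \<open>Multiplied by \<open>Tp p i - 1\<close>, both sides become \<open>Tp p k - 1\<close>;
  that factor is nonzero and can be cancelled, so no double sum has to be reindexed.\<close>

lemma Nm_Nm: "p > 0 \<Longrightarrow> i \<le> j \<Longrightarrow> j \<le> k \<Longrightarrow> Nm p i j * Nm p j k = Nm p i k"
proof -
  assume a: "p > 0" "i \<le> j" "j \<le> k"
  then have "(Tp p i - 1) * (Nm p i j * Nm p j k) = (Tp p i - 1) * Nm p i k"
    by (simp add: Tp_Nm flip: mult.assoc)
  then show ?thesis using Tp_neq_1[OF a(1), of i] by simp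
qed

text \<open>What the argument takes from field theory, stated for an abstract abelian group standing
  for K^x: Hilbert 90 for every layer K_j over K_i, and the fact that the p-th roots of unity are
  the powers of one element fixed by \<open>s\<close>. Addition in the field does not occur from
  here on.\<close>

locale galois_units = op_group A s for A (structure) and s +
  fixes p n :: nat and \<xi> :: 'a
  assumes p_prime: "Factorial_Ring.prime p"
    and act_Tp_n: "a \<in> carrier A \<Longrightarrow> act (Tp p n) a = a"
    and H90: "\<lbrakk>i \<le> j; j \<le> n; a \<in> carrier A; act (Tp p j) a = a; act (Nm p i j) a = \<one>\<rbrakk>
       \<Longrightarrow> \<exists>b\<in>carrier A. act (Tp p j) b = b \<and> act (Tp p i - 1) b = a"
    and xi_closed [simp]: "\<xi> \<in> carrier A" and s_xi: "s \<xi> = \<xi>" and xi_neq: "\<xi> \<noteq> \<one>"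
    and xi_pow: "\<xi> [^] p = \<one>"
    and xi_gen: "\<lbrakk>a \<in> carrier A; a [^] p = \<one>\<rbrakk> \<Longrightarrow> \<exists>k::nat. a = \<xi> [^] k"
begin

section \<open>The layers of the tower and the roots of unity\<close>

lemma p_pos: "p > 0" using p_prime by (simp add: prime_gt_0_nat)

definition L :: "nat \<Rightarrow> 'a set" where
  "L i = {a \<in> carrier A. act (Tp p i) a = a}"

lemma L_iff: "a \<in> L i \<longleftrightarrow> a \<in> carrier A \<and> act (Tp p i - 1) a = \<one>"
  using inv_solve_right'[of \<one> "act (Tp p i) a" a]
  by (auto simp: L_def act_diff)

lemma L_closed: "a \<in> L i \<Longrightarrow> a \<in> carrier A" by (simp add: L_def)

lemma L_n: "L n = carrier A" using act_Tp_n by (auto simp: L_def)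

lemma L_mult: "a \<in> L i \<Longrightarrow> b \<in> L i \<Longrightarrow> a \<otimes> b \<in> L i"
  by (auto simp: L_def act_mult)

lemma L_inv: "a \<in> L i \<Longrightarrow> inv a \<in> L i"
  by (auto simp: L_def act_inv)

lemma L_pow: "a \<in> L i \<Longrightarrow> a [^] (k::nat) \<in> L i"
  by (auto simp: L_def act_nat_pow)

lemma L_act: "a \<in> L i \<Longrightarrow> act f a \<in> L i"
  by (auto simp: L_def act_commute[of _ "Tp p i"])

lemma L_mono: "a \<in> L i \<Longrightarrow> i \<le> j \<Longrightarrow> a \<in> L j"
  unfolding L_iff using act_dvd_one[of a "Tp p i - 1" "Tp p j - 1"] Tp_Nm[of i j p]
  by (metis dvd_triv_left)

text \<open>Modulo \<open>Tp p i - 1\<close>, which kills \<open>a\<close>, every summand of the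
  norm operator is 1, so the operator acts as the number of its summands.\<close>

lemma act_Nm_L: "a \<in> L i \<Longrightarrow> act (Nm p i j) a = a [^] (p ^ (j - i))"
proof -
  assume a: "a \<in> L i"
  have ac: "a \<in> carrier A" using a by (simp add: L_def)
  have "(Tp p i - 1) dvd (\<Sum>k<p ^ (j - i). Tp p i ^ k - 1)"
    by (intro dvd_sum) (metis dvd_triv_left power_diff_1_eq)
  then obtain S where S: "Nm p i j - of_nat (p ^ (j - i)) = (Tp p i - 1) * S"
    by (auto simp: Nm_def sum_subtractf elim!: dvdE)
  have "act (Nm p i j - of_nat (p ^ (j - i))) a = \<one>"
    by (rule act_dvd_one[of a "Tp p i - 1", OF ac]) (use a in \<open>simp_all only: S L_iff dvd_triv_left\<close>)
  then show ?thesis using ac inv_solve_right'[of \<one> "act (Nm p i j) a" "a [^] (p ^ (j - i))"]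
    by (simp only: act_diff act_of_nat act_closed nat_pow_closed one_closed l_one)
qed

lemma Nm_L: "a \<in> L j \<Longrightarrow> i \<le> j \<Longrightarrow> act (Nm p i j) a \<in> L i"
  unfolding L_iff
  by (auto simp flip: act_comp simp: Tp_Nm)

lemma Tp_0: "Tp p 0 = [:0, 1:]" by (simp add: Tp_def monom_Suc monom_0)

lemma L_0: "a \<in> L 0 \<longleftrightarrow> a \<in> carrier A \<and> s a = a"
  by (auto simp: L_def Tp_0 act_pCons)

lemma xi_L: "\<xi> \<in> L i"
  using L_0 s_xi L_mono[of \<xi> 0 i] by simp

lemma xi_pow_L: "\<xi> [^] (k::nat) \<in> L i" by (intro L_pow xi_L)

lemma xi_pow_one: "\<xi> [^] (k::nat) = \<one> \<longleftrightarrow> p dvd k"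
proof
  assume k: "\<xi> [^] k = \<one>"
  have "ord \<xi> dvd p" "ord \<xi> dvd k" "ord \<xi> \<noteq> 1"
    using xi_pow k pow_eq_id[of \<xi>] xi_neq ord_eq_1[of \<xi>] by auto
  then show "p dvd k" using p_prime by (metis prime_nat_iff)
next
  assume "p dvd k"
  then show "\<xi> [^] k = \<one>" using xi_pow by (auto simp flip: nat_pow_pow elim!: dvdE)
qed

text \<open>The root \<open>f\<close> is demanded in F and not merely in K. This distinction is what
  separates exceptional elements from the others.\<close>

definition pnorm :: "'a \<Rightarrow> bool" where
  "pnorm a \<longleftrightarrow> (\<exists>f\<in>L 0. act (Nm p 0 n) a = f [^] p)"

text \<open>The p-th power of (\<sigma> - 1) f is (\<sigma> - 1) a = 1. The resulting root of unity
  is the Kummer pairing of \<open>a\<close> with \<sigma>; it measures how far the root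
  \<open>f\<close> is from lying in F, and the repairs below consist in making it trivial.\<close>

lemma root_move:
  assumes "a \<in> L 0" "f \<in> carrier A" "a = f [^] p"
  shows "\<exists>k::nat. act (Tp p 0 - 1) f = \<xi> [^] k"
proof (rule xi_gen)
  show "act (Tp p 0 - 1) f [^] p = \<one>"
    using assms by (simp add: L_iff flip: act_nat_pow)
qed (use assms in auto)

text \<open>If b = (\<sigma>^(p^i) - 1) c, then g divided by c^p lies in K_i. By Hilbert 90 it is
  enough that \<open>b\<close> has norm 1 over K_i. This norm equals (\<sigma>^(p^i) - 1) th for a
  certain p-th root \<open>th\<close> of the norm of \<open>g\<close>, so the claim reduces to
  \<open>th\<close> being in K_i, and this is where the root in F given by \<open>pnorm g\<close> is
  used.\<close>

lemma fixed_class: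
  assumes i: "i < n" and g: "g \<in> carrier A" and b: "b \<in> carrier A"
    and gb: "act (Tp p i - 1) g = b [^] p" and np: "pnorm g"
  shows "\<exists>a\<in>L i. \<exists>c\<in>carrier A. g = a \<otimes> c [^] p"
proof -
  define r where "r = p ^ (n - Suc i)"
  have pr: "p ^ (n - i) = p * r" using i by (simp add: r_def Suc_diff_Suc flip: power_Suc)
  have "(Tp p i - 1) dvd (\<Sum>k<p ^ (n - i). Tp p i ^ k - 1)"
    by (intro dvd_sum) (metis dvd_triv_left power_diff_1_eq)
  then obtain S where S: "Nm p i n = (Tp p i - 1) * S + of_nat (p * r)"
    by (auto simp: Nm_def sum_subtractf pr algebra_simps elim!: dvdE)
  \<comment> \<open>Modulo \<sigma>^(p^i) - 1 the norm operator is the number p r, and the remaining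
    multiple of \<sigma>^(p^i) - 1 turns \<open>g\<close> into a p-th power by \<open>gb\<close>. So
    a p-th root of the norm of \<open>g\<close> can be written down, with r = p^(n-i-1) available
    because i < n.\<close>
  define th where "th = g [^] r \<otimes> act S b"
  have th: "th \<in> carrier A" using g b by (simp add: th_def)
  have thp: "th [^] p = act (Nm p i n) g"
  proof -
    have "th [^] p = g [^] (p * r) \<otimes> act S (b [^] p)"
      using g b by (simp add: th_def nat_pow_distrib nat_pow_pow act_nat_pow mult.commute)
    also have "act S (b [^] p) = act ((Tp p i - 1) * S) g"
      using g by (simp add: act_comp mult.commute flip: gb)
    finally show ?thesis using g by (simp add: S act_add act_of_nat m_comm del: of_nat_mult)
  qed
  have tht: "act (Tp p i - 1) th = act (Nm p i n) b"
    using g b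
    by (simp add: th_def act_mult act_nat_pow gb nat_pow_pow S act_add act_of_nat m_comm act_comp
        del: of_nat_mult)
  obtain f where f: "f \<in> L 0" "act (Nm p 0 n) g = f [^] p" using np by (auto simp: pnorm_def)
  \<comment> \<open>The operator of the norm from K_i to F is applied formally, before
    \<open>th\<close> is known to lie in K_i. Since (\<sigma> - 1) \<open>Nm p 0 i\<close> =
    \<sigma>^(p^i) - 1, having \<open>ph\<close> in F is the same as having \<open>th\<close> in
    K_i.\<close>
  define ph where "ph = act (Nm p 0 i) th"
  have ph: "ph \<in> carrier A" using th by (simp add: ph_def)
  have "ph [^] p = f [^] p"
  proof -
    have "ph [^] p = act (Nm p 0 i) (act (Nm p i n) g)" using th by (simp add: ph_def thp flip: act_nat_pow)
    also have "\<dots> = f [^] p" using i g by (simp add: Nm_Nm p_pos f(2) flip: act_comp)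
    finally show ?thesis .
  qed
  then have "(ph \<otimes> inv f) [^] p = \<one>"
    using ph f by (simp add: nat_pow_distrib nat_pow_inv L_closed)
  then obtain k :: nat where k: "ph \<otimes> inv f = \<xi> [^] k"
    using xi_gen[of "ph \<otimes> inv f"] ph f by (auto simp: L_closed)
  then have "ph = \<xi> [^] k \<otimes> f" using ph f by (simp add: L_closed inv_solve_right')
  then have "ph \<in> L 0" using L_mult[OF xi_pow_L f(1)] by simp
  then have "act (Tp p i - 1) th = \<one>"
    using th by (simp add: L_iff ph_def Tp_Nm flip: act_comp)
  then have "act (Nm p i n) b = \<one>" by (simp add: tht)
  then obtain c where c: "c \<in> carrier A" "act (Tp p i - 1) c = b"
    using H90[of i n b] i b act_Tp_n by auto
  have "act (Tp p i - 1) (g \<otimes> inv (c [^] p)) = \<one>"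
    using c g b gb by (simp add: act_mult act_inv act_nat_pow)
  then have "g \<otimes> inv (c [^] p) \<in> L i" using g c by (simp add: L_iff)
  moreover have "g = (g \<otimes> inv (c [^] p)) \<otimes> c [^] p"
    using g c by (simp add: m_assoc)
  ultimately show ?thesis using c by blast
qed

text \<open>The norm of \<xi> from K to K_i is \<xi>^(p^(n-i)) = 1 because i < n. For i = n - 1 such
  a t is a Kummer generator of K over K_(n-1). These elements correct roots in
  \<open>norm_pth_power\<close> and supply the exceptional elements.\<close>

lemma norm_root_exists:
  assumes i: "i \<le> n" "i \<noteq> n"
  shows "\<exists>t\<in>carrier A. act (Tp p i - 1) t = \<xi>"
proof -
  have "act (Nm p i n) \<xi> = \<xi> [^] (p ^ (n - i))" by (rule act_Nm_L[OF xi_L])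
  also have "\<dots> = \<one>" using i by (subst xi_pow_one) auto
  finally show ?thesis using H90[of i n \<xi>] i act_Tp_n by auto
qed

text \<open>The root \<open>h\<close> is multiplied by some \<xi>^k under \<sigma>. If
  (\<sigma>^(p^i) - 1) t = \<xi>, then the formal norm \<open>ph\<close> of t satisfies (\<sigma> -
  1) ph = \<xi>. Dividing \<open>g\<close> by the p-th power of t^k leaves its class alone, divides
  \<open>h\<close> by ph^k and so moves the root into F.\<close>

lemma norm_pth_power:
  assumes i: "i < n" and g: "g \<in> L i" and h: "h \<in> carrier A" "act (Nm p 0 i) g = h [^] p"
  shows "\<exists>a\<in>L i. \<exists>c\<in>carrier A. g = a \<otimes> c [^] p \<and> (\<exists>f\<in>L 0. act (Nm p 0 i) a = f [^] p)"
proof -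
  obtain t where t: "t \<in> carrier A" "act (Tp p i - 1) t = \<xi>" using norm_root_exists[of i] i by auto
  define ph where "ph = act (Nm p 0 i) t"
  have ph: "ph \<in> carrier A" "act (Tp p 0 - 1) ph = \<xi>"
    using t by (simp_all add: ph_def Tp_Nm flip: act_comp)
  have gc: "g \<in> carrier A" using g by (rule L_closed)
  obtain k :: nat where k: "act (Tp p 0 - 1) h = \<xi> [^] k"
    using root_move[OF _ h(1) h(2)] Nm_L[OF g, of 0] by auto
  define c where "c = t [^] k"
  have c: "c \<in> carrier A" using t by (simp add: c_def)
  \<comment> \<open>Although \<open>c\<close> itself need not be in K_i, its p-th power is:
    \<sigma>^(p^i) changes \<open>c\<close> only by a p-th root of unity.\<close>
  have cL: "c [^] p \<in> L i"
  proof -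
    have "act (Tp p i - 1) (c [^] p) = (\<xi> [^] k) [^] p" using t by (simp add: c_def act_nat_pow)
    also have "\<dots> = \<one>" using xi_pow_one[of "k * p"] by (simp add: nat_pow_pow)
    finally show ?thesis using c by (simp add: L_iff)
  qed
  define a where "a = g \<otimes> inv (c [^] p)"
  have a: "a \<in> L i" unfolding a_def by (intro L_mult g L_inv cL)
  define f where "f = h \<otimes> inv (ph [^] k)"
  have "act (Tp p 0 - 1) f = \<one>"
    using h ph k by (simp add: f_def act_mult act_inv act_nat_pow)
  then have f: "f \<in> L 0" using h ph by (simp add: L_iff f_def)
  have "act (Nm p 0 i) c = ph [^] k" using t by (simp add: c_def ph_def act_nat_pow)
  then have "act (Nm p 0 i) a = f [^] p"
    using h ph gc c by (simp add: a_def f_def act_mult act_inv act_nat_pow nat_pow_distrib nat_pow_inv)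
  moreover have "g = a \<otimes> c [^] p" using gc c by (simp add: a_def m_assoc)
  ultimately show ?thesis using a c f by blast
qed

text \<open>Let j = i - 1. As \<open>f\<close> is in F, f^p is its norm from K_i to K_j, so the norm
  of \<open>g\<close> formed with \<open>Nm p 0 j\<close>, divided by \<open>f\<close>, has norm 1
  over K_j and equals (\<sigma>^(p^j) - 1) b. Dividing \<open>g\<close> by (\<sigma> - 1) b leaves
  an element \<open>a\<close> with \<open>Nm p 0 j\<close> a = f; applying \<sigma> - 1 shows that
  \<sigma>^(p^j) fixes \<open>a\<close>.\<close>

lemma norm_fixed_pth_power:
  assumes i: "0 < i" "i \<le> n" and g: "g \<in> L i" and f: "f \<in> L 0" "act (Nm p 0 i) g = f [^] p"
  shows "\<exists>a\<in>L (i - 1). \<exists>b\<in>L i. g = act (Tp p 0 - 1) b \<otimes> a"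
proof -
  obtain j where j: "i = Suc j" using i(1) by (cases i) auto
  have gc: "g \<in> carrier A" and fc: "f \<in> carrier A" using g f by (auto simp: L_closed)
  have fj: "act (Nm p j i) f = f [^] p" using act_Nm_L[of f j i] L_mono[OF f(1)] j by simp
  define e where "e = act (Nm p 0 j) g \<otimes> inv f"
  have e: "e \<in> L i" unfolding e_def using L_mono[OF f(1)] by (intro L_mult L_act g L_inv) simp
  have "act (Nm p j i) (act (Nm p 0 j) g) = f [^] p"
    using f(2) gc j Nm_Nm[of p 0 j i] p_pos by (simp add: mult.commute flip: act_comp)
  then have "act (Nm p j i) e = \<one>"
    using gc fc fj by (simp add: e_def act_mult act_inv)
  then obtain b where b: "b \<in> L i" "act (Tp p j - 1) b = e"
    using H90[of j i e] e i j by (auto simp: L_def)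
  have bc: "b \<in> carrier A" using b by (simp add: L_closed)
  define a where "a = g \<otimes> inv (act (Tp p 0 - 1) b)"
  have "act (Nm p 0 j) (act (Tp p 0 - 1) b) = e"
    using bc b(2) Tp_Nm[of 0 j p] by (simp add: mult.commute flip: act_comp)
  then have "act (Nm p 0 j) a = act (Nm p 0 j) g \<otimes> inv e"
    using gc bc by (simp add: a_def act_mult act_inv)
  also have "\<dots> = f" using gc fc by (simp add: e_def inv_mult) (simp add: m_assoc[symmetric])
  finally have af: "act (Nm p 0 j) a = f" .
  have ac: "a \<in> carrier A" using gc bc by (simp add: a_def)
  have "act (Tp p j - 1) a = act (Tp p 0 - 1) f"
    using ac Tp_Nm[of 0 j p] by (simp flip: af act_comp)
  also have "\<dots> = \<one>" using f(1) by (simp add: L_iff)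
  finally have "a \<in> L j" using ac by (simp add: L_iff)
  moreover have "g = act (Tp p 0 - 1) b \<otimes> a" using gc bc
    by (simp add: a_def m_lcomm)
  ultimately show ?thesis using b(1) j by auto
qed

section \<open>Elements whose norm is, or is not, a p-th power in F\<close>

lemma pnorm_mult: "pnorm a \<Longrightarrow> pnorm b \<Longrightarrow> a \<in> carrier A \<Longrightarrow> b \<in> carrier A \<Longrightarrow> pnorm (a \<otimes> b)"
  unfolding pnorm_def by (metis L_closed L_mult act_mult nat_pow_distrib)

lemma pnorm_inv: "pnorm a \<Longrightarrow> a \<in> carrier A \<Longrightarrow> pnorm (inv a)"
  unfolding pnorm_def by (metis L_closed L_inv act_inv nat_pow_inv)

lemma pnorm_pow: "a \<in> carrier A \<Longrightarrow> pnorm (a [^] p)"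
  unfolding pnorm_def by (metis L_n Nm_L act_nat_pow le0)

lemma pnorm_diff: "a \<in> carrier A \<Longrightarrow> pnorm (act (Tp p 0 - 1) a)"
  unfolding pnorm_def using Tp_Nm[of 0 n p] L_iff[of a n] L_n
  by (intro bexI[of _ \<one>]) (auto simp: L_iff mult.commute simp flip: act_comp)

lemma pnorm_L:
  assumes "i < n" "a \<in> L i"
  shows "pnorm a"
proof -
  have a: "a \<in> carrier A" using assms by (simp add: L_closed)
  have "act (Nm p 0 n) a = act (Nm p 0 i) (act (Nm p i n) a)"
    using assms a by (simp add: Nm_Nm p_pos flip: act_comp)
  also have "\<dots> = act (Nm p 0 i) a [^] (p ^ (n - i))" using assms a by (simp add: act_Nm_L act_nat_pow)
  also have "\<dots> = (act (Nm p 0 i) a [^] (p ^ (n - Suc i))) [^] p"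
    using assms a by (simp add: nat_pow_pow Suc_diff_Suc mult.commute flip: power_Suc)
  finally show ?thesis unfolding pnorm_def using Nm_L[OF assms(2), of 0] by (blast intro: L_pow)
qed

text \<open>Modulo elements satisfying \<open>pnorm\<close>, those whose norm is a p-th power in K
  form at most a line, because the only obstruction is the exponent of \<xi> from
  \<open>root_move\<close>, a residue modulo p. For \<open>d\<close> this residue is nonzero, so a
  power of \<open>d\<close> cancels that of \<open>g\<close>.\<close>

lemma pnorm_adjust:
  assumes g: "g \<in> carrier A" "h \<in> carrier A" "act (Nm p 0 n) g = h [^] p"
    and d: "d \<in> carrier A" "k \<in> carrier A" "act (Nm p 0 n) d = k [^] p" and nd: "\<not> pnorm d"
  shows "\<exists>c::nat. pnorm (g \<otimes> d [^] c)"
proof -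
  obtain u :: nat where u: "act (Tp p 0 - 1) h = \<xi> [^] u"
    using root_move[OF _ g(2,3)] Nm_L[of g n 0] L_n g by auto
  obtain v :: nat where v: "act (Tp p 0 - 1) k = \<xi> [^] v"
    using root_move[OF _ d(2,3)] Nm_L[of d n 0] L_n d by auto
  have "\<not> p dvd v"
  proof
    assume "p dvd v"
    then have "k \<in> L 0" using v d xi_pow_one[of v] by (simp add: L_iff)
    with nd d show False by (auto simp: pnorm_def)
  qed
  then have "coprime v p" using p_prime by (metis coprime_commute prime_imp_coprime)
  then obtain w where w: "[v * w = 1] (mod p)" using cong_solve_coprime_nat[of v p] by auto
  \<comment> \<open>This is -u/v modulo p, with (p - 1) u in place of -u to remain in the natural
    numbers.\<close>
  define c where "c = w * ((p - 1) * u)"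
  have "[u + v * c = u + 1 * ((p - 1) * u)] (mod p)"
    unfolding c_def mult.assoc[symmetric] by (intro cong_add cong_refl cong_mult w)
  moreover have "u + 1 * ((p - 1) * u) = p * u" using p_pos by (cases p) auto
  ultimately have "p dvd u + v * c" using cong_dvd_iff by (metis dvd_triv_left)
  then have one: "\<xi> [^] (u + v * c) = \<one>" by (simp add: xi_pow_one)
  have "act (Tp p 0 - 1) (h \<otimes> k [^] c) = \<one>"
    using g d u v one by (simp add: act_mult act_nat_pow nat_pow_pow nat_pow_mult)
  then have "h \<otimes> k [^] c \<in> L 0" using g d by (simp add: L_iff)
  moreover have "act (Nm p 0 n) (g \<otimes> d [^] c) = (h \<otimes> k [^] c) [^] p"
    using g d by (simp add: act_mult act_nat_pow nat_pow_distrib nat_pow_pow mult.commute)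
  ultimately show ?thesis by (auto simp: pnorm_def)
qed

text \<open>Two p-th roots of the norm differ by a power of \<xi>, which is in F. So either all of
  them lie in F or none does, and it suffices to exhibit one that \<sigma> moves.\<close>

lemma not_pnormI:
  assumes "a \<in> carrier A" "h \<in> carrier A" "act (Nm p 0 n) a = h [^] p" "act (Tp p 0 - 1) h = \<xi>"
  shows "\<not> pnorm a"
proof
  assume "pnorm a"
  then obtain f where f: "f \<in> L 0" "h [^] p = f [^] p" using assms by (auto simp: pnorm_def)
  then have "(h \<otimes> inv f) [^] p = \<one>"
    using assms by (simp add: nat_pow_distrib nat_pow_inv L_closed)
  then obtain k :: nat where k: "h \<otimes> inv f = \<xi> [^] k"
    using xi_gen[of "h \<otimes> inv f"] assms f by (auto simp: L_closed)
  then have "h = \<xi> [^] k \<otimes> f" using assms f by (simp add: L_closed inv_solve_right')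
  then have "h \<in> L 0" using L_mult[OF xi_pow_L f(1)] by simp
  then show False using assms xi_neq by (simp add: L_iff)
qed

text \<open>The witness is the t with \<sigma>^(p^(n-1)) t = \<xi> t. Its norm to K_(n-1) is t^p up
  to a power of \<xi>, and if that power disappears in the norm to F, the norm of t is the p-th
  power of an \<open>h\<close> with (\<sigma> - 1) h = \<xi>. Moreover (\<sigma>^(p^(n-1)) - 1)
  kills (\<sigma> - 1) t, since \<xi> is fixed by \<sigma>.\<close>

lemma exceptional_exists:
  assumes n: "n \<ge> 1" and c: "p = 2 \<Longrightarrow> n > 1"
  shows "\<exists>d\<in>carrier A. \<not> pnorm d \<and> act (Tp p 0 - 1) d \<in> L (n - 1)"
proof -
  obtain q where q: "n = Suc q" using n by (cases n) auto
  obtain t where t: "t \<in> carrier A" "act (Tp p q - 1) t = \<xi>"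
    using norm_root_exists[of q] q by auto
  have st: "(s ^^ k) t \<in> carrier A" for k using t by (induction k) auto
  have tk: "act (Tp p q ^ k) t = t \<otimes> \<xi> [^] k" for k
  proof (induction k)
    case (Suc k)
    have t1: "act (Tp p q) t = \<xi> \<otimes> t"
      using t by (simp add: act_diff inv_solve_right')
    have "act (Tp p q ^ Suc k) t = act (Tp p q) (act (Tp p q ^ k) t)"
      using t by (simp add: act_comp)
    also have "\<dots> = \<xi> \<otimes> t \<otimes> \<xi> [^] k"
      using t xi_pow_L[of k q] by (simp add: Suc act_mult t1 L_def)
    finally show ?case using t by (simp add: m_ac)
  qed (use t in simp)
  have "act (\<Sum>k<r. Tp p q ^ k) t = t [^] r \<otimes> \<xi> [^] (r * (r - 1) div 2)" for r
  proof (induction r)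
    case (Suc r)
    have "Suc r * (Suc r - 1) div 2 = r * (r - 1) div 2 + r" by (cases r) auto
    with Suc t show ?case by (simp add: act_add tk m_ac flip: nat_pow_mult)
  qed (use t in simp)
  then have Nt: "act (Nm p q n) t = t [^] p \<otimes> \<xi> [^] (p * (p - 1) div 2)"
    by (simp add: Nm_def q)
  \<comment> \<open>For odd p the number p(p-1)/2 is already a multiple of p. For p = 2 it is 1, and
    the factor p^q, contributed by the norm of \<xi> from K_q to F, has to be even.\<close>
  have "p dvd p ^ q * (p * (p - 1) div 2)"
  proof (cases "p = 2")
    case True
    then have "q > 0" using c q by auto
    then show ?thesis by (simp add: dvd_mult2)
  next
    case False
    then have "odd p" using p_prime primes_dvd_imp_eq two_is_prime_nat by blast
    then have "p * (p - 1) div 2 = p * ((p - 1) div 2)" by (simp add: div_mult_swap)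
    then show ?thesis by simp
  qed
  then have x1: "(\<xi> [^] (p * (p - 1) div 2)) [^] (p ^ q) = \<one>"
    using xi_pow_one by (simp add: nat_pow_pow mult.commute)
  define h where "h = act (Nm p 0 q) t"
  have h: "h \<in> carrier A" "act (Tp p 0 - 1) h = \<xi>"
    using t by (simp_all add: h_def Tp_Nm flip: act_comp)
  have "act (Nm p 0 n) t = act (Nm p 0 q) (act (Nm p q n) t)"
    using t q by (simp add: Nm_Nm p_pos flip: act_comp)
  also have "\<dots> = h [^] p"
    using t x1 act_Nm_L[OF xi_L, of 0 q] by (simp add: Nt act_mult act_nat_pow h_def nat_pow_pow mult.commute)
  finally have "\<not> pnorm t" using t h by (intro not_pnormI)
  moreover have "act (Tp p 0 - 1) t \<in> L q"
    using t xi_L[of 0] unfolding L_iff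
    by (simp add: act_commute[of t "Tp p q - 1"])
  ultimately show ?thesis using t q by auto
qed

text \<open>Here 1 + \<sigma> = (\<sigma> - 1) + 2, so the norm of t is \<xi> t^2. Multiplying t by
  an \<open>e\<close> of norm \<xi> makes it t^2, and (\<sigma> - 1)(t e) becomes the square of the
  inverse of \<open>e\<close>; the class of t e is therefore fixed, which is the index
  -\<infinity>.\<close>

lemma exceptional_exists_quadratic:
  assumes n: "n = 1" and p: "p = 2" and e: "e \<in> carrier A" "act (Nm p 0 n) e = \<xi>"
  shows "\<exists>d\<in>carrier A. \<not> pnorm d \<and> (\<exists>c\<in>carrier A. act (Tp p 0 - 1) d = c [^] p)"
proof -
  obtain t where t: "t \<in> carrier A" "act (Tp p 0 - 1) t = \<xi>"
    using norm_root_exists[of 0] n by auto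
  have N: "Nm p 0 n = (Tp p 0 - 1) + [:2:]"
    by (simp add: Nm_def n p lessThan_Suc numeral_2_eq_2 one_pCons)
  have Na: "act (Nm p 0 n) a = act (Tp p 0 - 1) a \<otimes> a [^] (2::nat)" if "a \<in> carrier A" for a
    unfolding N using that by (simp add: act_add act_const flip: int_pow_int)
  have xx: "\<xi> \<otimes> \<xi> = \<one>" using xi_pow p by (simp add: numeral_2_eq_2)
  have "act (Nm p 0 n) (t \<otimes> e) = t [^] (2::nat)"
    using t e xx by (simp add: act_mult Na[of t]) (simp add: m_ac flip: m_assoc)
  then have "\<not> pnorm (t \<otimes> e)"
    using t e p by (intro not_pnormI[of _ t]) auto
  moreover have "act (Tp p 0 - 1) (t \<otimes> e) = (inv e) [^] p"
  proof -
    have "act (Tp p 0 - 1) e = \<xi> \<otimes> inv (e [^] (2::nat))"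
      using Na[of e] e by (simp add: inv_solve_right)
    then show ?thesis
      using t e xx p by (simp add: act_mult nat_pow_inv flip: m_assoc)
  qed
  ultimately show ?thesis using t e by blast
qed

end

section \<open>Independent families of subgroups\<close>

context comm_group
begin

text \<open>J may be infinite-dimensional, so sums and relations range over finite subsets
  \<open>T\<close> of the index set; values of \<open>f\<close> outside \<open>T\<close> do not
  enter.\<close>

definition fsum :: "'i set \<Rightarrow> ('i \<Rightarrow> 'a set) \<Rightarrow> 'a set" where
  "fsum I N = {finprod G f T | T f. finite T \<and> T \<subseteq> I \<and> (\<forall>t\<in>T. f t \<in> N t)}"

definition indep_fam :: "'i set \<Rightarrow> ('i \<Rightarrow> 'a set) \<Rightarrow> bool" where
  "indep_fam I N \<longleftrightarrow> (\<forall>T f. finite T \<longrightarrow> T \<subseteq> I \<longrightarrow> (\<forall>t\<in>T. f t \<in> N t) \<longrightarrow>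
     finprod G f T = \<one> \<longrightarrow> (\<forall>t\<in>T. f t = \<one>))"

lemma fsumI: "\<lbrakk>finite T; T \<subseteq> I; \<And>t. t \<in> T \<Longrightarrow> f t \<in> N t\<rbrakk> \<Longrightarrow> finprod G f T \<in> fsum I N"
  unfolding fsum_def by blast

lemma fsumE:
  assumes "v \<in> fsum I N"
  obtains T f where "finite T" "T \<subseteq> I" "\<forall>t\<in>T. f t \<in> N t" "v = finprod G f T"
  using assms unfolding fsum_def by blast

lemma indep_famD:
  "\<lbrakk>indep_fam I N; finite T; T \<subseteq> I; \<And>t. t \<in> T \<Longrightarrow> f t \<in> N t; finprod G f T = \<one>; t \<in> T\<rbrakk> \<Longrightarrow> f t = \<one>"
  unfolding indep_fam_def by blast

lemma indep_fam_mono: "indep_fam I N \<Longrightarrow> I' \<subseteq> I \<Longrightarrow> indep_fam I' N"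
  unfolding indep_fam_def by blast

lemma fsum_mono: "I' \<subseteq> I \<Longrightarrow> fsum I' N \<subseteq> fsum I N"
  unfolding fsum_def by blast

lemma fsum_incl:
  assumes "\<And>i. i \<in> I \<Longrightarrow> subgroup (N i) G" "i \<in> I" shows "N i \<subseteq> fsum I N"
proof
  fix v assume v: "v \<in> N i"
  have "v \<in> carrier G" by (rule subgroup.mem_carrier[OF assms(1)[OF assms(2)] v])
  then have "v = finprod G (\<lambda>_. v) {i}" by simp
  then show "v \<in> fsum I N" using fsumI[of "{i}" I "\<lambda>_. v" N] v assms by simp
qed

lemma finprod_pad:
  assumes "finite U" "T \<subseteq> U" "\<And>t. t \<in> T \<Longrightarrow> f t \<in> carrier G"
  shows "finprod G f T = finprod G (\<lambda>t. if t \<in> T then f t else \<one>) U"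
proof -
  have "finprod G (\<lambda>t. if t \<in> T then f t else \<one>) U = finprod G (\<lambda>t. if t \<in> T then f t else \<one>) T"
    using assms by (intro finprod_mono_neutral_cong_right) auto
  also have "\<dots> = finprod G f T" using assms by (intro finprod_cong') auto
  finally show ?thesis by simp
qed

lemma fsum_subgroup:
  assumes N: "\<And>i. i \<in> I \<Longrightarrow> subgroup (N i) G"
  shows "subgroup (fsum I N) G"
proof
  have car: "\<And>i v. i \<in> I \<Longrightarrow> v \<in> N i \<Longrightarrow> v \<in> carrier G"
    by (rule subgroup.mem_carrier[OF N])
  show "fsum I N \<subseteq> carrier G"
    by (auto elim!: fsumE intro!: finprod_closed dest: car)
  show "\<one> \<in> fsum I N" using fsumI[of "{}" I] by simp
  fix v assume "v \<in> fsum I N"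
  then obtain T f where T: "finite T" "T \<subseteq> I" "\<forall>t\<in>T. f t \<in> N t" "v = finprod G f T"
    by (rule fsumE)
  then have fc: "f \<in> T \<rightarrow> carrier G" using car by blast
  have "inv v = finprod G (\<lambda>t. inv (f t)) T"
    unfolding T(4)
  proof (rule inv_equality)
    have "finprod G (\<lambda>t. inv f t) T \<otimes> finprod G f T = finprod G (\<lambda>t. inv f t \<otimes> f t) T"
      using fc by (subst finprod_multf) auto
    also have "\<dots> = \<one>" using fc by (intro finprod_one_eqI) (auto simp: Pi_iff)
    finally show "finprod G (\<lambda>t. inv f t) T \<otimes> finprod G f T = \<one>" .
  qed (use fc in \<open>auto intro!: finprod_closed\<close>)
  then show "inv v \<in> fsum I N"
    using T by (auto intro!: fsumI subgroup.m_inv_closed[OF N])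
  fix w assume "w \<in> fsum I N"
  then obtain U g where U: "finite U" "U \<subseteq> I" "\<forall>t\<in>U. g t \<in> N t" "w = finprod G g U"
    by (rule fsumE)
  define f' g' where "f' = (\<lambda>t. if t \<in> T then f t else \<one>)" and "g' = (\<lambda>t. if t \<in> U then g t else \<one>)"
  have f': "f' t \<in> N t" "g' t \<in> N t" if "t \<in> T \<union> U" for t
    using that T U subgroup.one_closed[OF N] by (auto simp: f'_def g'_def)
  have "v = finprod G f' (T \<union> U)" "w = finprod G g' (T \<union> U)"
    unfolding T(4) U(4) f'_def g'_def using T U car by (auto intro!: finprod_pad)
  moreover have "f' \<in> T \<union> U \<rightarrow> carrier G" "g' \<in> T \<union> U \<rightarrow> carrier G" using f' T U car by blast+
  ultimately have "v \<otimes> w = finprod G (\<lambda>t. f' t \<otimes> g' t) (T \<union> U)" by (simp add: finprod_multf)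
  moreover have "f' t \<otimes> g' t \<in> N t" if "t \<in> T \<union> U" for t
    using f'[OF that] that T U by (intro subgroup.m_closed[OF N]) auto
  ultimately show "v \<otimes> w \<in> fsum I N" using fsumI[of "T \<union> U" I "\<lambda>t. f' t \<otimes> g' t" N] T U by simp
qed

lemma finprod_in_subgroup:
  assumes "subgroup H G" "finite T" "\<And>t. t \<in> T \<Longrightarrow> f t \<in> H"
  shows "finprod G f T \<in> H"
  using assms(2,3)
proof (induction T rule: finite_induct)
  case (insert a T)
  have "f \<in> insert a T \<rightarrow> carrier G" using insert.prems subgroup.mem_carrier[OF assms(1)] by blast
  then show ?case using insert assms(1) by (auto intro!: subgroup.m_closed simp: finprod_insert)
qed (use assms(1) in \<open>simp add: subgroup.one_closed\<close>)

lemma fsum_least: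
  assumes "subgroup H G" "\<And>i. i \<in> I \<Longrightarrow> N i \<subseteq> H" shows "fsum I N \<subseteq> H"
  using assms by (auto elim!: fsumE intro!: finprod_in_subgroup)

text \<open>This puts independence into the shape of \<open>is_direct_sum_family\<close>, where a
  representation is a family of finite support defined on all of \<open>I\<close>.\<close>

lemma indep_fam_bij:
  assumes N: "\<And>i. i \<in> I \<Longrightarrow> subgroup (N i) G" and ind: "indep_fam I N"
  shows "bij_betw (\<lambda>f. finprod G f {i \<in> I. f i \<noteq> \<one>}) {f \<in> (\<Pi>\<^sub>E i\<in>I. N i). finite {i \<in> I. f i \<noteq> \<one>}} (fsum I N)"
proof (rule bij_betwI')
  have car: "\<And>i v. i \<in> I \<Longrightarrow> v \<in> N i \<Longrightarrow> v \<in> carrier G"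
    by (rule subgroup.mem_carrier[OF N])
  fix f g assume f: "f \<in> {f \<in> (\<Pi>\<^sub>E i\<in>I. N i). finite {i \<in> I. f i \<noteq> \<one>}}"
    and g: "g \<in> {f \<in> (\<Pi>\<^sub>E i\<in>I. N i). finite {i \<in> I. f i \<noteq> \<one>}}"
  \<comment> \<open>The two products run over different supports; they are compared on the union,
    where missing factors are 1.\<close>
  define U where "U = {i \<in> I. f i \<noteq> \<one>} \<union> {i \<in> I. g i \<noteq> \<one>}"
  have U: "finite U" "U \<subseteq> I" using f g by (auto simp: U_def)
  have fN: "f i \<in> N i" "g i \<in> N i" if "i \<in> I" for i using f g that by auto
  have pf: "finprod G f {i \<in> I. f i \<noteq> \<one>} = finprod G f U"
    using f U fN car by (intro finprod_mono_neutral_cong_left) (auto simp: U_def)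
  have pg: "finprod G g {i \<in> I. g i \<noteq> \<one>} = finprod G g U"
    using g U fN car by (intro finprod_mono_neutral_cong_left) (auto simp: U_def)
  show "(finprod G f {i \<in> I. f i \<noteq> \<one>} = finprod G g {i \<in> I. g i \<noteq> \<one>}) = (f = g)"
  proof
    assume eq: "finprod G f {i \<in> I. f i \<noteq> \<one>} = finprod G g {i \<in> I. g i \<noteq> \<one>}"
    have fc: "f \<in> U \<rightarrow> carrier G" "g \<in> U \<rightarrow> carrier G" using fN U car by blast+
    have "finprod G (\<lambda>i. f i \<otimes> inv g i) U \<otimes> finprod G g U = finprod G (\<lambda>i. (f i \<otimes> inv g i) \<otimes> g i) U"
      using fc by (subst finprod_multf) (auto intro!: finprod_multf[symmetric])
    also have "\<dots> = finprod G f U" using fc by (intro finprod_cong') (auto simp: m_assoc Pi_iff)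
    also have "\<dots> = \<one> \<otimes> finprod G g U" using eq pf pg fc by simp
    finally have one: "finprod G (\<lambda>i. f i \<otimes> inv g i) U = \<one>"
      using fc finprod_closed[OF fc(2)] finprod_closed[of "\<lambda>i. f i \<otimes> inv g i" U]
      by (auto simp: Pi_iff)
    have "f i = g i" if i: "i \<in> U" for i
    proof -
      have "f i \<otimes> inv g i = \<one>"
      proof (rule indep_famD[OF ind U _ one i])
        fix t assume "t \<in> U"
        then show "f t \<otimes> inv g t \<in> N t"
          using fN U by (intro subgroup.m_closed[OF N] subgroup.m_inv_closed[OF N]) auto
      qed
      then show ?thesis using fN[of i] i U car[of i]
        by (metis inv_equality inv_inv subset_iff inv_closed)
    qed
    then have "f i = g i" if "i \<in> I" for i using that by (cases "i \<in> U") (auto simp: U_def)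
    then show "f = g" using f g by (auto intro: PiE_ext)
  qed simp
next
  fix f assume f: "f \<in> {f \<in> (\<Pi>\<^sub>E i\<in>I. N i). finite {i \<in> I. f i \<noteq> \<one>}}"
  then show "finprod G f {i \<in> I. f i \<noteq> \<one>} \<in> fsum I N" by (intro fsumI) auto
next
  have car: "\<And>i v. i \<in> I \<Longrightarrow> v \<in> N i \<Longrightarrow> v \<in> carrier G"
    by (rule subgroup.mem_carrier[OF N])
  fix v assume "v \<in> fsum I N"
  then obtain T f where T: "finite T" "T \<subseteq> I" "\<forall>t\<in>T. f t \<in> N t" "v = finprod G f T"
    by (rule fsumE)
  define g where "g = (\<lambda>i\<in>I. if i \<in> T then f i else \<one>)"
  have sub: "{i \<in> I. g i \<noteq> \<one>} \<subseteq> T" by (auto simp: g_def split: if_splits)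
  have "g \<in> (\<Pi>\<^sub>E i\<in>I. N i)" using T subgroup.one_closed[OF N] by (auto simp: g_def)
  moreover have "finprod G g {i \<in> I. g i \<noteq> \<one>} = finprod G f T"
    using sub T car by (intro finprod_mono_neutral_cong_left) (auto simp: g_def subset_iff)
  ultimately show "\<exists>g\<in>{f \<in> (\<Pi>\<^sub>E i\<in>I. N i). finite {i \<in> I. f i \<noteq> \<one>}}. v = finprod G g {i \<in> I. g i \<noteq> \<one>}"
    using T sub finite_subset by (intro bexI[of _ g]) auto
qed

text \<open>Used to collect the cyclic summands of the same level into the modules Y_i. Expanding
  every block turns a relation between blocks into a relation between the members of the original
  family.\<close>

lemma indep_fam_regroup:
  assumes N: "\<And>i. i \<in> I \<Longrightarrow> subgroup (N i) G" and ind: "indep_fam I N"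
    and P: "\<And>k. k \<in> K \<Longrightarrow> P k \<subseteq> I" and disj: "disjoint_family_on P K"
  shows "indep_fam K (\<lambda>k. fsum (P k) N)"
  unfolding indep_fam_def
proof (intro allI impI ballI)
  have car: "\<And>i v. i \<in> I \<Longrightarrow> v \<in> N i \<Longrightarrow> v \<in> carrier G"
    by (rule subgroup.mem_carrier[OF N])
  fix T f k assume T: "finite T" "T \<subseteq> K" and f: "\<forall>t\<in>T. f t \<in> fsum (P t) N"
    and one: "finprod G f T = \<one>" and k: "k \<in> T"
  have "\<forall>t\<in>T. \<exists>U g. finite U \<and> U \<subseteq> P t \<and> (\<forall>u\<in>U. g u \<in> N u) \<and> f t = finprod G g U"
    using f by (metis fsumE)
  then obtain U g where Ug: "\<And>t. t \<in> T \<Longrightarrow> finite (U t)" "\<And>t. t \<in> T \<Longrightarrow> U t \<subseteq> P t"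
    "\<And>t u. t \<in> T \<Longrightarrow> u \<in> U t \<Longrightarrow> g t u \<in> N u" "\<And>t. t \<in> T \<Longrightarrow> f t = finprod G (g t) (U t)"
    by metis
  have uniq: "t = t'" if "t \<in> T" "t' \<in> T" "u \<in> U t" "u \<in> U t'" for t t' u
  proof (rule ccontr)
    assume "t \<noteq> t'"
    then have "P t \<inter> P t' = {}" using disj that T(2) unfolding disjoint_family_on_def by blast
    then show False using that Ug(2)[of t] Ug(2)[of t'] by blast
  qed
  \<comment> \<open>The expansions of the blocks come with separate coefficient functions
    \<open>g t\<close>. As the blocks are disjoint, an index determines its block, and the functions
    merge into one.\<close>
  define h where "h u = g (THE t. t \<in> T \<and> u \<in> U t) u" for u
  have h: "h u = g t u" if "t \<in> T" "u \<in> U t" for t u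
  proof -
    have "(THE t. t \<in> T \<and> u \<in> U t) = t" by (rule the_equality) (use that uniq in blast)+
    then show ?thesis by (simp add: h_def)
  qed
  have UI: "U t \<subseteq> I" if "t \<in> T" for t using Ug(2)[OF that] P T that by blast
  have hN: "h u \<in> N u" if "t \<in> T" "u \<in> U t" for t u using that Ug(3) h by simp
  then have hc: "h u \<in> carrier G" "h u \<in> N u" if "t \<in> T" "u \<in> U t" for t u
    using that car[of u "h u"] UI[of t] by auto
  have ft: "f t = finprod G h (U t)" if "t \<in> T" for t
    unfolding Ug(4)[OF that] using that h hc by (intro finprod_cong') auto
  have "finprod G h (\<Union>t\<in>T. U t) = finprod G (\<lambda>t. finprod G h (U t)) T"
    using T Ug uniq hc by (intro finprod_UN_disjoint) (auto simp: pairwise_def disjnt_def)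
  also have "\<dots> = finprod G f T"
    using ft hc by (intro finprod_cong') (auto intro!: finprod_closed)
  finally have one': "finprod G h (\<Union>t\<in>T. U t) = \<one>" using one by simp
  have "h u = \<one>" if "u \<in> U k" for u
    by (rule indep_famD[OF ind _ _ _ one']) (use that T Ug(1) k hc subsetD[OF UI] in auto)
  then show "f k = \<one>" unfolding ft[OF k] by (intro finprod_one_eqI) auto
qed

lemma fsum_regroup:
  assumes N: "\<And>i. i \<in> I \<Longrightarrow> subgroup (N i) G" and P: "(\<Union>k\<in>K. P k) = I"
  shows "fsum K (\<lambda>k. fsum (P k) N) = fsum I N"
proof
  have Nk: "subgroup (fsum (P k) N) G" if "k \<in> K" for k using that N P by (intro fsum_subgroup) blast
  show "fsum K (\<lambda>k. fsum (P k) N) \<subseteq> fsum I N"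
    using P N by (intro fsum_least fsum_subgroup fsum_mono) auto
  show "fsum I N \<subseteq> fsum K (\<lambda>k. fsum (P k) N)"
  proof (rule fsum_least)
    show "subgroup (fsum K (\<lambda>k. fsum (P k) N)) G" by (intro fsum_subgroup Nk)
    fix i assume "i \<in> I"
    then obtain k where k: "k \<in> K" "i \<in> P k" using P by blast
    have "N i \<subseteq> fsum (P k) N" using k N P by (intro fsum_incl) blast+
    also have "\<dots> \<subseteq> fsum K (\<lambda>k. fsum (P k) N)" using fsum_incl[of K "\<lambda>k. fsum (P k) N"] Nk k by simp
    finally show "N i \<subseteq> fsum K (\<lambda>k. fsum (P k) N)" .
  qed
qed

lemma fsum_image:
  fixes N' :: "'j \<Rightarrow> 'a set" and N :: "'i \<Rightarrow> 'a set"
  assumes N: "\<And>i. i \<in> I \<Longrightarrow> N' (g i) = N i"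
    and sub: "\<And>i. i \<in> I \<Longrightarrow> subgroup (N i) G"
  shows "fsum (g ` I) N' = fsum I N" 
proof -
  have sub': "subgroup (N' j) G" if "j \<in> g ` I" for j using that N sub by auto
  show ?thesis
  proof
    show "fsum (g ` I) N' \<subseteq> fsum I N"
    proof (rule fsum_least)
      show "subgroup (fsum I N) G" by (rule fsum_subgroup[OF sub])
      show "N' j \<subseteq> fsum I N" if "j \<in> g ` I" for j
        using that N fsum_incl[of I N] sub by auto
    qed
    show "fsum I N \<subseteq> fsum (g ` I) N'"
    proof (rule fsum_least)
      show "subgroup (fsum (g ` I) N') G" by (rule fsum_subgroup[OF sub'])
      show "N i \<subseteq> fsum (g ` I) N'" if "i \<in> I" for i
        using that N fsum_incl[of "g ` I" N' "g i"] sub' by auto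
    qed
  qed
qed

text \<open>In the final statement the summands of Y_i form a set of submodules indexed by
  themselves, while the construction indexes them by socle vectors.\<close>

lemma indep_fam_image:
  fixes N' :: "'j \<Rightarrow> 'a set" and N :: "'i \<Rightarrow> 'a set"
  assumes inj: "inj_on g I" and N: "\<And>i. i \<in> I \<Longrightarrow> N' (g i) = N i"
    and sub: "\<And>i. i \<in> I \<Longrightarrow> subgroup (N i) G" and ind: "indep_fam I N"
  shows "indep_fam (g ` I) N'"
  unfolding indep_fam_def
proof (intro allI impI ballI)
  fix T f t assume T: "finite T" "T \<subseteq> g ` I" and f: "\<forall>t\<in>T. f t \<in> N' t"
    and one: "finprod G f T = \<one>" and t: "t \<in> T"
  obtain U where U: "U \<subseteq> I" "T = g ` U" "finite U"
    by (metis T finite_subset_image)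
  have fN: "f (g u) \<in> N u" if "u \<in> U" for u
    using that f U N by auto
  have fc: "f (g u) \<in> N u" "f (g u) \<in> carrier G" if "u \<in> U" for u
    using fN that subgroup.mem_carrier[OF sub] U(1) by auto
  have "finprod G (\<lambda>u. f (g u)) U = \<one>"
    using one unfolding U(2) using fc inj_on_subset[OF inj U(1)]
    by (subst (asm) finprod_reindex) auto
  then show "f t = \<one>" using indep_famD[OF ind U(3,1), of "\<lambda>u. f (g u)"] fc t U(2) by blast
qed

lemma indep_fam_insert:
  assumes N: "\<And>i. i \<in> insert b I \<Longrightarrow> subgroup (N i) G" and ind: "indep_fam I N"
    and b: "b \<notin> I" "N b \<inter> fsum I N \<subseteq> {\<one>}"
  shows "indep_fam (insert b I) N"
  unfolding indep_fam_def
proof (intro allI impI)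
  have car: "\<And>i v. i \<in> insert b I \<Longrightarrow> v \<in> N i \<Longrightarrow> v \<in> carrier G"
    by (rule subgroup.mem_carrier[OF N])
  fix T f assume T: "finite T" "T \<subseteq> insert b I" and f: "\<forall>t\<in>T. f t \<in> N t"
    and one: "finprod G f T = \<one>"
  have T': "finite (T - {b})" "T - {b} \<subseteq> I" using T by auto
  have fc: "f \<in> T \<rightarrow> carrier G" using f T car by blast
  have *: "finprod G f (T - {b}) = \<one>"
  proof (cases "b \<in> T")
    case True
    have "finprod G f T = finprod G f (insert b (T - {b}))" using True by (simp add: insert_absorb)
    also have "\<dots> = f b \<otimes> finprod G f (T - {b})"
      using T' fc True by (subst finprod_insert) auto
    finally have e: "f b \<otimes> finprod G f (T - {b}) = \<one>" using one by simp
    have c: "finprod G f (T - {b}) \<in> carrier G" "f b \<in> carrier G"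
      using fc True by (auto intro!: finprod_closed)
    then have "f b = inv (finprod G f (T - {b}))" using e by (simp add: inv_equality)
    moreover have "finprod G f (T - {b}) \<in> fsum I N" using T' f by (intro fsumI) auto
    ultimately have "f b \<in> fsum I N"
      using subgroup.m_inv_closed[OF fsum_subgroup[of I N]] N by simp
    then have "f b = \<one>" using b f True by blast
    then show ?thesis using e c by simp
  next
    case False
    then show ?thesis using one by simp
  qed
  have o: "f t = \<one>" if "t \<in> T - {b}" for t
    using indep_famD[OF ind T' _ * that] f by auto
  moreover have "f b = \<one>" if "b \<in> T"
  proof -
    have "finprod G f T = finprod G f (insert b (T - {b}))" using that by (simp add: insert_absorb)
    also have "\<dots> = f b \<otimes> finprod G f (T - {b})"
      using T' fc that by (subst finprod_insert) auto
    finally show ?thesis using * one fc that by (auto simp: Pi_iff)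
  qed
  ultimately show "\<forall>t\<in>T. f t = \<one>" by blast
qed

lemma indep_fam_disjoint:
  assumes N: "\<And>i. i \<in> insert b I \<Longrightarrow> subgroup (N i) G" and ind: "indep_fam (insert b I) N" and b: "b \<notin> I"
  shows "N b \<inter> fsum I N = {\<one>}"
proof
  have sb: "subgroup (N b) G" "subgroup (fsum I N) G" using N by (auto intro!: fsum_subgroup)
  show "{\<one>} \<subseteq> N b \<inter> fsum I N" using subgroup.one_closed[OF sb(1)] subgroup.one_closed[OF sb(2)] by simp
  show "N b \<inter> fsum I N \<subseteq> {\<one>}"
  proof
    fix v assume v: "v \<in> N b \<inter> fsum I N"
    have vc: "v \<in> carrier G" using v subgroup.mem_carrier[OF sb(1)] by simp
    have "v \<in> fsum I N" using v by simp
    then obtain T f where T: "finite T" "T \<subseteq> I" "\<forall>t\<in>T. f t \<in> N t" "v = finprod G f T"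
      by (rule fsumE)
    have fc: "f \<in> T \<rightarrow> carrier G" using T subgroup.mem_carrier[OF N] by blast
    have bT: "b \<notin> T" using T b by blast
    define g where "g = f(b := inv v)"
    have "finprod G g T = finprod G f T" using bT fc by (intro finprod_cong') (auto simp: g_def)
    then have "finprod G g (insert b T) = \<one>"
      using T bT fc vc by (subst finprod_insert) (auto simp: g_def)
    moreover have "g t \<in> N t" if "t \<in> insert b T" for t
      using that T v sb bT by (auto simp: g_def subgroup.m_inv_closed)
    ultimately have "g b = \<one>" using indep_famD[OF ind, of "insert b T" g b] T by auto
    then show "v \<in> {\<one>}" using vc by (simp add: g_def)
  qed
qed

lemma fsum_insert:
  assumes N: "\<And>i. i \<in> insert b I \<Longrightarrow> subgroup (N i) G"
  shows "fsum (insert b I) N = N b <#> fsum I N"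
proof
  have sb: "subgroup (N b) G" "subgroup (fsum I N) G" "subgroup (fsum (insert b I) N) G"
    using N by (auto intro!: fsum_subgroup)
  have i: "N b \<subseteq> N b <#> fsum I N" "fsum I N \<subseteq> N b <#> fsum I N"
    using subgroup.one_closed[OF sb(1)] subgroup.one_closed[OF sb(2)]
      subgroup.mem_carrier[OF sb(1)] subgroup.mem_carrier[OF sb(2)]
    unfolding set_mult_def by force+
  show "fsum (insert b I) N \<subseteq> N b <#> fsum I N"
  proof (rule fsum_least)
    show "subgroup (N b <#> fsum I N) G" using sb by (simp add: mult_subgroups)
    fix j assume "j \<in> insert b I"
    then show "N j \<subseteq> N b <#> fsum I N" using i fsum_incl[of I N j] N by fastforce
  qed
  show "N b <#> fsum I N \<subseteq> fsum (insert b I) N"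
    using fsum_incl[of "insert b I" N b] N fsum_mono[of I "insert b I" N]
    by (auto simp: set_mult_def intro!: subgroup.m_closed[OF sb(3)])
qed

end

section \<open>Cyclic modules and their socles\<close>

definition xd :: "int poly" where "xd = [:-1, 1:]"

lemma poly_split_xd: "\<exists>g. f = [:c:] + xd * g" if "c = poly f 1"
proof -
  have "[:-1, 1:] dvd f - [:c:]" using that by (simp add: dvd_iff_poly_eq_0)
  then obtain g where "f - [:c:] = xd * g" by (auto simp: xd_def elim!: dvdE)
  then show ?thesis by (intro exI[of _ g]) (simp add: algebra_simps)
qed

context op_group
begin

section \<open>Powers of \<sigma> - 1 and cyclic submodules\<close>

lemma act_subgroup: "subgroup H A \<Longrightarrow> (\<And>v. v \<in> H \<Longrightarrow> s v \<in> H) \<Longrightarrow> v \<in> H \<Longrightarrow> act f v \<in> H"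
  by (induction f)
     (auto simp: act_pCons intro!: subgroup.m_closed subgroup_int_pow_closed subgroup.one_closed)

lemma act_finprod:
  assumes "finite T" "\<And>t. t \<in> T \<Longrightarrow> g t \<in> carrier A"
  shows "act f (finprod A g T) = finprod A (\<lambda>t. act f (g t)) T"
  using assms
proof (induction T rule: finite_induct)
  case (insert a T)
  then have "g \<in> T \<rightarrow> carrier A" "(\<lambda>t. act f (g t)) \<in> T \<rightarrow> carrier A" by auto
  with insert show ?case by (simp add: act_mult)
qed simp

definition xp :: "nat \<Rightarrow> 'a \<Rightarrow> 'a" where "xp k = act (xd ^ k)"

lemma xp_closed [simp, intro]: "v \<in> carrier A \<Longrightarrow> xp k v \<in> carrier A" by (simp add: xp_def)
lemma xp_0 [simp]: "v \<in> carrier A \<Longrightarrow> xp 0 v = v" by (simp add: xp_def)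
lemma xp_one [simp]: "xp k \<one> = \<one>" by (simp add: xp_def)
lemma xp_add: "v \<in> carrier A \<Longrightarrow> xp (i + j) v = xp i (xp j v)"
  by (simp add: xp_def power_add act_comp)
lemma xp_mult: "v \<in> carrier A \<Longrightarrow> w \<in> carrier A \<Longrightarrow> xp i (v \<otimes> w) = xp i v \<otimes> xp i w"
  by (simp add: xp_def act_mult)
lemma xp_inv: "v \<in> carrier A \<Longrightarrow> xp i (inv v) = inv (xp i v)" by (simp add: xp_def act_inv)
lemma xp_pow: "v \<in> carrier A \<Longrightarrow> xp i (v [^] (c::nat)) = xp i v [^] c" by (simp add: xp_def act_nat_pow)
lemma xp_le: "v \<in> carrier A \<Longrightarrow> xp i v = \<one> \<Longrightarrow> i \<le> j \<Longrightarrow> xp j v = \<one>"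
  using xp_add[of v "j - i" i] by simp
lemma xp_act: "v \<in> carrier A \<Longrightarrow> xp i (act f v) = act f (xp i v)"
  by (simp add: xp_def act_commute)

definition cyc :: "'a \<Rightarrow> 'a set" where "cyc v = range (\<lambda>f. act f v)"

lemma cyc_I: "act f v \<in> cyc v" by (simp add: cyc_def)

lemma cyc_carrier: "v \<in> carrier A \<Longrightarrow> u \<in> cyc v \<Longrightarrow> u \<in> carrier A" by (auto simp: cyc_def)

lemma cyc_self: "v \<in> carrier A \<Longrightarrow> v \<in> cyc v" using cyc_I[of 1 v] by simp

lemma cyc_act: "v \<in> carrier A \<Longrightarrow> u \<in> cyc v \<Longrightarrow> act f u \<in> cyc v"
  by (auto simp: cyc_def simp flip: act_comp)

lemma cyc_subgroup: "v \<in> carrier A \<Longrightarrow> subgroup (cyc v) A"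
proof
  assume v: "v \<in> carrier A"
  show "cyc v \<subseteq> carrier A" using v by (auto simp: cyc_def)
  show "\<one> \<in> cyc v" using cyc_I[of 0 v] by simp
  show "x \<otimes> y \<in> cyc v" if "x \<in> cyc v" "y \<in> cyc v" for x y
    using that v by (auto simp: cyc_def simp flip: act_add)
  show "inv x \<in> cyc v" if "x \<in> cyc v" for x
    using that v by (auto simp: cyc_def simp flip: act_uminus)
qed

end

locale p_op_group = op_group A s for A (structure) and s +
  fixes p :: nat
  assumes p_prime: "Factorial_Ring.prime p" and exp_p: "v \<in> carrier A \<Longrightarrow> v [^] p = \<one>"
begin

section \<open>Vector spaces over the prime field, written multiplicatively\<close>

lemma pow_dvd: "v \<in> carrier A \<Longrightarrow> p dvd c \<Longrightarrow> v [^] (c::nat) = \<one>"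
  by (auto simp: exp_p simp flip: nat_pow_pow elim!: dvdE)

lemma pow_not_dvd:
  assumes v: "v \<in> carrier A" and c: "\<not> p dvd c"
  shows "\<exists>k::nat. (v [^] c) [^] k = v"
proof -
  have "coprime c p" using p_prime c by (metis coprime_commute prime_imp_coprime)
  then obtain w where w: "[c * w = 1] (mod p)" using cong_solve_coprime_nat[of c p] by auto
  have "v [^] (c * w) = v"
  proof -
    have "c * w mod p = 1" using w prime_gt_1_nat[OF p_prime] by (simp add: cong_def)
    then have "c * w = p * (c * w div p) + 1" by (metis mult_div_mod_eq)
    then have "v [^] (c * w) = v [^] (p * (c * w div p)) \<otimes> v" using v
      by (metis nat_pow_mult nat_pow_eone)
    then show ?thesis using v pow_dvd[of v "p * (c * w div p)"] by simp
  qed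
  then show ?thesis using v by (auto simp: nat_pow_pow)
qed

lemma pow_one_dvd: "v \<in> carrier A \<Longrightarrow> v \<noteq> \<one> \<Longrightarrow> v [^] (c::nat) = \<one> \<Longrightarrow> p dvd c"
  using pow_not_dvd by fastforce

lemma int_pow_nat: "v \<in> carrier A \<Longrightarrow> v [^] (c::int) = v [^] nat (c mod int p)"
proof -
  assume v: "v \<in> carrier A"
  have p: "int p > 0" using p_prime by (simp add: prime_gt_0_nat)
  have "v [^] c = v [^] (int p * (c div int p)) \<otimes> v [^] (c mod int p)"
    using v by (simp flip: int_pow_mult)
  also have "v [^] (int p * (c div int p)) = \<one>"
    using v exp_p[OF v] by (simp add: int_pow_int flip: int_pow_pow)
  also have "v [^] (c mod int p) = v [^] nat (c mod int p)"
    using p by (metis int_nat_eq int_pow_int pos_mod_sign)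
  finally show ?thesis using v by simp
qed

definition line :: "'a \<Rightarrow> 'a set" where "line v = range (\<lambda>c::nat. v [^] c)"

lemma line_subgroup: "v \<in> carrier A \<Longrightarrow> subgroup (line v) A"
proof
  assume v: "v \<in> carrier A"
  show "line v \<subseteq> carrier A" using v by (auto simp: line_def)
  show "\<one> \<in> line v" using nat_pow_0[of v] by (metis line_def rangeI)
  show "x \<otimes> y \<in> line v" if "x \<in> line v" "y \<in> line v" for x y
    using that v by (auto simp: line_def nat_pow_mult)
  show "inv x \<in> line v" if x: "x \<in> line v" for x
  proof -
    obtain c :: nat where c: "x = v [^] c" using x by (auto simp: line_def)
    have "v [^] ((p - 1) * c) \<otimes> x = v [^] ((p - 1) * c + c)" using v by (simp add: c nat_pow_mult)
    also have "(p - 1) * c + c = p * c" using p_prime by (cases p) auto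
    finally have "v [^] ((p - 1) * c) = inv x" using v c pow_dvd[of v "p * c"]
      by (intro inv_equality[symmetric]) auto
    then show ?thesis unfolding line_def by (metis rangeI)
  qed
qed

lemma line_self: "v \<in> carrier A \<Longrightarrow> v \<in> line v" unfolding line_def using nat_pow_eone[of v] by (metis rangeI)

lemma line_sub: "subgroup H A \<Longrightarrow> v \<in> H \<Longrightarrow> line v \<subseteq> H"
proof -
  assume H: "subgroup H A" "v \<in> H"
  have "v [^] (c::nat) \<in> H" for c
    by (induction c) (auto intro: subgroup.one_closed[OF H(1)] subgroup.m_closed[OF H(1)] H(2))
  then show ?thesis by (auto simp: line_def)
qed

text \<open>Scalars of the prime field are exponents, so coefficients are determined only modulo \<open>p\<close>;
  independence is therefore expressed by the lines that the vectors span.\<close>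

definition lin_indep :: "'a set \<Rightarrow> bool" where
  "lin_indep B \<longleftrightarrow> B \<subseteq> carrier A \<and> \<one> \<notin> B \<and> indep_fam B line"

definition lin_span :: "'a set \<Rightarrow> 'a set" where "lin_span B = fsum B line"

lemma lin_span_subgroup: "B \<subseteq> carrier A \<Longrightarrow> subgroup (lin_span B) A"
  unfolding lin_span_def by (rule fsum_subgroup) (auto intro: line_subgroup)

lemma lin_span_incl: "B \<subseteq> carrier A \<Longrightarrow> B \<subseteq> lin_span B"
  unfolding lin_span_def using fsum_incl[of B line] line_subgroup line_self by (auto simp: subset_iff)

lemma lin_span_least: "subgroup H A \<Longrightarrow> B \<subseteq> H \<Longrightarrow> lin_span B \<subseteq> H"
  unfolding lin_span_def by (rule fsum_least) (auto dest: line_sub)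

lemma lin_indep_insert:
  assumes B: "lin_indep B" and v: "v \<in> carrier A" "v \<notin> lin_span B"
  shows "lin_indep (insert v B)"
proof -
  have Bc: "B \<subseteq> carrier A" using B by (simp add: lin_indep_def)
  have sg: "subgroup (lin_span B) A" using lin_span_subgroup Bc by blast
  have "line v \<inter> fsum B line \<subseteq> {\<one>}"
  proof
    fix x assume x: "x \<in> line v \<inter> fsum B line"
    then obtain c :: nat where c: "x = v [^] c" by (auto simp: line_def)
    show "x \<in> {\<one>}"
    proof (cases "p dvd c")
      case True then show ?thesis using pow_dvd v c by simp
    next
      case False
      then obtain k :: nat where "x [^] k = v" using pow_not_dvd v c by blast
      moreover have "x [^] k \<in> lin_span B" using line_sub[OF sg, of x] x
        unfolding lin_span_def line_def by blast
      ultimately show ?thesis using v by simp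
    qed
  qed
  moreover have "v \<notin> B" using v lin_span_incl[OF Bc] by blast
  moreover have "v \<noteq> \<one>" using v sg subgroup.one_closed[OF sg] by blast
  ultimately show ?thesis using B v(1) unfolding lin_indep_def
    by (auto intro!: indep_fam_insert line_subgroup)
qed

text \<open>Zorn's lemma, the dimension being unrestricted. The extension stays inside
  \<open>V\<close>, so that a basis of one step of the filtration can be enlarged to a basis of the
  next larger one.\<close>

lemma basis_extension:
  assumes B: "lin_indep B" "B \<subseteq> V" and V: "subgroup V A"
  shows "\<exists>C. B \<subseteq> C \<and> C \<subseteq> V \<and> lin_indep C \<and> lin_span C = V"
proof -
  define S where "S = {C. B \<subseteq> C \<and> C \<subseteq> V \<and> lin_indep C}"
  have "\<exists>C\<in>S. \<forall>D\<in>S. C \<subseteq> D \<longrightarrow> D = C"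
  proof (rule subset_Zorn_nonempty)
    show "S \<noteq> {}" using B by (auto simp: S_def)
    fix \<C> assume ne: "\<C> \<noteq> {}" and ch: "subset.chain S \<C>"
    have CS: "\<C> \<subseteq> S" using ch by (simp add: subset_chain_def)
    have "indep_fam (\<Union>\<C>) line"
      unfolding indep_fam_def
    proof (intro allI impI)
      fix T f assume T: "finite T" "T \<subseteq> \<Union>\<C>" "\<forall>t\<in>T. f t \<in> line t" "finprod A f T = \<one>"
      obtain C where C: "C \<in> \<C>" "T \<subseteq> C"
        using finite_subset_Union_chain[OF T(1,2) ne ch] by blast
      have "indep_fam C line" using C CS by (auto simp: S_def lin_indep_def)
      then show "\<forall>t\<in>T. f t = \<one>" using C(2) T unfolding indep_fam_def by blast
    qed
    then show "\<Union>\<C> \<in> S" using ne CS by (fastforce simp: S_def lin_indep_def)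
  qed
  then obtain C where C: "C \<in> S" "\<And>D. D \<in> S \<Longrightarrow> C \<subseteq> D \<Longrightarrow> D = C" by blast
  have Cv: "C \<subseteq> V" "lin_indep C" "B \<subseteq> C" using C by (auto simp: S_def)
  have "v \<in> lin_span C" if "v \<in> V" for v
  proof (rule ccontr)
    assume nv: "v \<notin> lin_span C"
    have "lin_indep (insert v C)"
      by (rule lin_indep_insert[OF Cv(2) subgroup.mem_carrier[OF V that] nv])
    then have "insert v C = C" using C(2)[of "insert v C"] Cv that by (auto simp: S_def)
    then have "v \<in> C" by blast
    then show False using nv lin_span_incl[of C] Cv(2) by (auto simp: lin_indep_def)
  qed
  then have "lin_span C = V" using lin_span_least[OF V Cv(1)] by blast
  then show ?thesis using Cv by blast
qed

text \<open>Remainder theorem: modulo \<sigma> - 1 a polynomial is its value at 1. Hence the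
  generator spans the cyclic module modulo the image of \<open>xp 1\<close>.\<close>

lemma cyc_step:
  assumes v: "v \<in> carrier A" and u: "u \<in> cyc v"
  shows "\<exists>c::nat. \<exists>w\<in>cyc v. u = v [^] c \<otimes> xp 1 w"
proof -
  obtain f where f: "u = act f v" using u by (auto simp: cyc_def)
  obtain g where g: "f = [:poly f 1:] + xd * g" using poly_split_xd by blast
  have "u = v [^] (poly f 1) \<otimes> xp 1 (act g v)"
    unfolding f by (subst g) (use v in \<open>simp add: act_add act_const act_comp xp_def\<close>)
  then show ?thesis using int_pow_nat[OF v] cyc_I[of g v] by metis
qed

text \<open>The module is isomorphic to F_p[x]/(x^(l+1)), whose submodules form a chain, so the
  kernel of x^k is the image of x^(l+1-k). The proof extracts one factor x at a time: if u = x^j w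
  with l - j \<ge> k and \<open>c\<close> is the coefficient of the generator in w, then 1 = x^(l-j)
  u = (x^l v)^c, so p divides c.\<close>

lemma cyc_ker:
  assumes v: "v \<in> carrier A" and l: "xp (Suc l) v = \<one>" "xp l v \<noteq> \<one>"
    and u: "u \<in> cyc v" "xp k u = \<one>" and k: "k \<le> Suc l"
  shows "u \<in> xp (Suc l - k) ` cyc v"
proof -
  have "u \<in> xp j ` cyc v" if "j \<le> Suc l - k" for j
    using that
  proof (induction j)
    case 0
    have "u = xp 0 u" using u v cyc_carrier by simp
    then show ?case using u by blast
  next
    case (Suc j)
    then obtain w where w: "w \<in> cyc v" "u = xp j w" by auto
    obtain c :: nat and w' where c: "w' \<in> cyc v" "w = v [^] c \<otimes> xp 1 w'"
      using cyc_step[OF v w(1)] by blast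
    have wc: "w \<in> carrier A" "w' \<in> carrier A" using w c v cyc_carrier by auto
    obtain f where f: "w' = act f v" using c by (auto simp: cyc_def)
    have "xp l w = xp (l - j) u" using Suc.prems wc w by (simp flip: xp_add)
    also have "\<dots> = \<one>" using u cyc_carrier[OF v u(1)] Suc.prems xp_le[of u k "l - j"] by simp
    also have "xp l w = xp l v [^] c \<otimes> xp (Suc l) w'"
      using v wc by (simp add: c(2) xp_mult xp_pow xp_add[of w' l 1, simplified])
    also have "xp (Suc l) w' = \<one>" using v l by (simp add: f xp_act)
    finally have "xp l v [^] c = \<one>" using v by simp
    then have "p dvd c" using pow_one_dvd v l by blast
    then have "w = xp 1 w'" using c wc pow_dvd v by simp
    then have "u = xp (Suc j) w'" using w(2) wc by (simp flip: xp_add)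
    then show ?case using c by blast
  qed
  from this[of "Suc l - k"] show ?thesis by simp
qed

text \<open>The family is indexed by the vectors that span its socles. In a relation whose terms are
  all killed by a power of x, applying x shortens that power; by induction x kills every term, so
  each term lies on the line of its socle, and these lines are independent.\<close>

lemma cyc_indep:
  assumes gen: "\<And>t. t \<in> I \<Longrightarrow> gen t \<in> carrier A"
    and len: "\<And>t. t \<in> I \<Longrightarrow> xp (len t) (gen t) = t" "\<And>t. t \<in> I \<Longrightarrow> xp 1 t = \<one>"
    and ind: "lin_indep I"
  shows "indep_fam I (\<lambda>t. cyc (gen t))"
proof -
  have one: "t \<noteq> \<one>" if "t \<in> I" for t using that ind by (auto simp: lin_indep_def)
  have ker1: "u \<in> line t" if t: "t \<in> I" and u: "u \<in> cyc (gen t)" "xp 1 u = \<one>" for t u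
  proof -
    have s: "xp (Suc (len t)) (gen t) = \<one>" using len t gen[OF t] xp_add[of "gen t" 1 "len t"] by simp
    have "u \<in> xp (Suc (len t) - 1) ` cyc (gen t)"
      using cyc_ker[OF gen[OF t] s _ u] len t one by simp
    then obtain w where w: "w \<in> cyc (gen t)" "u = xp (len t) w" by auto
    obtain c :: nat and w' where c: "w' \<in> cyc (gen t)" "w = gen t [^] c \<otimes> xp 1 w'"
      using cyc_step[OF gen[OF t] w(1)] by blast
    have w': "w' \<in> carrier A" using cyc_carrier gen t c by blast
    obtain f where f: "w' = act f (gen t)" using c by (auto simp: cyc_def)
    have "u = t [^] c \<otimes> xp (Suc (len t)) w'"
      using gen[OF t] w' len t by (simp add: w c(2) xp_mult xp_pow xp_add[of w' "len t" 1, simplified])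
    also have "xp (Suc (len t)) w' = \<one>" using gen[OF t] s by (simp add: f xp_act)
    finally show ?thesis using ind t by (auto simp: line_def lin_indep_def)
  qed
  have "\<forall>t\<in>T. f t = \<one>" if "finite T" "T \<subseteq> I" "\<forall>t\<in>T. f t \<in> cyc (gen t)" "finprod A f T = \<one>"
    "\<forall>t\<in>T. xp k (f t) = \<one>" for T f k
    using that
  proof (induction k arbitrary: f)
    case 0
    then show ?case using cyc_carrier gen by (metis subset_iff xp_0)
  next
    case (Suc k)
    have fc: "f t \<in> carrier A" if "t \<in> T" for t
      using cyc_carrier[OF gen] Suc.prems that by blast
    have "\<forall>t\<in>T. xp 1 (f t) = \<one>"
    proof (rule Suc.IH)
      show "\<forall>t\<in>T. xp 1 (f t) \<in> cyc (gen t)" using Suc.prems cyc_act gen by (auto simp: xp_def)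
      show "finprod A (\<lambda>t. xp 1 (f t)) T = \<one>"
        using act_finprod[of T f "xd ^ 1"] Suc.prems fc by (simp add: xp_def)
      show "\<forall>t\<in>T. xp k (xp 1 (f t)) = \<one>"
        using Suc.prems fc xp_add[of _ k 1] by auto
    qed (use Suc.prems in auto)
    then have "\<forall>t\<in>T. f t \<in> line t" using ker1 Suc.prems by blast
    then show ?case using ind Suc.prems unfolding lin_indep_def indep_fam_def by blast
  qed
  note * = this
  show ?thesis
    unfolding indep_fam_def
  proof (intro allI impI)
    fix T f assume T: "finite T" "T \<subseteq> I" "\<forall>t\<in>T. f t \<in> cyc (gen t)" "finprod A f T = \<one>"
    \<comment> \<open>Any common bound for the lengths of the finitely many modules involved would
      do.\<close>
    define k where "k = (\<Sum>t\<in>T. Suc (len t))"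
    have "xp k (f t) = \<one>" if t: "t \<in> T" for t
    proof -
      have tI: "t \<in> I" using T t by blast
      obtain g where g: "f t = act g (gen t)" using T t by (auto simp: cyc_def)
      have "xp (Suc (len t)) (gen t) = \<one>"
        using len tI gen[OF tI] xp_add[of "gen t" 1 "len t"] by simp
      moreover have "Suc (len t) \<le> k" unfolding k_def using T(1) t by (intro member_le_sum) auto
      ultimately show ?thesis using gen[OF tI] xp_le[of "gen t" "Suc (len t)" k] by (simp add: g xp_act)
    qed
    then show "\<forall>t\<in>T. f t = \<one>" using *[of T f k] T by blast
  qed
qed

end

section \<open>The decomposition\<close>

text \<open>J with only those properties that the decomposition uses. \<open>Q_E\<close> and
  \<open>E_split\<close> are the two consequences of Hilbert 90; the extra premise of
  \<open>E_split\<close> at i = n can be arranged through \<open>adjust\<close>.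
  \<open>m_cases\<close> includes m < n, and \<open>m_min\<close> is the minimality of
  i(K/F).\<close>

locale pclass_mod = p_op_group A s p for A (structure) and s p +
  fixes n :: nat and E :: "nat \<Rightarrow> 'a set" and Q :: "'a set" and d :: 'a and m :: "nat extended"
  assumes n_pos: "n \<ge> 1"
    and E_sub: "i \<le> n \<Longrightarrow> subgroup (E i) A"
    and E_s: "i \<le> n \<Longrightarrow> v \<in> E i \<Longrightarrow> s v \<in> E i"
    and E_mono: "i \<le> j \<Longrightarrow> j \<le> n \<Longrightarrow> E i \<subseteq> E j"
    and E_n: "E n = carrier A"
    and E_nil: "i \<le> n \<Longrightarrow> v \<in> E i \<Longrightarrow> xp (p ^ i) v = \<one>"
    and E_norm: "i \<le> j \<Longrightarrow> j \<le> n \<Longrightarrow> v \<in> E j \<Longrightarrow> xp (p ^ j - p ^ i) v \<in> E i"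
    and Q_sub: "subgroup Q A"
    and Q_x: "v \<in> carrier A \<Longrightarrow> xp 1 v \<in> Q"
    and E_Q: "i < n \<Longrightarrow> E i \<subseteq> Q"
    and Q_E: "i < n \<Longrightarrow> v \<in> Q \<Longrightarrow> xp (p ^ i) v = \<one> \<Longrightarrow> v \<in> E i"
    and E_split: "\<lbrakk>0 < i; i \<le> n; v \<in> E i; xp (p ^ i - 1) v = \<one>; i = n \<Longrightarrow> v \<in> Q\<rbrakk>
       \<Longrightarrow> \<exists>a\<in>E i. \<exists>b\<in>E (i - 1). v = xp 1 a \<otimes> b"
    and adjust: "\<lbrakk>v \<in> carrier A; xp (p ^ n - 1) v = \<one>\<rbrakk> \<Longrightarrow> \<exists>c::nat. v \<otimes> d [^] c \<in> Q"
    and d_closed [simp]: "d \<in> carrier A" and d_Q: "d \<notin> Q"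
    and d_nil: "xp (p ^ n - 1) d = \<one>"
    and m_cases: "m = Minf \<and> xp 1 d = \<one> \<or> (\<exists>k<n. m = Fin k \<and> xp 1 d \<in> E k)"
    and m_min: "m = Fin k \<Longrightarrow> v \<in> carrier A \<Longrightarrow> v \<notin> Q \<Longrightarrow> xp 1 v \<noteq> \<one> \<and> (\<forall>j<k. xp 1 v \<notin> E j)"
begin

section \<open>The exceptional class and the socle of X\<close>

lemma p_gt_1: "p > 1" using p_prime by (rule prime_gt_1_nat)

lemma p_pos [simp]: "0 < p" "Suc 0 \<le> p" using p_gt_1 by auto

lemma p_pow_pos [simp]: "p ^ i > 0" "Suc 0 \<le> p ^ i" using p_gt_1 by (auto simp: Suc_le_eq)

lemma p_pow_mono: "i \<le> j \<Longrightarrow> p ^ i \<le> p ^ j" using p_gt_1 by (simp add: power_increasing)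

lemma p_pow_mono': "i < j \<Longrightarrow> p ^ i < p ^ j" using p_gt_1 by (simp add: power_strict_increasing)

lemma E_carrier: "i \<le> n \<Longrightarrow> v \<in> E i \<Longrightarrow> v \<in> carrier A" using subgroup.mem_carrier[OF E_sub] .

lemma E_act: "i \<le> n \<Longrightarrow> v \<in> E i \<Longrightarrow> act f v \<in> E i"
  using act_subgroup[OF E_sub E_s] by blast

lemma Q_xp: "v \<in> carrier A \<Longrightarrow> k > 0 \<Longrightarrow> xp k v \<in> Q"
  using Q_x[of "xp (k - 1) v"] xp_add[of v 1 "k - 1"] by simp

text \<open>The number p^m with p^(-\<infinity>) = 0: the largest power of \<sigma> - 1 that does
  not kill \<open>d\<close>, so that \<open>s0\<close> spans the socle of X.\<close>

definition lenX :: nat where "lenX = (case m of Fin k \<Rightarrow> p ^ k | _ \<Rightarrow> 0)"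

definition s0 :: 'a where "s0 = xp lenX d"

lemma s0_closed [simp]: "s0 \<in> carrier A" by (simp add: s0_def)

text \<open>If \<open>v\<close> were killed by \<open>xp (p ^ Suc i)\<close>, splitting \<open>xp 1 v\<close> and subtracting the element of
  \<open>E (Suc i)\<close> obtained would give an element outside \<open>Q\<close> whose image under \<open>xp 1\<close> is in \<open>E i\<close>.\<close>

lemma exceptional_length: "m = Fin k \<Longrightarrow> i \<le> k \<Longrightarrow> k < n \<Longrightarrow> v \<in> carrier A \<Longrightarrow> v \<notin> Q \<Longrightarrow> xp (p ^ i) v \<noteq> \<one>"
proof (induction i arbitrary: v)
  case 0
  then show ?case using m_min[of k v] by simp
next
  case (Suc i)
  show ?case
  proof
    assume xv: "xp (p ^ Suc i) v = \<one>"
    have "xp 1 v \<in> E (Suc i)"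
      using Suc.prems xv by (intro Q_E Q_x) (auto simp flip: xp_add simp: xp_add[of v "1"] xp_le)
    moreover have "xp (p ^ Suc i - 1) (xp 1 v) = \<one>"
      using Suc.prems xv p_gt_1 by (simp flip: xp_add)
    ultimately obtain a b where ab: "a \<in> E (Suc i)" "b \<in> E i" "xp 1 v = xp 1 a \<otimes> b"
      using E_split[of "Suc i" "xp 1 v"] Suc.prems by auto
    have ac: "a \<in> carrier A" "b \<in> carrier A" using ab Suc.prems E_carrier[of "Suc i"] E_carrier[of i] by auto
    have aQ: "a \<in> Q" using ab E_Q[of "Suc i"] Suc.prems by auto
    define w where "w = v \<otimes> inv a"
    have w: "w \<in> carrier A" using ac Suc.prems by (simp add: w_def)
    have "w \<notin> Q"
    proof
      assume "w \<in> Q"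
      then have "w \<otimes> a \<in> Q" using aQ by (rule subgroup.m_closed[OF Q_sub])
      then show False using ac Suc.prems by (simp add: w_def m_assoc)
    qed
    moreover have "xp 1 w = b"
      using ac Suc.prems ab(3) by (simp add: w_def xp_mult xp_inv) (simp add: m_ac)
    ultimately show False using m_min[of k w] w ab(2) Suc.prems by auto
  qed
qed

lemma lenX_cases: "m = Minf \<and> lenX = 0 \<and> s0 = d \<or> (\<exists>k<n. m = Fin k \<and> lenX = p ^ k \<and> xp 1 d \<in> E k)"
  using m_cases by (auto simp: lenX_def s0_def)

lemma xp_s0: "xp 1 s0 = \<one>"
  using lenX_cases
proof
  assume "m = Minf \<and> lenX = 0 \<and> s0 = d"
  then show ?thesis using m_cases by auto
next
  assume "\<exists>k<n. m = Fin k \<and> lenX = p ^ k \<and> xp 1 d \<in> E k"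
  then show ?thesis using E_nil[of _ "xp 1 d"] by (auto simp: s0_def add.commute simp flip: xp_add)
qed

lemma xp_SlenX: "xp (Suc lenX) d = \<one>"
  using xp_s0 xp_add[of d 1 lenX] by (simp add: s0_def)

lemma s0_neq: "s0 \<noteq> \<one>"
  using lenX_cases exceptional_length[of _ _ d] d_Q subgroup.one_closed[OF Q_sub] by (auto simp: s0_def)

text \<open>Since the power p^i - 1 of \<sigma> - 1 acts on [K_i^x] as the norm to F, this is the
  group of classes of norms from K_i to F.\<close>

definition V :: "nat \<Rightarrow> 'a set" where "V i = xp (p ^ i - 1) ` E i"

lemma V_sub: assumes "i \<le> n" shows "subgroup (V i) A"
proof
  note Es = E_sub[OF assms] and Ec = E_carrier[OF assms]
  show "V i \<subseteq> carrier A" using Ec by (auto simp: V_def)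
  show "\<one> \<in> V i" unfolding V_def using subgroup.one_closed[OF Es] xp_one by (metis imageI)
  show "x \<otimes> y \<in> V i" if "x \<in> V i" "y \<in> V i" for x y
    using that Ec subgroup.m_closed[OF Es] by (auto simp: V_def simp flip: xp_mult)
  show "inv x \<in> V i" if "x \<in> V i" for x
    using that Ec subgroup.m_inv_closed[OF Es] by (auto simp: V_def simp flip: xp_inv)
qed

lemma V_mono: assumes "i \<le> j" "j \<le> n" shows "V j \<subseteq> V i"
proof
  fix x assume "x \<in> V j"
  then obtain v where v: "v \<in> E j" "x = xp (p ^ j - 1) v" by (auto simp: V_def)
  have "x = xp (p ^ i - 1) (xp (p ^ j - p ^ i) v)"
    using v E_carrier[OF assms(2) v(1)] p_pow_mono[OF assms(1)] p_pow_pos[of i]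
    by (simp flip: xp_add)
  then show "x \<in> V i" using E_norm[OF assms v(1)] by (simp add: V_def)
qed

lemma V_0: "V 0 = E 0"
proof -
  have "xp 0 v = v" if "v \<in> E 0" for v using that E_carrier[of 0] by simp
  then show ?thesis by (auto simp: V_def)
qed

lemma V_xp: "i \<le> n \<Longrightarrow> v \<in> V i \<Longrightarrow> xp 1 v = \<one>"
  using V_mono[of 0 i] V_0 E_nil[of 0 v] by auto

text \<open>For the second claim suppose s0 = x^(p^(k+1) - 1) v and write the exponent as p^k + r.
  Then \<open>d\<close> divided by x^r v is killed by x^(p^k). It is outside Q provided that x^r v
  is in Q, and then it contradicts \<open>exceptional_length\<close>.\<close>

lemma s0_V:
  assumes m: "m = Fin k"
  shows "s0 \<in> V k" "Suc k \<le> n \<Longrightarrow> s0 \<notin> V (Suc k)"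
proof -
  have k: "k < n" "lenX = p ^ k" "xp 1 d \<in> E k" using lenX_cases m by auto
  have "s0 = xp (p ^ k - 1) (xp 1 d)" using k by (simp add: s0_def flip: xp_add)
  then show "s0 \<in> V k" using k by (simp add: V_def)
  assume kn: "Suc k \<le> n"
  show "s0 \<notin> V (Suc k)"
  proof
    assume "s0 \<in> V (Suc k)"
    then obtain v where v: "v \<in> E (Suc k)" "s0 = xp (p ^ Suc k - 1) v" by (auto simp: V_def)
    have vc: "v \<in> carrier A" using v kn E_carrier by blast
    define r where "r = p ^ Suc k - 1 - p ^ k"
    have le: "2 * p ^ k \<le> p ^ Suc k" using p_gt_1 by simp
    have r: "p ^ Suc k - 1 = p ^ k + r" using le p_pow_pos[of k] by (simp add: r_def del: power_Suc)
    have rQ: "xp r v \<in> Q"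
    proof (cases "r = 0")
      case False
      then show ?thesis using vc by (intro Q_xp) auto
    next
      \<comment> \<open>This happens only for p = 2 and k = 0, where membership in Q does not come
        for free from a factor x. It comes from \<open>E_Q\<close> unless n = 1; but for p^n = 2 the
        assumption \<open>d_nil\<close> reads x d = 1, against the minimality of m.\<close>
      case r0: True
      then have "p ^ k \<le> 1" using le by (simp add: r_def del: power_Suc)
      then have k0: "k = 0" using p_pow_mono'[of 0 k] by (cases k) auto
      have "Suc k < n"
      proof (rule ccontr)
        assume "\<not> Suc k < n"
        then have n1: "n = 1" using kn k0 by simp
        have "p = 2" using r0 k0 p_gt_1 by (simp add: r_def)
        then have "xp 1 d = \<one>" using d_nil n1 by simp
        then show False using m_min[OF m d_closed d_Q] by blast
      qed
      then show ?thesis using E_Q[of "Suc k"] v vc r0 by auto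
    qed
    define w where "w = d \<otimes> inv (xp r v)"
    have wc: "w \<in> carrier A" using vc by (simp add: w_def)
    have "w \<notin> Q"
    proof
      assume "w \<in> Q"
      then have "w \<otimes> xp r v \<in> Q" using rQ by (rule subgroup.m_closed[OF Q_sub])
      then show False using vc d_Q by (simp add: w_def m_assoc)
    qed
    moreover have "xp (p ^ k) w = \<one>"
    proof -
      have "xp (p ^ k) w = xp (p ^ k) d \<otimes> inv (xp (p ^ k) (xp r v))"
        using vc by (simp add: w_def xp_mult xp_inv)
      also have "xp (p ^ k) d = s0" using k by (simp add: s0_def)
      also have "xp (p ^ k) (xp r v) = s0" using v(2) vc by (simp only: r xp_add)
      finally show ?thesis by simp
    qed
    ultimately show False using exceptional_length[OF m order_refl k(1) wc] by blast
  qed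
qed

text \<open>The filtration decreases, so bases are extended from V_n towards V_0. If m = k is
  finite, \<open>s0\<close> is inserted on passing from V_(k+1) to V_k, the moment when it becomes
  available and, by \<open>s0_V\<close>, is still independent of the basis at hand.\<close>

lemma adapted_basis:
  "\<exists>C. (\<forall>i\<le>n. C i \<subseteq> V i \<and> lin_indep (C i) \<and> lin_span (C i) = V i)
     \<and> (\<forall>i<n. C (Suc i) \<subseteq> C i) \<and> (\<forall>k i. m = Fin k \<longrightarrow> i \<le> n \<longrightarrow> (s0 \<in> C i \<longleftrightarrow> i \<le> k))"
proof -
  \<comment> \<open>The parameter \<open>j\<close> counts steps down from n. The choice principle
    yields an infinite sequence; for j beyond n truncated subtraction merely repeats V 0.\<close>
  define P where "P j C \<longleftrightarrow> C \<subseteq> V (n - j) \<and> lin_indep C \<and> lin_span C = V (n - j) \<and>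
     (\<forall>k. m = Fin k \<longrightarrow> n - j \<le> k \<longrightarrow> s0 \<in> C)" for j C
  have "\<exists>C. \<forall>j. P j (C j) \<and> (C j \<subseteq> C (Suc j))"
  proof (rule dependent_nat_choice)
    have "lin_indep {}" by (simp add: lin_indep_def indep_fam_def)
    then obtain C where "C \<subseteq> V n" "lin_indep C" "lin_span C = V n"
      using basis_extension[of "{}" "V n"] V_sub[of n] by auto
    then show "\<exists>C. P 0 C" using lenX_cases by (auto simp: P_def)
  next
    fix C j assume C: "P j C"
    define i where "i = n - Suc j"
    have i: "i \<le> n" "V (n - j) \<subseteq> V i" using V_mono[of i "n - j"] by (auto simp: i_def)
    show "\<exists>D. P (Suc j) D \<and> C \<subseteq> D"
    proof (cases "\<exists>k. m = Fin k \<and> i \<le> k")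
      case True
      then obtain k where k: "m = Fin k" "i \<le> k" by blast
      have kn: "k < n" using lenX_cases k by auto
      have "lin_indep (insert s0 C)"
      proof (cases "n - j \<le> k")
        case True
        then have "s0 \<in> C" using C k by (simp add: P_def)
        then show ?thesis using C by (simp add: P_def insert_absorb)
      next
        case False
        then have "V (n - j) \<subseteq> V (Suc k)" using V_mono[of "Suc k" "n - j"] by simp
        then have "s0 \<notin> lin_span C" using C s0_V[OF k(1)] kn by (auto simp: P_def)
        then show ?thesis using C by (intro lin_indep_insert) (auto simp: P_def)
      qed
      moreover have "insert s0 C \<subseteq> V i"
        using C i s0_V[OF k(1)] V_mono[of i k] k kn by (auto simp: P_def)
      ultimately obtain D where "insert s0 C \<subseteq> D" "D \<subseteq> V i" "lin_indep D" "lin_span D = V i"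
        using basis_extension[of "insert s0 C" "V i"] V_sub[OF i(1)] by blast
      then show ?thesis by (intro exI[of _ D]) (auto simp: P_def i_def)
    next
      case False
      have "lin_indep C" "C \<subseteq> V i" using C i by (auto simp: P_def)
      then obtain D where "C \<subseteq> D" "D \<subseteq> V i" "lin_indep D" "lin_span D = V i"
        using basis_extension[of C "V i"] V_sub[OF i(1)] by blast
      then show ?thesis using False by (intro exI[of _ D]) (auto simp: P_def i_def)
    qed
  qed
  then obtain C where C: "\<And>j. P j (C j)" "\<And>j. C j \<subseteq> C (Suc j)" by blast
  have 1: "C (n - i) \<subseteq> V i \<and> lin_indep (C (n - i)) \<and> lin_span (C (n - i)) = V i" if "i \<le> n" for i
    using C(1)[of "n - i"] that by (simp add: P_def)
  moreover have "C (n - Suc i) \<subseteq> C (n - i)" if "i < n" for i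
    using C(2)[of "n - Suc i"] that by (simp add: Suc_diff_Suc)
  moreover have "s0 \<in> C (n - i) \<longleftrightarrow> i \<le> k" if "m = Fin k" "i \<le> n" for k i
  proof
    assume "s0 \<in> C (n - i)"
    then have "s0 \<in> V i" using 1 that by blast
    then show "i \<le> k" using s0_V[OF that(1)] V_mono[of "Suc k" i] that(2)
      by (metis not_less_eq_eq order_trans subset_iff)
  next
    assume "i \<le> k"
    then show "s0 \<in> C (n - i)" using C(1)[of "n - i"] that by (simp add: P_def)
  qed
  ultimately show ?thesis by (intro exI[of _ "\<lambda>i. C (n - i)"]) auto
qed

text \<open>The operator of part (3) as a power of \<sigma> - 1: on J, (\<sigma> - 1)(\<sigma>^(p^i)
  - 1)^(p^(k-i) - 1) has exponent 1 + p^i (p^(k-i) - 1).\<close>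

definition expX :: "nat \<Rightarrow> nat" where
  "expX i = (case m of Fin k \<Rightarrow> if k \<le> i then 1 else p ^ k - p ^ i + 1 | _ \<Rightarrow> 1)"

text \<open>Summands are labelled by their socle vectors, and the label \<open>s0\<close> stands for
  X. The two conditions on \<open>lev w\<close> determine the dimension p^(lev w) of the summand,
  and the kernel of \<open>xp (p ^ i)\<close> in the last clause is Y^(H_i).\<close>

theorem decomposition:
  "\<exists>I gen lev. s0 \<notin> I \<and> gen s0 = d \<and>
     (\<forall>w\<in>insert s0 I. gen w \<in> carrier A) \<and>
     (\<forall>w\<in>I. lev w \<le> n \<and> xp (p ^ lev w) (gen w) = \<one> \<and> xp (p ^ lev w - 1) (gen w) \<noteq> \<one>) \<and>
     indep_fam (insert s0 I) (\<lambda>w. cyc (gen w)) \<and>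
     fsum (insert s0 I) (\<lambda>w. cyc (gen w)) = carrier A \<and>
     (\<forall>i<n. E i = xp (expX i) ` cyc d <#> {v \<in> fsum I (\<lambda>w. cyc (gen w)). xp (p ^ i) v = \<one>})"
proof -
  obtain C where C': "\<forall>i\<le>n. C i \<subseteq> V i \<and> lin_indep (C i) \<and> lin_span (C i) = V i"
      "\<forall>i<n. C (Suc i) \<subseteq> C i" "\<forall>k i. m = Fin k \<longrightarrow> i \<le> n \<longrightarrow> (s0 \<in> C i \<longleftrightarrow> i \<le> k)"
    using adapted_basis by (elim exE conjE)
  have C: "C i \<subseteq> V i" "lin_indep (C i)" "lin_span (C i) = V i" if "i \<le> n" for i
    using C'(1) that by simp_all
  have Cs: "C (Suc i) \<subseteq> C i" if "i < n" for i using C'(2) that by simp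
  have s0C: "s0 \<in> C i \<longleftrightarrow> i \<le> k" if "m = Fin k" "i \<le> n" for k i using C'(3) that by simp
  have Cm: "C j \<subseteq> C i" if "i \<le> j" "j \<le> n" for i j
    using that
  proof (induction j rule: dec_induct)
    case (step k)
    then show ?case using Cs[of k] by simp
  qed simp
  have C0: "C i \<subseteq> V 0" if "i \<le> n" for i using C(1)[OF that] V_mono[of 0 i] that by blast
  have C_carrier: "w \<in> carrier A" if "w \<in> C i" "i \<le> n" for w i
    using that C(2)[of i] by (auto simp: lin_indep_def)
  have V0Q: "V 0 \<subseteq> Q" using V_0 E_Q[of 0] n_pos by simp
  have s0_Minf: "s0 \<notin> V 0" if "m = Minf"
    using that lenX_cases V0Q d_Q by auto
  \<comment> \<open>For m = -\<infinity> the vector \<open>s0\<close> is outside V 0; then nothing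
    is removed here, and \<open>li\<close> below adjoins it to the basis.\<close>
  define I where "I = C 0 - {s0}"
  have "\<exists>j \<alpha>. j \<le> n \<and> w \<in> C j \<and> (j < n \<longrightarrow> w \<notin> C (Suc j)) \<and> \<alpha> \<in> E j \<and> xp (p ^ j - 1) \<alpha> = w"
    if w: "w \<in> I" for w
  proof -
    \<comment> \<open>The level of a basis vector is the last step of the filtration whose basis
      contains it. Lifting to K_j for this j makes the summand as long as the vector
      permits.\<close>
    define j where "j = Max {i. i \<le> n \<and> w \<in> C i}"
    have fin: "finite {i. i \<le> n \<and> w \<in> C i}" by auto
    have "0 \<in> {i. i \<le> n \<and> w \<in> C i}" using w by (simp add: I_def)
    then have j: "j \<le> n" "w \<in> C j" using Max_in[OF fin] unfolding j_def by blast+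
    have "w \<notin> C (Suc j)" if "j < n"
    proof
      assume "w \<in> C (Suc j)"
      then have "Suc j \<le> j" using Max_ge[OF fin, of "Suc j"] that by (simp add: j_def)
      then show False by simp
    qed
    moreover obtain \<alpha> where "\<alpha> \<in> E j" "w = xp (p ^ j - 1) \<alpha>" using j C(1)[of j] by (auto simp: V_def)
    ultimately show ?thesis using j by blast
  qed
  then obtain lev gen0 where lev: "\<And>w. w \<in> I \<Longrightarrow> lev w \<le> n" "\<And>w. w \<in> I \<Longrightarrow> w \<in> C (lev w)"
      "\<And>w. w \<in> I \<Longrightarrow> lev w < n \<Longrightarrow> w \<notin> C (Suc (lev w))"
    and gen0: "\<And>w. w \<in> I \<Longrightarrow> gen0 w \<in> E (lev w)" "\<And>w. w \<in> I \<Longrightarrow> xp (p ^ lev w - 1) (gen0 w) = w"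
    by metis
  define gen where "gen = gen0(s0 := d)"
  have s0I: "s0 \<notin> I" by (simp add: I_def)
  have gen: "gen s0 = d" "\<And>w. w \<in> I \<Longrightarrow> gen w = gen0 w" using s0I by (auto simp: gen_def)
  have genE: "gen w \<in> E (lev w)" if "w \<in> I" for w using gen0 gen that by simp
  have genI: "gen w \<in> carrier A" if "w \<in> I" for w using genE[OF that] E_carrier[of "lev w"] lev(1)[OF that] by blast
  have gen_carrier: "gen w \<in> carrier A" if "w \<in> insert s0 I" for w
    using that genI gen by auto
  have li: "lin_indep (insert s0 I)"
  proof (cases "m = Minf")
    case True
    then have "s0 \<notin> lin_span (C 0)" using s0_Minf C(3)[of 0] by simp
    then have "lin_indep (insert s0 (C 0))" using C(2)[of 0] by (intro lin_indep_insert) auto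
    then show ?thesis by (simp add: I_def)
  next
    case False
    then obtain k where "m = Fin k" using lenX_cases by auto
    then have "s0 \<in> C 0" using s0C[of k 0] by simp
    then show ?thesis using C(2)[of 0] by (simp add: I_def insert_absorb)
  qed
  have one: "w \<noteq> \<one>" if "w \<in> I" for w using li that by (auto simp: lin_indep_def)
  define len where "len w = (if w = s0 then lenX else p ^ lev w - 1)" for w
  have soc: "xp (len w) (gen w) = w" if "w \<in> insert s0 I" for w
    using that gen0 gen s0I by (auto simp: len_def s0_def)
  have soc1: "xp 1 w = \<one>" if "w \<in> insert s0 I" for w
    using that xp_s0 V_xp[of 0 w] C(1)[of 0] by (auto simp: I_def)
  let ?N = "\<lambda>w. cyc (gen w)"
  have N: "subgroup (?N w) A" if "w \<in> insert s0 I" for w by (rule cyc_subgroup[OF gen_carrier[OF that]])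
  have ind: "indep_fam (insert s0 I) ?N"
    using gen_carrier soc soc1 li by (rule cyc_indep)
  define Z where "Z = fsum (insert s0 I) ?N"
  have Z: "subgroup Z A" unfolding Z_def by (rule fsum_subgroup[OF N])
  have NZ: "?N w \<subseteq> Z" if "w \<in> insert s0 I" for w unfolding Z_def using fsum_incl[of "insert s0 I" ?N w] N that by blast
  have Z_act: "act f v \<in> Z" if v: "v \<in> Z" for f v
  proof -
    obtain T g where T: "finite T" "T \<subseteq> insert s0 I" "\<forall>t\<in>T. g t \<in> ?N t" "v = finprod A g T"
      using v unfolding Z_def by (rule fsumE)
    have "act f v = finprod A (\<lambda>t. act f (g t)) T"
      unfolding T(4) using T cyc_carrier[OF gen_carrier] by (intro act_finprod) auto
    also have "\<dots> \<in> Z" unfolding Z_def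
      using T cyc_act[OF gen_carrier] by (intro fsumI) auto
    finally show ?thesis .
  qed
  have Zc: "v \<in> carrier A" if "v \<in> Z" for v using subgroup.mem_carrier[OF Z that] .
  \<comment> \<open>It is enough to lift the basis vectors of V_i. Each is x^(p^j - 1) of a
    generator in E_j with j \<ge> i, or s0 = x^(p^k - 1)(x d) with x d in E_k and k \<ge> i;
    applying the norm to K_i, a power of x, gives a lift at level i inside the same cyclic
    module.\<close>
  have soc_lift: "\<exists>y\<in>Z. y \<in> E i \<and> xp (p ^ i - 1) y = w" if i: "i \<le> n" and w: "w \<in> V i" for i w
  proof -
    define S where "S = {w \<in> carrier A. \<exists>y\<in>Z. y \<in> E i \<and> xp (p ^ i - 1) y = w}"
    have "subgroup S A"
    proof
      show "S \<subseteq> carrier A" by (auto simp: S_def)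
      show "\<one> \<in> S" using subgroup.one_closed[OF Z] subgroup.one_closed[OF E_sub[OF i]] xp_one
        unfolding S_def by blast
      show "x \<otimes> y \<in> S" if xy: "x \<in> S" "y \<in> S" for x y
      proof -
        obtain x' y' where x': "x' \<in> Z" "x' \<in> E i" "xp (p ^ i - 1) x' = x"
          and y': "y' \<in> Z" "y' \<in> E i" "xp (p ^ i - 1) y' = y" using xy by (auto simp: S_def)
        have "x' \<otimes> y' \<in> Z" "x' \<otimes> y' \<in> E i" using x' y' subgroup.m_closed[OF Z] subgroup.m_closed[OF E_sub[OF i]] by auto
        moreover have "xp (p ^ i - 1) (x' \<otimes> y') = x \<otimes> y" using x' y' Zc by (simp add: xp_mult)
        ultimately show ?thesis using xy by (auto simp: S_def)
      qed
      show "inv x \<in> S" if x: "x \<in> S" for x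
      proof -
        obtain x' where x': "x' \<in> Z" "x' \<in> E i" "xp (p ^ i - 1) x' = x" using x by (auto simp: S_def)
        have "inv x' \<in> Z" "inv x' \<in> E i" using x' subgroup.m_inv_closed[OF Z] subgroup.m_inv_closed[OF E_sub[OF i]] by auto
        moreover have "xp (p ^ i - 1) (inv x') = inv x" using x' Zc by (simp add: xp_inv)
        ultimately show ?thesis using x by (auto simp: S_def)
      qed
    qed
    moreover have "C i \<subseteq> S"
    proof
      fix c assume c: "c \<in> C i"
      have cc: "c \<in> carrier A" using C_carrier c i by blast
      show "c \<in> S"
      proof (cases "c = s0")
        case True
        have "m \<noteq> Minf" using s0_Minf C0[OF i] c True by blast
        then obtain k where k: "k < n" "m = Fin k" "lenX = p ^ k" "xp 1 d \<in> E k" using lenX_cases by auto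
        have ik: "i \<le> k" using s0C[OF k(2) i] c True by simp
        define y where "y = xp (p ^ k - p ^ i) (xp 1 d)"
        have "y \<in> E i" unfolding y_def using E_norm[OF ik _ k(4)] k by simp
        moreover have "y = act (xd ^ (p ^ k - p ^ i) * xd ^ 1) d" by (simp add: y_def xp_def act_comp)
        then have "y \<in> Z" using NZ[of s0] cyc_I gen by auto
        moreover have "xp (p ^ i - 1) y = s0"
          using p_pow_mono[OF ik] p_pow_pos[of i] by (simp add: y_def s0_def k(3) flip: xp_add)
        ultimately show ?thesis using True cc by (auto simp: S_def)
      next
        case False
        then have cI: "c \<in> I" using c Cm[of 0 i] i by (auto simp: I_def)
        have il: "i \<le> lev c"
        proof (rule ccontr)
          assume "\<not> i \<le> lev c"
          then have "c \<in> C (Suc (lev c))" using Cm[of "Suc (lev c)" i] i c by auto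
          then show False using lev(3)[OF cI] \<open>\<not> i \<le> lev c\<close> i by simp
        qed
        define y where "y = xp (p ^ lev c - p ^ i) (gen c)"
        have "y \<in> E i" unfolding y_def using E_norm[OF il _ genE[OF cI]] lev(1)[OF cI] by simp
        moreover have "y \<in> Z" using NZ[of c] cI cyc_I by (auto simp: y_def xp_def)
        moreover have "xp (p ^ i - 1) y = c"
          using p_pow_mono[OF il] p_pow_pos[of i] gen0(2)[OF cI] gen(2)[OF cI] genI[OF cI]
          by (simp add: y_def flip: xp_add)
        ultimately show ?thesis using cc by (auto simp: S_def)
      qed
    qed
    ultimately have "lin_span (C i) \<subseteq> S" by (rule lin_span_least)
    then show ?thesis using w C(3)[OF i] by (auto simp: S_def)
  qed
  \<comment> \<open>Given v in E_i, dividing by a lift of x^(p^i - 1) v leaves an element killed by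
    x^(p^i - 1), to which \<open>E_split\<close> applies; its part in E_(i-1) is covered by
    induction. So E_i is contained in Z times x E_i.\<close>
  have span: "E i \<subseteq> Z" if "i \<le> n" for i
    using that
  proof (induction i rule: less_induct)
    case (less i)
    have step: "\<exists>z\<in>Z. \<exists>a\<in>E i. v = z \<otimes> xp 1 a" if v: "v \<in> E i" for v
    proof -
      have vc: "v \<in> carrier A" using v less.prems E_carrier by blast
      obtain y where y: "y \<in> Z" "y \<in> E i" "xp (p ^ i - 1) y = xp (p ^ i - 1) v"
        using soc_lift[OF less.prems, of "xp (p ^ i - 1) v"] v by (auto simp: V_def)
      define v1 where "v1 = v \<otimes> inv y"
      have v1: "v1 \<in> E i" unfolding v1_def using v y less.prems
        by (auto intro!: subgroup.m_closed[OF E_sub] subgroup.m_inv_closed[OF E_sub])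
      have v1c: "v1 \<in> carrier A" using v1 less.prems E_carrier by blast
      have v1x: "xp (p ^ i - 1) v1 = \<one>" using y vc Zc by (simp add: v1_def xp_mult xp_inv)
      have vv1: "v = y \<otimes> v1" using vc y(1) Zc by (simp add: v1_def m_lcomm)
      show ?thesis
      proof (cases "i = 0")
        case True
        then have "v1 = \<one>" using v1x v1c by simp
        then have "v = y \<otimes> xp 1 \<one>" using vv1 by simp
        then show ?thesis using y subgroup.one_closed[OF E_sub[OF less.prems]] by blast
      next
        case False
        \<comment> \<open>At i = n the premise of \<open>E_split\<close> about Q is obtained by
          multiplying with a power of \<open>d\<close>. This is harmless because \<open>d\<close> is
          in Z, and because \<open>d_nil\<close> preserves the other premise.\<close>
        have "\<exists>c::nat. v1 \<otimes> d [^] c \<in> E i \<and> xp (p ^ i - 1) (v1 \<otimes> d [^] c) = \<one> \<and>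
            (i = n \<longrightarrow> v1 \<otimes> d [^] c \<in> Q)"
        proof (cases "i = n")
          case True
          obtain c :: nat where "v1 \<otimes> d [^] c \<in> Q" using adjust v1c v1x True by blast
          then show ?thesis using True v1c v1x E_n d_nil by (intro exI[of _ c]) (simp add: xp_mult xp_pow)
        next
          case False
          then show ?thesis using v1 v1x v1c by (intro exI[of _ 0]) simp
        qed
        then obtain c :: nat where c: "v1 \<otimes> d [^] c \<in> E i" "xp (p ^ i - 1) (v1 \<otimes> d [^] c) = \<one>"
          "i = n \<Longrightarrow> v1 \<otimes> d [^] c \<in> Q" by blast
        obtain a b where ab: "a \<in> E i" "b \<in> E (i - 1)" "v1 \<otimes> d [^] c = xp 1 a \<otimes> b"
          using E_split[OF _ less.prems c] False by auto
        have "E (i - 1) \<subseteq> Z" using less.prems False by (intro less.IH) auto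
        then have bZ: "b \<in> Z" using ab(2) by blast
        have ac: "a \<in> carrier A" using ab less.prems E_carrier by blast
        have dc: "d [^] c \<in> Z"
          using NZ[of s0] subgroup_int_pow_closed[OF Z, of d "int c"] cyc_self[of d] gen by (auto simp: int_pow_int)
        have "v1 = xp 1 a \<otimes> b \<otimes> inv (d [^] c)" using ab(3) v1c ac Zc[OF bZ]
          by (metis d_closed inv_solve_right m_closed nat_pow_closed xp_closed)
        then have "v = (y \<otimes> b \<otimes> inv (d [^] c)) \<otimes> xp 1 a"
          using vv1 Zc y(1) bZ ac by (simp add: m_ac)
        moreover have "y \<otimes> b \<otimes> inv (d [^] c) \<in> Z"
          using y(1) bZ dc by (intro subgroup.m_closed[OF Z] subgroup.m_inv_closed[OF Z])
        ultimately show ?thesis using ab(1) by blast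
      qed
    qed
    \<comment> \<open>Repeating the step p^i times makes the remaining factor trivial by
      \<open>E_nil\<close>.\<close>
    have iter: "\<exists>z\<in>Z. \<exists>a\<in>E i. v = z \<otimes> xp k a" if v: "v \<in> E i" for v k
    proof (induction k)
      case 0
      have "v = \<one> \<otimes> xp 0 v" using v less.prems E_carrier by simp
      then show ?case using v subgroup.one_closed[OF Z] by blast
    next
      case (Suc k)
      then obtain z a where za: "z \<in> Z" "a \<in> E i" "v = z \<otimes> xp k a" by blast
      obtain z' a' where za': "z' \<in> Z" "a' \<in> E i" "a = z' \<otimes> xp 1 a'" using step[OF za(2)] by blast
      have c: "z \<in> carrier A" "z' \<in> carrier A" "a' \<in> carrier A"
        using za za' Zc E_carrier[OF less.prems] by auto
      have "v = (z \<otimes> xp k z') \<otimes> xp (Suc k) a'"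
        using c by (simp add: za(3) za'(3) xp_mult m_assoc xp_add[of a' k 1, simplified])
      moreover have "z \<otimes> xp k z' \<in> Z" using za za' Z_act by (auto simp: xp_def intro!: subgroup.m_closed[OF Z])
      ultimately show ?case using za' by blast
    qed
    show ?case
    proof
      fix v assume v: "v \<in> E i"
      obtain z a where "z \<in> Z" "a \<in> E i" "v = z \<otimes> xp (p ^ i) a" using iter[OF v] by blast
      then show "v \<in> Z" using E_nil[OF less.prems] Zc by auto
    qed
  qed
  have full: "Z = carrier A" using span[of n] E_n Z subgroup.subset by blast
  define Y where "Y = fsum I ?N"
  have NI: "subgroup (?N w) A" if "w \<in> I" for w using N that by simp
  have Y: "subgroup Y A" unfolding Y_def by (rule fsum_subgroup[OF NI])
  have XY: "cyc d \<inter> Y = {\<one>}" using indep_fam_disjoint[OF N ind s0I] gen by (simp add: Y_def)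
  have XYs: "cyc d <#> Y = carrier A" using fsum_insert[of s0 I ?N, OF N] full gen by (simp add: Y_def Z_def)
  have Y_act: "act f v \<in> Y" if v: "v \<in> Y" for f v
  proof -
    obtain T g where T: "finite T" "T \<subseteq> I" "\<forall>t\<in>T. g t \<in> ?N t" "v = finprod A g T"
      using v unfolding Y_def by (rule fsumE)
    have "act f v = finprod A (\<lambda>t. act f (g t)) T"
      unfolding T(4) using T cyc_carrier[OF genI] by (intro act_finprod) auto
    also have "\<dots> \<in> Y" unfolding Y_def
      using T cyc_act[OF genI] by (intro fsumI) auto
    finally show ?thesis .
  qed
  have Y_E: "v \<in> E i" if i: "i < n" and v: "v \<in> Y" "xp (p ^ i) v = \<one>" for i v
  proof -
    obtain T g where T: "finite T" "T \<subseteq> I" "\<forall>t\<in>T. g t \<in> ?N t" "v = finprod A g T"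
      using v(1) unfolding Y_def by (rule fsumE)
    have gc: "g t \<in> carrier A" if "t \<in> T" for t using T cyc_carrier[OF genI] that by auto
    have "finprod A (\<lambda>t. xp (p ^ i) (g t)) T = \<one>"
      using act_finprod[of T g "xd ^ (p ^ i)"] T gc v(2) by (simp add: xp_def)
    moreover have "xp (p ^ i) (g t) \<in> ?N t" if "t \<in> T" for t
      using T that cyc_act[OF genI] by (auto simp: xp_def)
    ultimately have gk: "xp (p ^ i) (g t) = \<one>" if "t \<in> T" for t
      using indep_famD[OF indep_fam_mono[OF ind, of I] T(1,2), of "\<lambda>t. xp (p ^ i) (g t)" t] that by auto
    \<comment> \<open>Below level n the summand lies in Q as a whole. At level n its generator need
      not, but a component killed by x^(p^i) with i < n is by \<open>cyc_ker\<close> a multiple of a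
      positive power of x, hence in Q.\<close>
    have "g t \<in> Q" if t: "t \<in> T" for t
    proof (cases "lev t = n")
      case False
      have tI: "t \<in> I" using T t by blast
      obtain f where "g t = act f (gen t)" using T t by (auto simp: cyc_def)
      then have "g t \<in> E (lev t)" using E_act[OF lev(1) genE] tI by simp
      then show ?thesis using E_Q[of "lev t"] False lev(1)[OF tI] by auto
    next
      case True
      have tI: "t \<in> I" using T t by blast
      define l where "l = p ^ n - 1"
      have l: "Suc l = p ^ n" by (simp add: l_def)
      have "xp (Suc l) (gen t) = \<one>" using E_nil[OF lev(1) genE, OF tI tI] True l by simp
      moreover have "xp l (gen t) \<noteq> \<one>"
        using gen0(2)[OF tI] gen(2)[OF tI] one[OF tI] True by (simp add: l_def)
      moreover have "p ^ i < Suc l" using p_pow_mono'[OF i] l by simp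
      ultimately obtain w where w: "w \<in> ?N t" "g t = xp (Suc l - p ^ i) w"
        using cyc_ker[OF genI[OF tI], of l "g t" "p ^ i"] T t gk[OF t] by auto
      show ?thesis unfolding w(2) using \<open>p ^ i < Suc l\<close> cyc_carrier[OF genI[OF tI] w(1)] by (intro Q_xp) auto
    qed
    then have "v \<in> Q" unfolding T(4) by (intro finprod_in_subgroup[OF Q_sub T(1)])
    then show ?thesis using Q_E[OF i] v by blast
  qed
  have expX_E: "xp (expX i) d \<in> E i" if i: "i < n" for i
  proof (cases m)
    case (Fin k)
    then have k: "k < n" "xp 1 d \<in> E k" using lenX_cases by auto
    show ?thesis
    proof (cases "k \<le> i")
      case True
      then have "expX i = 1" unfolding expX_def using Fin by simp
      then show ?thesis using E_mono[of k i] k i True by auto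
    next
      case False
      then have "xp (p ^ k - p ^ i) (xp 1 d) \<in> E i" using E_norm[of i k] k by simp
      moreover have "expX i = p ^ k - p ^ i + 1" unfolding expX_def using Fin False by simp
      ultimately show ?thesis by (simp flip: xp_add)
    qed
  next
    case Pinf
    then show ?thesis using m_cases by simp
  next
    case Minf
    then have "expX i = 1" unfolding expX_def by simp
    then show ?thesis using Minf m_cases subgroup.one_closed[OF E_sub[of i]] i by auto
  qed
  \<comment> \<open>For i < m this is the description of kernels in a cyclic module. For m \<le> i
    it is membership in Q that matters: the coefficient of \<open>d\<close> in u must vanish modulo
    p, as \<open>d\<close> is not in Q, and the rest is a multiple of x.\<close>
  have X_E: "u \<in> xp (expX i) ` cyc d" if i: "i < n" and u: "u \<in> cyc d" "xp (p ^ i) u = \<one>" "u \<in> Q" for i u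
  proof (cases "\<exists>k. m = Fin k \<and> i < k")
    case True
    then obtain k where k: "m = Fin k" "i < k" by blast
    have l: "lenX = p ^ k" using lenX_cases k by auto
    have "u \<in> xp (Suc lenX - p ^ i) ` cyc d"
      using cyc_ker[OF d_closed xp_SlenX _ u(1,2)] s0_neq p_pow_mono'[OF k(2)] l by (simp add: s0_def)
    moreover have "Suc lenX - p ^ i = expX i"
      unfolding expX_def l using k p_pow_mono'[OF k(2)] by (simp add: Suc_diff_le)
    ultimately show ?thesis by simp
  next
    case False
    then have e: "expX i = 1" by (auto simp: expX_def split: extended.splits)
    obtain c :: nat and w where w: "w \<in> cyc d" "u = d [^] c \<otimes> xp 1 w" using cyc_step[OF d_closed u(1)] by blast
    have wc: "w \<in> carrier A" using cyc_carrier[OF d_closed w(1)] .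
    have "u \<otimes> inv (xp 1 w) \<in> Q"
      using u(3) Q_x[OF wc] by (intro subgroup.m_closed[OF Q_sub] subgroup.m_inv_closed[OF Q_sub])
    then have dQ: "d [^] c \<in> Q" using wc by (simp add: w(2) m_assoc)
    have "p dvd c"
    proof (rule ccontr)
      assume "\<not> p dvd c"
      then obtain k :: nat where "(d [^] c) [^] k = d" using pow_not_dvd[of d c] by auto
      then show False using subgroup_int_pow_closed[OF Q_sub dQ, of "int k"] d_Q by (simp add: int_pow_int)
    qed
    then have "u = xp 1 w" using w(2) wc pow_dvd[OF d_closed] by simp
    then show ?thesis using w e by auto
  qed
  have main: "E i = xp (expX i) ` cyc d <#> {v \<in> Y. xp (p ^ i) v = \<one>}" if i: "i < n" for i
  proof
    have in': "i \<le> n" using i by simp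
    show "E i \<subseteq> xp (expX i) ` cyc d <#> {v \<in> Y. xp (p ^ i) v = \<one>}"
    proof
      fix v assume v: "v \<in> E i"
      have vc: "v \<in> carrier A" using E_carrier[OF in' v] .
      then have "v \<in> cyc d <#> Y" using XYs by simp
      then obtain u y where uy: "u \<in> cyc d" "y \<in> Y" "v = u \<otimes> y" by (auto simp: set_mult_def)
      have c: "u \<in> carrier A" "y \<in> carrier A" using cyc_carrier[OF d_closed uy(1)] subgroup.mem_carrier[OF Y uy(2)] by auto
      \<comment> \<open>Directness splits the equation x^(p^i) v = 1 into one for u and one for y.
        Then \<open>Y_E\<close> places y in E_i, so u is in E_i too and therefore in Q.\<close>
      have e: "xp (p ^ i) u \<otimes> xp (p ^ i) y = \<one>" using E_nil[OF in' v] c by (simp add: uy xp_mult)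
      have "xp (p ^ i) u = inv (xp (p ^ i) y)" using e c by (simp add: inv_equality)
      also have "\<dots> \<in> Y" using Y_act[OF uy(2)] by (simp add: xp_def subgroup.m_inv_closed[OF Y])
      finally have "xp (p ^ i) u \<in> cyc d \<inter> Y" using cyc_act[OF d_closed uy(1)] by (simp add: xp_def)
      then have u1: "xp (p ^ i) u = \<one>" using XY by simp
      then have y1: "xp (p ^ i) y = \<one>" using e c by simp
      have yE: "y \<in> E i" using Y_E[OF i uy(2) y1] .
      have "v \<otimes> inv y \<in> E i" using v yE by (intro subgroup.m_closed[OF E_sub[OF in']] subgroup.m_inv_closed[OF E_sub[OF in']])
      then have "u \<in> E i" using c by (simp add: uy m_assoc)
      then have "u \<in> Q" using E_Q[OF i] by blast
      then have "u \<in> xp (expX i) ` cyc d" using X_E[OF i uy(1) u1] by blast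
      then show "v \<in> xp (expX i) ` cyc d <#> {v \<in> Y. xp (p ^ i) v = \<one>}"
        using uy y1 by (auto simp: set_mult_def)
    qed
    show "xp (expX i) ` cyc d <#> {v \<in> Y. xp (p ^ i) v = \<one>} \<subseteq> E i"
    proof
      fix v assume "v \<in> xp (expX i) ` cyc d <#> {v \<in> Y. xp (p ^ i) v = \<one>}"
      then obtain f y where fy: "v = xp (expX i) (act f d) \<otimes> y" "y \<in> Y" "xp (p ^ i) y = \<one>"
        by (auto simp: set_mult_def cyc_def)
      have "xp (expX i) (act f d) = act f (xp (expX i) d)" by (simp add: xp_act)
      then have "xp (expX i) (act f d) \<in> E i" using E_act[OF in' expX_E[OF i]] by simp
      then show "v \<in> E i" unfolding fy(1) using Y_E[OF i fy(2,3)] by (rule subgroup.m_closed[OF E_sub[OF in']])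
    qed
  qed
  have gnil: "xp (p ^ lev w) (gen w) = \<one>" "xp (p ^ lev w - 1) (gen w) \<noteq> \<one>" if "w \<in> I" for w
    using E_nil[OF lev(1)[OF that] genE[OF that]] gen0(2)[OF that] gen(2)[OF that] one[OF that] by auto
  show ?thesis
    by (intro exI[of _ I] exI[of _ gen] exI[of _ lev] conjI ballI allI impI)
       (fact s0I gen(1) gen_carrier lev(1) gnil ind full[unfolded Z_def] main[unfolded Y_def])+
qed

end

section \<open>Power classes\<close>

text \<open>To avoid the sign of (-1)^p, and with it a special case for p = 2, the binomial
  expansion is applied to A = (A - 1) + 1 and solved for the power of A - 1.\<close>

lemma freshman_diff:
  fixes a :: "'a :: comm_ring_1"
  assumes p: "Factorial_Ring.prime p"
  shows "\<exists>h. (a - 1) ^ (p ^ i) = a ^ (p ^ i) - 1 + of_nat p * h"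
proof (induction i)
  case 0
  show ?case by (intro exI[of _ 0]) simp
next
  case (Suc i)
  have *: "\<exists>h. (a + b) ^ p = a ^ p + b ^ p + of_nat p * h" for a b :: 'a
  proof -
    obtain q where q: "p = Suc (Suc q)" using prime_ge_2_nat[OF p] by (metis Suc_le_D numeral_2_eq_2 Suc_le_mono)
    have "of_nat p dvd (\<Sum>k=1..Suc q. of_nat (p choose k) * a ^ k * b ^ (p - k))"
    proof (rule dvd_sum)
      fix k assume "k \<in> {1..Suc q}"
      then have "p dvd (p choose k)" using p q by (intro dvd_choose_prime) auto
      then have "(of_nat p :: 'a) dvd of_nat (p choose k)" by (auto elim!: dvdE)
      then show "(of_nat p :: 'a) dvd of_nat (p choose k) * a ^ k * b ^ (p - k)" by (simp add: mult.assoc)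
    qed
    then obtain h where h: "(\<Sum>k=1..Suc q. of_nat (p choose k) * a ^ k * b ^ (p - k)) = of_nat p * h" by (elim dvdE)
    have "(a + b) ^ p = (\<Sum>k\<le>p. of_nat (p choose k) * a ^ k * b ^ (p - k))" by (rule binomial_ring)
    also have "{..p} = insert 0 (insert p {1..Suc q})" using q by auto
    also have "(\<Sum>k\<in>insert 0 (insert p {1..Suc q}). of_nat (p choose k) * a ^ k * b ^ (p - k)) = b ^ p + (a ^ p + of_nat p * h)"
    proof -
      have "sum g (insert 0 (insert p {1..Suc q})) = g 0 + (g p + sum g {1..Suc q})" for g :: "nat \<Rightarrow> 'a"
        by (simp add: q)
      then show ?thesis by (simp add: h del: One_nat_def sum.insert sum.cl_ivl_Suc)
    qed
    finally show ?thesis by (auto simp: algebra_simps)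
  qed
  obtain h where h: "(a - 1) ^ (p ^ i) = a ^ (p ^ i) - 1 + of_nat p * h" using Suc by blast
  define A where "A = a ^ (p ^ i)"
  obtain h1 where h1: "((A - 1) + of_nat p * h) ^ p = (A - 1) ^ p + (of_nat p * h) ^ p + of_nat p * h1" using * by blast
  obtain h2 where h2: "((A - 1) + 1) ^ p = (A - 1) ^ p + 1 ^ p + of_nat p * h2" using * by blast
  obtain q where q: "p = Suc q" using prime_gt_0_nat[OF p] by (cases p) auto
  have "(a - 1) ^ (p ^ Suc i) = ((a - 1) ^ (p ^ i)) ^ p"
    by (simp add: mult.commute flip: power_mult)
  also have "\<dots> = (A - 1 + of_nat p * h) ^ p" by (simp only: h A_def)
  also have "\<dots> = A ^ p - 1 + of_nat p * (h * (of_nat p * h) ^ q + h1 - h2)"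
  proof -
    have "(of_nat p * h) ^ p = of_nat p * (h * (of_nat p * h) ^ q)"
      by (subst q, subst power_Suc) (simp only: mult.assoc)
    moreover have "A ^ p = (A - 1) ^ p + 1 + of_nat p * h2" using h2 by simp
    ultimately show ?thesis using h1 by (simp only: distrib_left right_diff_distrib) simp
  qed
  also have "A ^ p = a ^ (p ^ Suc i)"
    unfolding A_def power_mult[symmetric] power_Suc by (simp only: mult.commute)
  finally show ?case by blast
qed

section \<open>Powers of \<sigma> - 1 modulo p\<close>

lemma xd_Tp: "Tp p 0 - 1 = xd" by (simp add: Tp_def xd_def monom_Suc monom_0 one_pCons)

lemma xd_pow:
  assumes "Factorial_Ring.prime p"
  shows "\<exists>h. xd ^ (p ^ i) = Tp p i - 1 + of_nat p * h"
proof -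
  have "Tp p i = Tp p 0 ^ (p ^ i)" by (simp add: Tp_def monom_power)
  then show ?thesis using freshman_diff[OF assms, of "Tp p 0" i] by (simp add: xd_Tp)
qed

text \<open>Multiplied by x^(p^i), both sides agree modulo p with \<sigma>^(p^j) - 1, and x can be
  cancelled modulo p.\<close>

lemma xd_pow_Nm:
  assumes p: "Factorial_Ring.prime p" and ij: "i \<le> j"
  shows "\<exists>h. xd ^ (p ^ j - p ^ i) = Nm p i j + of_nat p * h"
proof -
  obtain h1 where h1: "xd ^ (p ^ i) = Tp p i - 1 + of_nat p * h1" using xd_pow[OF p] by blast
  obtain h2 where h2: "xd ^ (p ^ j) = Tp p j - 1 + of_nat p * h2" using xd_pow[OF p] by blast
  have le: "p ^ i \<le> p ^ j" using ij prime_gt_0_nat[OF p] by (intro power_increasing) auto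
  have "xd ^ (p ^ i) * xd ^ (p ^ j - p ^ i) = xd ^ (p ^ j)" using le by (simp flip: power_add)
  then have e: "xd ^ (p ^ i) * (xd ^ (p ^ j - p ^ i) - Nm p i j) = of_nat p * (h2 - h1 * Nm p i j)"
    using Tp_Nm[OF ij, of p] by (simp add: algebra_simps h1 h2)
  \<comment> \<open>Evaluation at 1 kills x, so a factor x on the left forces \<open>g\<close> to
    vanish at 1 and hence to contain x as well; it is cancelled in the domain Z[x].\<close>
  have "\<exists>g. f = of_nat p * g" if "xd ^ k * f = of_nat p * g" for f g k
    using that
  proof (induction k arbitrary: g)
    case (Suc k)
    have "poly (of_nat p * g) 1 = 0" by (simp flip: Suc.prems add: xd_def)
    then have "poly g 1 = 0" using prime_gt_0_nat[OF p] by (simp add: of_nat_poly)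
    then obtain g' where "g = xd * g'" using poly_split_xd[of 0 g] by auto
    then have "xd * (xd ^ k * f) = xd * (of_nat p * g')" using Suc.prems by (simp add: algebra_simps)
    moreover have "xd \<noteq> 0" by (simp add: xd_def)
    ultimately have "xd ^ k * f = of_nat p * g'" by (metis mult_left_cancel)
    then show ?case by (rule Suc.IH)
  qed auto
  from this[OF e] obtain g where "xd ^ (p ^ j - p ^ i) - Nm p i j = of_nat p * g" by blast
  then show ?thesis by (intro exI[of _ g]) (simp add: algebra_simps)
qed

context galois_units
begin

section \<open>Passage to p-th power classes\<close>

definition P :: "'a set" where "P = (\<lambda>x. x [^] p) ` carrier A"

lemma P_iff: "a \<in> P \<longleftrightarrow> (\<exists>c\<in>carrier A. a = c [^] p)" by (auto simp: P_def)

lemma P_subgroup: "subgroup P A"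
proof
  show "P \<subseteq> carrier A" by (auto simp: P_def)
  show "\<one> \<in> P" by (auto simp: P_iff intro!: bexI[of _ \<one>])
  show "x \<otimes> y \<in> P" if "x \<in> P" "y \<in> P" for x y
    using that by (auto simp: P_def simp flip: nat_pow_distrib)
  show "inv x \<in> P" if "x \<in> P" for x
    using that by (auto simp: P_def simp flip: nat_pow_inv)
qed

lemma P_normal: "P \<lhd> A" using P_subgroup by (rule subgroup_imp_normal)

definition J :: "'a set monoid" where "J = A Mod P"

definition cls :: "'a \<Rightarrow> 'a set" where "cls a = P #> a"

lemma J_group: "comm_group J" unfolding J_def using P_subgroup by (rule abelian_FactGroup)

lemma cls_closed [simp]: "a \<in> carrier A \<Longrightarrow> cls a \<in> carrier J"
  by (auto simp: cls_def J_def FactGroup_def RCOSETS_def)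

lemma carrier_J: "carrier J = cls ` carrier A"
  by (auto simp: cls_def J_def FactGroup_def RCOSETS_def)

lemma cls_eq: "a \<in> carrier A \<Longrightarrow> b \<in> carrier A \<Longrightarrow> cls a = cls b \<longleftrightarrow> (\<exists>c\<in>carrier A. a = b \<otimes> c [^] p)"
proof -
  assume ab: "a \<in> carrier A" "b \<in> carrier A"
  have "cls a = cls b \<longleftrightarrow> a \<in> P #> b"
    unfolding cls_def using ab P_subgroup by (metis repr_independence rcos_self subgroup.subset)
  also have "\<dots> \<longleftrightarrow> (\<exists>c\<in>carrier A. a = b \<otimes> c [^] p)"
    using ab by (auto simp: r_coset_def P_def m_comm)
  finally show ?thesis .
qed

lemma cls_mult: "a \<in> carrier A \<Longrightarrow> b \<in> carrier A \<Longrightarrow> cls a \<otimes>\<^bsub>J\<^esub> cls b = cls (a \<otimes> b)"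
  by (simp add: cls_def J_def FactGroup_def normal.rcos_sum[OF P_normal])

lemma J_one: "\<one>\<^bsub>J\<^esub> = cls \<one>"
  using P_subgroup by (simp add: cls_def J_def FactGroup_def coset_mult_one subgroup.subset)

lemma cls_one: "a \<in> carrier A \<Longrightarrow> cls a = \<one>\<^bsub>J\<^esub> \<longleftrightarrow> (\<exists>c\<in>carrier A. a = c [^] p)"
  using cls_eq[of a \<one>] by (auto simp: J_one)

lemma cls_hom: "cls \<in> hom A J" by (rule homI) (auto simp: cls_mult)

lemma cls_int_pow: "a \<in> carrier A \<Longrightarrow> cls (a [^] (c::int)) = cls a [^]\<^bsub>J\<^esub> c"
  using hom_int_pow[OF cls_hom] J_group comm_group.axioms(2) is_group by blast

lemma cls_nat_pow: "a \<in> carrier A \<Longrightarrow> cls (a [^] (c::nat)) = cls a [^]\<^bsub>J\<^esub> c"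
  using cls_int_pow[of a "int c"] by (simp add: int_pow_int)

definition sJ :: "'a set \<Rightarrow> 'a set" where "sJ c = s ` c"

text \<open>\<open>sJ\<close> takes images of cosets as sets. The image of a coset of
  \<open>P\<close> is a full coset only if \<open>s\<close> maps \<open>P\<close> onto itself, which
  finite order guarantees.\<close>

lemma s_surj: "a \<in> carrier A \<Longrightarrow> \<exists>b\<in>carrier A. s b = a"
proof -
  assume a: "a \<in> carrier A"
  obtain q where q: "p ^ n = Suc q" using p_pos by (metis gr0_implies_Suc zero_less_power)
  have "act (monom 1 (Suc q)) a = s (act (monom 1 q) a)"
    using a by (simp add: act_monom)
  moreover have "act (monom 1 (Suc q)) a = a" using act_Tp_n[OF a] by (simp add: Tp_def q)
  ultimately show ?thesis using a by (metis act_closed)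
qed

lemma sJ_cls: "a \<in> carrier A \<Longrightarrow> sJ (cls a) = cls (s a)"
proof -
  assume a: "a \<in> carrier A"
  have sp: "s (x [^] p) = s x [^] p" if "x \<in> carrier A" for x
    using s_int_pow[OF that, of "int p"] by (simp add: int_pow_int)
  have "s ` P = P"
    using s_surj by (auto simp: P_def image_image sp)
  moreover have "s ` (P #> a) = (s ` P) #> s a"
    using a subgroup.mem_carrier[OF P_subgroup] by (auto simp: r_coset_def image_UN)
  ultimately show ?thesis by (simp add: sJ_def cls_def)
qed

sublocale J: p_op_group J sJ p
proof -
  interpret J: comm_group J by (rule J_group)
  show "p_op_group J sJ p"
  proof
    show "sJ \<in> hom J J"
      by (rule homI) (auto simp: carrier_J sJ_cls cls_mult)
    fix v assume "v \<in> carrier J"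
    then obtain a where a: "a \<in> carrier A" "v = cls a" by (auto simp: carrier_J)
    then have "v [^]\<^bsub>J\<^esub> p = cls (a [^] p)" by (simp add: cls_nat_pow)
    also have "\<dots> = \<one>\<^bsub>J\<^esub>" using cls_one[of "a [^] p"] a by auto
    finally show "v [^]\<^bsub>J\<^esub> p = \<one>\<^bsub>J\<^esub>" .
  qed (rule p_prime)
qed

lemma act_cls: "a \<in> carrier A \<Longrightarrow> J.act f (cls a) = cls (act f a)"
  by (induction f)
     (auto simp: J.act_pCons act_pCons J_one cls_mult sJ_cls simp flip: cls_int_pow)

lemma act_p: "v \<in> carrier J \<Longrightarrow> J.act (of_nat p * h) v = \<one>\<^bsub>J\<^esub>"
  by (simp add: J.act_comp J.act_of_nat J.exp_p)

lemma xp_cls: "a \<in> carrier A \<Longrightarrow> J.xp (p ^ i) (cls a) = cls (act (Tp p i - 1) a)"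
  using xd_pow[OF p_prime, of i]
  by (auto simp: J.xp_def J.act_add act_p simp flip: act_cls)

lemma xp_cls_Nm: "a \<in> carrier A \<Longrightarrow> i \<le> j \<Longrightarrow> J.xp (p ^ j - p ^ i) (cls a) = cls (act (Nm p i j) a)"
  using xd_pow_Nm[OF p_prime, of i j]
  by (auto simp: J.xp_def J.act_add act_p simp flip: act_cls)

lemma xp_cls_1: "a \<in> carrier A \<Longrightarrow> J.xp 1 (cls a) = cls (act (Tp p 0 - 1) a)"
  using xp_cls[of a 0] by simp

definition E :: "nat \<Rightarrow> 'a set set" where "E i = cls ` L i"

lemma E_subgroup: "subgroup (E i) J"
proof
  show "E i \<subseteq> carrier J" using L_closed by (auto simp: E_def)
  show "\<one>\<^bsub>J\<^esub> \<in> E i" unfolding E_def J_one by (intro imageI) (simp add: L_iff)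
  show "x \<otimes>\<^bsub>J\<^esub> y \<in> E i" if "x \<in> E i" "y \<in> E i" for x y
    using that by (auto simp: E_def cls_mult L_closed intro!: imageI L_mult)
  show "inv\<^bsub>J\<^esub> x \<in> E i" if x: "x \<in> E i" for x
  proof -
    obtain a where a: "a \<in> L i" "x = cls a" using x by (auto simp: E_def)
    have "inv\<^bsub>J\<^esub> x = cls (inv a)"
      using a L_closed[OF a(1)] by (intro J.inv_equality) (auto simp: cls_mult J_one)
    then show ?thesis using L_inv[OF a(1)] by (simp add: E_def)
  qed
qed

lemma E_sJ: "v \<in> E i \<Longrightarrow> sJ v \<in> E i"
proof -
  assume v: "v \<in> E i"
  have "s a \<in> L i" if "a \<in> L i" for a using L_act[OF that, of "[:0, 1:]"] that by (simp add: act_pCons L_closed)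
  then show ?thesis using v by (auto simp: E_def sJ_cls L_closed)
qed

definition Q :: "'a set set" where "Q = cls ` {a \<in> carrier A. pnorm a}"

lemma pnorm_cong: "a \<in> carrier A \<Longrightarrow> b \<in> carrier A \<Longrightarrow> cls a = cls b \<Longrightarrow> pnorm a \<Longrightarrow> pnorm b"
proof -
  assume a: "a \<in> carrier A" "b \<in> carrier A" "cls a = cls b" "pnorm a"
  then obtain c where "c \<in> carrier A" "b = a \<otimes> c [^] p" using cls_eq[of b a] by auto
  then show "pnorm b" using a pnorm_pow pnorm_mult by simp
qed

lemma cls_Q: "a \<in> carrier A \<Longrightarrow> cls a \<in> Q \<longleftrightarrow> pnorm a"
  using pnorm_cong by (auto simp: Q_def)

definition exc_at :: "nat extended \<Rightarrow> 'a \<Rightarrow> bool" where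
  "exc_at j a \<longleftrightarrow> a \<in> carrier A \<and> \<not> pnorm a \<and>
     cls (act (Tp p 0 - 1) a) \<in> (case j of Fin i \<Rightarrow> E i | _ \<Rightarrow> {cls \<one>})"

text \<open>The clause on p and n is carried along because for p^n = 2 an index 0 would be too large
  for \<open>d_nil\<close>; in that case the second alternative, index -\<infinity>, is the one
  provided.\<close>

lemma exc_exists:
  assumes n: "n \<ge> 1" and c: "p = 2 \<Longrightarrow> n > 1 \<or> (\<exists>e\<in>carrier A. act (Nm p 0 n) e = \<xi>)"
  shows "(\<exists>a. exc_at (Fin (n - 1)) a) \<and> (p = 2 \<longrightarrow> n > 1) \<or> (\<exists>a. exc_at Minf a)"
proof (cases "p = 2 \<longrightarrow> n > 1")
  case True
  then show ?thesis using exceptional_exists[OF n] by (auto simp: exc_at_def E_def)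
next
  case False
  then obtain e where e: "e \<in> carrier A" "act (Nm p 0 n) e = \<xi>" using c by auto
  have "n = 1" "p = 2" using False n by auto
  then obtain a where "a \<in> carrier A" "\<not> pnorm a" "\<exists>c\<in>carrier A. act (Tp p 0 - 1) a = c [^] p"
    using exceptional_exists_quadratic e by blast
  then have "exc_at Minf a" using cls_one[of "act (Tp p 0 - 1) a"] by (simp add: exc_at_def J_one)
  then show ?thesis by blast
qed

lemma pclass_mod:
  assumes n: "n \<ge> 1" and c: "p = 2 \<Longrightarrow> n > 1 \<or> (\<exists>e\<in>carrier A. act (Nm p 0 n) e = \<xi>)"
    and d: "exc_at m d" and m: "m \<in> insert Minf (Fin ` {0..n})"
    and m_min: "\<And>j a. j \<in> insert Minf (Fin ` {0..n}) \<Longrightarrow> exc_at j a \<Longrightarrow> m \<le> j"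
  shows "pclass_mod J sJ p n E Q (cls d) m"
proof -
  have dc: "d \<in> carrier A" "\<not> pnorm d" using d by (auto simp: exc_at_def)
  \<comment> \<open>An exceptional element of index n - 1 or -\<infinity> exists, so minimality
    excludes m = n.\<close>
  have m_le: "m = Minf \<or> (\<exists>k<n. m = Fin k \<and> (p = 2 \<longrightarrow> n > 1))"
  proof -
    have "m = Minf" if "exc_at Minf a" for a using m_min[of Minf a] that by simp
    moreover have "m \<le> Fin (n - 1)" if "exc_at (Fin (n - 1)) a" for a using m_min[of "Fin (n - 1)" a] that by simp
    ultimately have "m = Minf \<or> m \<le> Fin (n - 1) \<and> (p = 2 \<longrightarrow> n > 1)" using exc_exists[OF n c] by blast
    then show ?thesis using n by (cases m) auto
  qed
  have xd: "J.xp 1 (cls d) = cls (act (Tp p 0 - 1) d)" using xp_cls_1 dc by blast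
  note Esub = E_subgroup
  have Emono: "E i \<subseteq> E j" if "i \<le> j" for i j using L_mono that by (auto simp: E_def)
  have En: "E n = carrier J" using carrier_J L_n by (simp add: E_def)
  have Enil: "J.xp (p ^ i) v = \<one>\<^bsub>J\<^esub>" if "v \<in> E i" for i v
    using that xp_cls by (auto simp: E_def L_closed L_iff J_one)
  have Enorm: "J.xp (p ^ j - p ^ i) v \<in> E i" if "i \<le> j" "v \<in> E j" for i j v
    using that xp_cls_Nm Nm_L by (auto simp: E_def L_closed)
  have Qsub: "subgroup Q J"
  proof
    show "Q \<subseteq> carrier J" by (auto simp: Q_def)
    have "pnorm \<one>" using pnorm_pow[of \<one>] by simp
    then show "\<one>\<^bsub>J\<^esub> \<in> Q" by (simp add: J_one cls_Q)
    show "x \<otimes>\<^bsub>J\<^esub> y \<in> Q" if "x \<in> Q" "y \<in> Q" for x y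
      using that by (auto simp: Q_def cls_mult intro!: imageI pnorm_mult)
    show "inv\<^bsub>J\<^esub> x \<in> Q" if x: "x \<in> Q" for x
    proof -
      obtain a where a: "a \<in> carrier A" "pnorm a" "x = cls a" using x by (auto simp: Q_def)
      have "inv\<^bsub>J\<^esub> x = cls (inv a)"
        using a by (intro J.inv_equality) (auto simp: cls_mult J_one)
      then show ?thesis using pnorm_inv a by (simp add: cls_Q)
    qed
  qed
  have QE: "v \<in> E i" if i: "i < n" and v: "v \<in> Q" "J.xp (p ^ i) v = \<one>\<^bsub>J\<^esub>" for i v
  proof -
    obtain g where g: "g \<in> carrier A" "pnorm g" "v = cls g" using v by (auto simp: Q_def)
    have "cls (act (Tp p i - 1) g) = \<one>\<^bsub>J\<^esub>" using v g xp_cls by simp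
    then obtain b where b: "b \<in> carrier A" "act (Tp p i - 1) g = b [^] p"
      using cls_one[of "act (Tp p i - 1) g"] g by auto
    obtain a c where ac: "a \<in> L i" "c \<in> carrier A" "g = a \<otimes> c [^] p" using fixed_class[OF i g(1) b g(2)] by blast
    then have "v = cls a" using g cls_eq[of g a] L_closed by auto
    then show ?thesis using ac by (auto simp: E_def)
  qed
  have Esplit: "\<exists>a\<in>E i. \<exists>b\<in>E (i - 1). v = J.xp 1 a \<otimes>\<^bsub>J\<^esub> b"
    if i: "0 < i" "i \<le> n" and v: "v \<in> E i" "J.xp (p ^ i - 1) v = \<one>\<^bsub>J\<^esub>" and vQ: "i = n \<Longrightarrow> v \<in> Q" for i v
  proof -
    obtain g where g: "g \<in> L i" "v = cls g" using v by (auto simp: E_def)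
    have gc: "g \<in> carrier A" using g L_closed by blast
    \<comment> \<open>At i = n the root of the norm in F is supplied by membership in Q; at lower
      levels the vanishing of x^(p^i - 1) v gives only a root in K, and \<open>g\<close> is changed
      within its class.\<close>
    have "\<exists>a\<in>L i. cls g = cls a \<and> (\<exists>f\<in>L 0. act (Nm p 0 i) a = f [^] p)"
    proof (cases "i = n")
      case True
      then have "pnorm g" using vQ g gc cls_Q by simp
      then show ?thesis using True g by (auto simp: pnorm_def)
    next
      case False
      have "cls (act (Nm p 0 i) g) = \<one>\<^bsub>J\<^esub>" using v(2) g xp_cls_Nm[OF gc, of 0 i] by simp
      then obtain h where h: "h \<in> carrier A" "act (Nm p 0 i) g = h [^] p"
        using cls_one[of "act (Nm p 0 i) g"] gc by auto
      obtain a c where ac: "a \<in> L i" "c \<in> carrier A" "g = a \<otimes> c [^] p" "\<exists>f\<in>L 0. act (Nm p 0 i) a = f [^] p"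
        using norm_pth_power[OF _ g(1) h] i False by auto
      then have "cls g = cls a" using cls_eq[of g a] gc L_closed by auto
      then show ?thesis using ac by blast
    qed
    then obtain a f where a: "a \<in> L i" "cls g = cls a" "f \<in> L 0" "act (Nm p 0 i) a = f [^] p" by blast
    obtain a' b where ab: "a' \<in> L (i - 1)" "b \<in> L i" "a = act (Tp p 0 - 1) b \<otimes> a'"
      using norm_fixed_pth_power[OF i a(1,3,4)] by blast
    have "v = J.xp 1 (cls b) \<otimes>\<^bsub>J\<^esub> cls a'"
      using g(2) a(2) ab L_closed[OF ab(1)] L_closed[OF ab(2)] xp_cls_1 by (simp add: cls_mult)
    then show ?thesis using ab by (auto simp: E_def)
  qed
  have adj: "\<exists>c::nat. v \<otimes>\<^bsub>J\<^esub> cls d [^]\<^bsub>J\<^esub> c \<in> Q"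
    if v: "v \<in> carrier J" "J.xp (p ^ n - 1) v = \<one>\<^bsub>J\<^esub>" and dn: "J.xp (p ^ n - 1) (cls d) = \<one>\<^bsub>J\<^esub>" for v
  proof -
    obtain g where g: "g \<in> carrier A" "v = cls g" using v by (auto simp: carrier_J)
    have *: "\<exists>h\<in>carrier A. act (Nm p 0 n) g = h [^] p" if "g \<in> carrier A" "J.xp (p ^ n - 1) (cls g) = \<one>\<^bsub>J\<^esub>" for g
      using that xp_cls_Nm[of g 0 n] cls_one[of "act (Nm p 0 n) g"] by simp
    obtain h k where "h \<in> carrier A" "act (Nm p 0 n) g = h [^] p" "k \<in> carrier A" "act (Nm p 0 n) d = k [^] p"
      using *[of g] *[of d] g v dn dc by auto
    then obtain c :: nat where "pnorm (g \<otimes> d [^] c)" using pnorm_adjust g(1) dc by blast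
    then have "cls (g \<otimes> d [^] c) \<in> Q" using g dc by (simp add: cls_Q)
    then show ?thesis using g dc by (auto simp: cls_nat_pow simp flip: cls_mult)
  qed
  have mc: "m = Minf \<and> J.xp 1 (cls d) = \<one>\<^bsub>J\<^esub> \<or> (\<exists>k<n. m = Fin k \<and> J.xp 1 (cls d) \<in> E k)"
    using m_le d unfolding exc_at_def xd by (auto simp: J_one)
  have dnil: "J.xp (p ^ n - 1) (cls d) = \<one>\<^bsub>J\<^esub>"
    using mc
  proof
    assume "m = Minf \<and> J.xp 1 (cls d) = \<one>\<^bsub>J\<^esub>"
    moreover have "1 \<le> p ^ n - 1" using prime_gt_1_nat[OF p_prime] n power_increasing[of 1 n p] by simp
    ultimately show ?thesis using J.xp_le[of "cls d" 1] dc by simp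
  next
    assume "\<exists>k<n. m = Fin k \<and> J.xp 1 (cls d) \<in> E k"
    then obtain k where k: "k < n" "m = Fin k" "J.xp 1 (cls d) \<in> E k" by blast
    have p2: "p \<ge> 2" using prime_ge_2_nat[OF p_prime] .
    have c2: "p = 2 \<longrightarrow> n > 1" using m_le k by auto
    have "J.xp (p ^ k + 1) (cls d) = \<one>\<^bsub>J\<^esub>" using Enil[OF k(3)] dc J.xp_add[of "cls d" "p ^ k" 1] by simp
    moreover have "p ^ k + 1 \<le> p ^ n - 1"
    proof -
      obtain q where q: "n = Suc q" using n by (cases n) auto
      have "p ^ k \<le> p ^ q" using k q p2 by (intro power_increasing) auto
      moreover have "p ^ q + 2 \<le> p * p ^ q"
      proof (cases "p = 2")
        case True
        then have "2 ^ 1 \<le> (2::nat) ^ q" using c2 q by (intro power_increasing) auto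
        then show ?thesis using True by simp
      next
        case False
        then have "3 * p ^ q \<le> p * p ^ q" using p2 by (intro mult_right_mono) auto
        moreover have "1 \<le> p ^ q" using p2 by simp
        ultimately show ?thesis by linarith
      qed
      ultimately show ?thesis unfolding q power_Suc by linarith
    qed
    ultimately show ?thesis using J.xp_le[of "cls d"] dc by simp
  qed
  show ?thesis
  proof (intro pclass_mod.intro J.p_op_group_axioms pclass_mod_axioms.intro)
    fix k v assume mk: "m = Fin k" and v: "v \<in> carrier J" "v \<notin> Q"
    obtain a where a: "a \<in> carrier A" "v = cls a" using v by (auto simp: carrier_J)
    have na: "\<not> pnorm a" using v a cls_Q by simp
    have kn: "k \<le> n" using m mk by auto
    have "\<not> exc_at Minf a" using m_min[of Minf a] mk by (auto simp: less_eq_extended_case)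
    moreover have "\<not> exc_at (Fin j) a" if "j < k" for j using m_min[of "Fin j" a] mk that kn by auto
    ultimately show "J.xp 1 v \<noteq> \<one>\<^bsub>J\<^esub> \<and> (\<forall>j<k. J.xp 1 v \<notin> E j)"
      using a na xp_cls_1[OF a(1)] by (auto simp: exc_at_def J_one)
  next
    fix v assume v: "v \<in> carrier J"
    then show "J.xp 1 v \<in> Q" using pnorm_diff xp_cls_1 by (auto simp: carrier_J cls_Q)
  next
    fix i v assume v: "v \<in> E i"
    then show "sJ v \<in> E i" by (rule E_sJ)
  next
    show "cls d \<notin> Q" using dc cls_Q by simp
  next
    fix i j v assume "i \<le> j" "v \<in> E j"
    then show "J.xp (p ^ j - p ^ i) v \<in> E i" by (rule Enorm)
  next
    fix i v assume "i < n" "v \<in> Q" "J.xp (p ^ i) v = \<one>\<^bsub>J\<^esub>"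
    then show "v \<in> E i" by (rule QE)
  next
    fix i assume "i < n"
    then show "E i \<subseteq> Q" using pnorm_L L_closed by (auto simp: E_def cls_Q)
  next
    fix i v assume "0 < i" "i \<le> n" "v \<in> E i" "J.xp (p ^ i - 1) v = \<one>\<^bsub>J\<^esub>" "i = n \<Longrightarrow> v \<in> Q"
    then show "\<exists>a\<in>E i. \<exists>b\<in>E (i - 1). v = J.xp 1 a \<otimes>\<^bsub>J\<^esub> b" by (rule Esplit)
  next
    fix v assume "v \<in> carrier J" "J.xp (p ^ n - 1) v = \<one>\<^bsub>J\<^esub>"
    then show "\<exists>c::nat. v \<otimes>\<^bsub>J\<^esub> cls d [^]\<^bsub>J\<^esub> c \<in> Q" using dnil by (rule adj)
  qed (assumption | rule n Enil Esub Emono En Enil Qsub mc dnil cls_closed dc(1))+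
qed

end

section \<open>Galois theory of a cyclic group of automorphisms\<close>

text \<open>The monoid is kept abstract because two kinds of characters are needed: powers of an
  automorphism on a field under multiplication, and k \<mapsto> b^k on the natural numbers under
  addition.\<close>

lemma (in domain) dedekind_independence:
  assumes "finite H"
    and M: "\<And>x y. x \<in> M \<Longrightarrow> y \<in> M \<Longrightarrow> mul x y \<in> M" "u \<in> M"
    and \<chi>: "\<And>i x. i \<in> H \<Longrightarrow> x \<in> M \<Longrightarrow> \<chi> i x \<in> carrier R"
      "\<And>i x y. i \<in> H \<Longrightarrow> x \<in> M \<Longrightarrow> y \<in> M \<Longrightarrow> \<chi> i (mul x y) = \<chi> i x \<otimes> \<chi> i y"
      "\<And>i. i \<in> H \<Longrightarrow> \<chi> i u = \<one>"
      "\<And>i j. i \<in> H \<Longrightarrow> j \<in> H \<Longrightarrow> i \<noteq> j \<Longrightarrow> \<exists>x\<in>M. \<chi> i x \<noteq> \<chi> j x"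
    and c: "\<And>i. i \<in> H \<Longrightarrow> c i \<in> carrier R"
    and zero: "\<And>x. x \<in> M \<Longrightarrow> (\<Oplus>i\<in>H. c i \<otimes> \<chi> i x) = \<zero>"
  shows "\<forall>i\<in>H. c i = \<zero>"
  using assms
proof (induction H arbitrary: c rule: finite_induct)
  case (insert a H)
  note \<chi> = insert.prems(3-6) and c = insert.prems(7) and zero = insert.prems(8)
  have split: "c a \<otimes> \<chi> a x \<oplus> (\<Oplus>i\<in>H. c i \<otimes> \<chi> i x) = \<zero>" if "x \<in> M" for x
    using zero[OF that] insert.hyps c \<chi>(1) that by (simp add: finsum_insert Pi_def)
  have sc: "(\<Oplus>i\<in>H. c i \<otimes> \<chi> i x) \<in> carrier R" if "x \<in> M" for x
    using c \<chi>(1) that by (intro finsum_closed) auto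
  have H0: "c j = \<zero>" if j: "j \<in> H" for j
  proof -
    obtain y where y: "y \<in> M" "\<chi> a y \<noteq> \<chi> j y"
      using \<chi>(4)[of a j] j insert.hyps by auto
    \<comment> \<open>Subtracting \<chi>_a(y) times the relation at x from the relation at x y
      eliminates \<chi>_a and leaves a relation between the remaining characters.\<close>
    define b where "b i = c i \<otimes> (\<chi> i y \<ominus> \<chi> a y)" for i
    have "\<forall>i\<in>H. b i = \<zero>"
    proof (rule insert.IH)
      fix x assume x: "x \<in> M"
      have xy: "mul x y \<in> M" using M x y by blast
      have eq: "b i \<otimes> \<chi> i x = c i \<otimes> \<chi> i (mul x y) \<ominus> \<chi> a y \<otimes> (c i \<otimes> \<chi> i x)" if "i \<in> H" for i
      proof -
        have "c i \<in> carrier R" "\<chi> i x \<in> carrier R" "\<chi> i y \<in> carrier R" "\<chi> a y \<in> carrier R"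
          using c \<chi>(1) x y that by auto
        then show ?thesis using \<chi>(2)[of i x y] that x y unfolding b_def by simp algebra
      qed
      have "(\<Oplus>i\<in>H. b i \<otimes> \<chi> i x) = (\<Oplus>i\<in>H. c i \<otimes> \<chi> i (mul x y) \<ominus> \<chi> a y \<otimes> (c i \<otimes> \<chi> i x))"
        using eq c \<chi>(1) x y xy by (intro finsum_cong') auto
      also have "\<dots> = (\<Oplus>i\<in>H. c i \<otimes> \<chi> i (mul x y) \<oplus> (\<ominus> \<chi> a y) \<otimes> (c i \<otimes> \<chi> i x))"
        using c \<chi>(1) x y xy by (intro finsum_cong') (auto simp: a_minus_def l_minus)
      also have "\<dots> = (\<Oplus>i\<in>H. c i \<otimes> \<chi> i (mul x y)) \<oplus> (\<Oplus>i\<in>H. (\<ominus> \<chi> a y) \<otimes> (c i \<otimes> \<chi> i x))"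
        using c \<chi>(1) x y xy by (intro finsum_addf) auto
      also have "(\<Oplus>i\<in>H. (\<ominus> \<chi> a y) \<otimes> (c i \<otimes> \<chi> i x)) = (\<ominus> \<chi> a y) \<otimes> (\<Oplus>i\<in>H. c i \<otimes> \<chi> i x)"
        using c \<chi>(1) x y insert.hyps by (intro finsum_rdistr[symmetric]) auto
      also have "(\<Oplus>i\<in>H. c i \<otimes> \<chi> i (mul x y)) \<oplus> (\<ominus> \<chi> a y) \<otimes> (\<Oplus>i\<in>H. c i \<otimes> \<chi> i x) = \<zero>"
      proof -
        define S1 S2 where "S1 = (\<Oplus>i\<in>H. c i \<otimes> \<chi> i (mul x y))" and "S2 = (\<Oplus>i\<in>H. c i \<otimes> \<chi> i x)"
        have car: "S1 \<in> carrier R" "S2 \<in> carrier R" "c a \<in> carrier R" "\<chi> a x \<in> carrier R" "\<chi> a y \<in> carrier R"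
          using sc[OF xy] sc[OF x] c \<chi>(1) x y by (auto simp: S1_def S2_def)
        have "c a \<otimes> (\<chi> a x \<otimes> \<chi> a y) \<oplus> S1 = \<zero>" "c a \<otimes> \<chi> a x \<oplus> S2 = \<zero>"
          using split[OF xy] split[OF x] \<chi>(2)[of a x y] x y by (auto simp: S1_def S2_def)
        then have "S1 = \<ominus> (c a \<otimes> (\<chi> a x \<otimes> \<chi> a y))" "S2 = \<ominus> (c a \<otimes> \<chi> a x)"
          using car minus_equality[of S1 "c a \<otimes> (\<chi> a x \<otimes> \<chi> a y)"] minus_equality[of S2 "c a \<otimes> \<chi> a x"]
          by (auto simp: a_comm)
        then show ?thesis using car unfolding S1_def[symmetric] S2_def[symmetric] by simp algebra
      qed
      finally show "(\<Oplus>i\<in>H. b i \<otimes> \<chi> i x) = \<zero>" .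
    qed (use insert.prems y in \<open>auto simp: b_def\<close>)
    then have "c j \<otimes> (\<chi> j y \<ominus> \<chi> a y) = \<zero>" using j by (auto simp: b_def)
    moreover have "\<chi> j y \<ominus> \<chi> a y \<noteq> \<zero>" using y \<chi>(1) j by (metis insertI1 insertI2 r_right_minus_eq)
    ultimately show ?thesis using c \<chi>(1) j y integral by (metis insertI1 insertI2 minus_closed)
  qed
  have "(\<Oplus>i\<in>H. c i \<otimes> \<chi> i u) = (\<Oplus>i\<in>H. \<zero>)"
    using H0 \<chi>(1) M by (intro finsum_cong') auto
  then have "c a \<otimes> \<chi> a u = \<zero>" using split[OF M(2)] c \<chi>(1) M by simp
  then have "c a = \<zero>" using \<chi>(3)[of a] c[of a] by simp
  then show ?case using H0 by simp
qed simp

text \<open>Gaussian elimination, one equation per induction step. The reduced system has one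
  unknown less, and the unknown at the pivot \<open>i0\<close> is chosen afterwards to satisfy the
  removed equation.\<close>

lemma (in field) underdetermined_system:
  assumes "finite T" "finite I" "card T < card I" "\<And>t i. t \<in> T \<Longrightarrow> i \<in> I \<Longrightarrow> a t i \<in> carrier R"
  shows "\<exists>c. (\<forall>i\<in>I. c i \<in> carrier R) \<and> (\<exists>i\<in>I. c i \<noteq> \<zero>) \<and> (\<forall>t\<in>T. (\<Oplus>i\<in>I. a t i \<otimes> c i) = \<zero>)"
  using assms
proof (induction T arbitrary: I a rule: finite_induct)
  case empty
  then have "I \<noteq> {}" by auto
  then show ?case by (intro exI[of _ "\<lambda>_. \<one>"]) auto
next
  case (insert t0 T)
  show ?case
  proof (cases "\<forall>i\<in>I. a t0 i = \<zero>")
    case True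
    have "card T < card I" using insert by simp
    then obtain c where c: "\<forall>i\<in>I. c i \<in> carrier R" "\<exists>i\<in>I. c i \<noteq> \<zero>" "\<forall>t\<in>T. (\<Oplus>i\<in>I. a t i \<otimes> c i) = \<zero>"
      using insert.IH[of I a] insert.prems by auto
    have "(\<Oplus>i\<in>I. a t0 i \<otimes> c i) = (\<Oplus>i\<in>I. \<zero>)" using True c by (intro finsum_cong') auto
    then show ?thesis using c by (intro exI[of _ c]) auto
  next
    case False
    then obtain i0 where i0: "i0 \<in> I" "a t0 i0 \<noteq> \<zero>" by blast
    define v where "v = inv (a t0 i0)"
    have vU: "a t0 i0 \<in> Units R" using i0 insert.prems by (auto simp: field_Units)
    then have v: "v \<in> carrier R" "v \<otimes> a t0 i0 = \<one>" by (auto simp: v_def)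
    define I' where "I' = I - {i0}"
    have I': "finite I'" "i0 \<notin> I'" "I = insert i0 I'" "card T < card I'"
      using insert i0 by (auto simp: I'_def)
    have ac: "a t i \<in> carrier R" if "t \<in> insert t0 T" "i \<in> I" for t i using insert.prems that by auto
    define a' where "a' t i = a t i \<ominus> (a t i0 \<otimes> v) \<otimes> a t0 i" for t i
    have a'c: "a' t i \<in> carrier R" if "t \<in> T" "i \<in> I'" for t i
      using that ac v I' by (auto simp: a'_def)
    obtain c where c: "\<forall>i\<in>I'. c i \<in> carrier R" "\<exists>i\<in>I'. c i \<noteq> \<zero>" "\<forall>t\<in>T. (\<Oplus>i\<in>I'. a' t i \<otimes> c i) = \<zero>"
    proof -
      have "\<exists>c. (\<forall>i\<in>I'. c i \<in> carrier R) \<and> (\<exists>i\<in>I'. c i \<noteq> \<zero>) \<and> (\<forall>t\<in>T. (\<Oplus>i\<in>I'. a' t i \<otimes> c i) = \<zero>)"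
        by (rule insert.IH[OF I'(1,4)]) (rule a'c)
      then show ?thesis using that by (elim exE conjE)
    qed
    define S where "S = (\<Oplus>i\<in>I'. a t0 i \<otimes> c i)"
    have S: "S \<in> carrier R" unfolding S_def using ac c I' by (intro finsum_closed) auto
    define b where "b = c(i0 := \<ominus> (v \<otimes> S))"
    have bc: "b i0 \<in> carrier R" "b i0 = \<ominus> (v \<otimes> S)" "\<And>i. i \<in> I' \<Longrightarrow> b i = c i"
      using S v I' by (auto simp: b_def)
    have sum: "(\<Oplus>i\<in>I. a t i \<otimes> b i) = a t i0 \<otimes> b i0 \<oplus> (\<Oplus>i\<in>I'. a t i \<otimes> c i)" if t: "t \<in> insert t0 T" for t
    proof -
      have "(\<Oplus>i\<in>I. a t i \<otimes> b i) = a t i0 \<otimes> b i0 \<oplus> (\<Oplus>i\<in>I'. a t i \<otimes> b i)"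
        unfolding I'(3) using I' ac[OF t] bc c by (subst finsum_insert) auto
      also have "(\<Oplus>i\<in>I'. a t i \<otimes> b i) = (\<Oplus>i\<in>I'. a t i \<otimes> c i)"
        using bc c ac[OF t] I' by (intro finsum_cong') auto
      finally show ?thesis .
    qed
    have "(\<Oplus>i\<in>I. a t i \<otimes> b i) = \<zero>" if t: "t \<in> insert t0 T" for t
    proof (cases "t = t0")
      case True
      have "a t0 i0 \<otimes> \<ominus> (v \<otimes> S) \<oplus> S = \<ominus> ((v \<otimes> a t0 i0) \<otimes> S) \<oplus> S"
        using v S ac[of t0 i0] i0 by simp algebra
      also have "\<dots> = \<zero>" using v S by (simp add: l_neg)
      finally show ?thesis using sum[OF t] True bc by (simp add: S_def)
    next
      case False
      then have tT: "t \<in> T" using t by simp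
      have ti0: "a t i0 \<in> carrier R" using ac t i0 by blast
      have "(\<Oplus>i\<in>I'. a' t i \<otimes> c i) = (\<Oplus>i\<in>I'. a t i \<otimes> c i \<oplus> (\<ominus> (a t i0 \<otimes> v)) \<otimes> (a t0 i \<otimes> c i))"
      proof (rule finsum_cong')
        fix i assume i: "i \<in> I'"
        have "c i \<in> carrier R" "a t i \<in> carrier R" "a t0 i \<in> carrier R" using i c ac t I' by auto
        then show "a' t i \<otimes> c i = a t i \<otimes> c i \<oplus> (\<ominus> (a t i0 \<otimes> v)) \<otimes> (a t0 i \<otimes> c i)"
          unfolding a'_def using v(1) ti0 by algebra
      qed (use c ac t I' v ti0 in auto)
      also have "\<dots> = (\<Oplus>i\<in>I'. a t i \<otimes> c i) \<oplus> (\<Oplus>i\<in>I'. (\<ominus> (a t i0 \<otimes> v)) \<otimes> (a t0 i \<otimes> c i))"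
        using c ac t I' v ti0 by (intro finsum_addf) auto
      also have "(\<Oplus>i\<in>I'. (\<ominus> (a t i0 \<otimes> v)) \<otimes> (a t0 i \<otimes> c i)) = (\<ominus> (a t i0 \<otimes> v)) \<otimes> S"
        unfolding S_def using c ac t I' v ti0 by (intro finsum_rdistr[symmetric]) auto
      finally have e: "(\<Oplus>i\<in>I'. a t i \<otimes> c i) \<oplus> (\<ominus> (a t i0 \<otimes> v)) \<otimes> S = \<zero>" using c tT by simp
      define U where "U = (\<Oplus>i\<in>I'. a t i \<otimes> c i)"
      have U: "U \<in> carrier R" unfolding U_def using c ac t I' by (intro finsum_closed) auto
      have "a t i0 \<otimes> \<ominus> (v \<otimes> S) \<oplus> U = U \<oplus> (\<ominus> (a t i0 \<otimes> v)) \<otimes> S"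
        using U S v(1) ti0 by algebra
      then show ?thesis using sum[OF t] e bc by (simp add: U_def)
    qed
    moreover have "\<exists>i\<in>I. b i \<noteq> \<zero>" using c(2) bc(3) I' by auto
    moreover have "\<forall>i\<in>I. b i \<in> carrier R" using c(1) bc I' by auto
    ultimately show ?thesis by blast
  qed
qed

lemma (in ring) combine_eq_finsum:
  assumes "length Ks = length Us" "set Ks \<subseteq> carrier R" "set Us \<subseteq> carrier R"
  shows "combine Ks Us = (\<Oplus>i\<in>{..<length Us}. Ks ! i \<otimes> Us ! i)"
  using assms
proof (induction Ks Us rule: list_induct2)
  case (Cons k Ks u Us)
  have "{..<length (u # Us)} = insert 0 (Suc ` {..<length Us})" by (simp add: lessThan_Suc_eq_insert_0)
  moreover have "(\<Oplus>i\<in>insert 0 (Suc ` {..<length Us}). (k # Ks) ! i \<otimes> (u # Us) ! i)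
     = k \<otimes> u \<oplus> (\<Oplus>i\<in>Suc ` {..<length Us}. (k # Ks) ! i \<otimes> (u # Us) ! i)"
    using Cons by (subst finsum_insert) (auto simp: subset_iff)
  moreover have "(\<Oplus>i\<in>Suc ` {..<length Us}. (k # Ks) ! i \<otimes> (u # Us) ! i) = (\<Oplus>i\<in>{..<length Us}. Ks ! i \<otimes> Us ! i)"
    using Cons by (subst finsum_reindex) (auto simp: subset_iff)
  ultimately show ?case using Cons by simp
qed simp

text \<open>A single endomorphism with fixed field F takes the place of the Galois group; its
  injectivity and its order \<open>D\<close> are derived below.\<close>

locale cyc_field = field R for R (structure) +
  fixes F :: "'a set" and s :: "'a \<Rightarrow> 'a" and D :: nat
  assumes F: "subfield F R" and s_hom: "s \<in> ring_hom R R"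
    and fixed: "{x \<in> carrier R. s x = x} = F"
    and dim: "dimension D F (carrier R)"
begin

lemma F_carrier: "x \<in> F \<Longrightarrow> x \<in> carrier R" using fixed by auto

sublocale s: ring_hom_cring R R s
  by unfold_locales (use s_hom in \<open>auto simp: ring_hom_def\<close>)

section \<open>Degrees and fixed fields for the powers of one automorphism\<close>

lemma pow_hom: "s ^^ k \<in> ring_hom R R"
proof (induction k)
  case (Suc k)
  then show ?case using s_hom by (auto simp: ring_hom_def Pi_iff)
qed (auto simp: ring_hom_def)

lemma sp_closed [simp]: "x \<in> carrier R \<Longrightarrow> (s ^^ k) x \<in> carrier R"
  using pow_hom ring_hom_closed by metis
lemma sp_mult: "x \<in> carrier R \<Longrightarrow> y \<in> carrier R \<Longrightarrow> (s ^^ k) (x \<otimes> y) = (s ^^ k) x \<otimes> (s ^^ k) y"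
  using pow_hom ring_hom_mult by metis
lemma sp_add: "x \<in> carrier R \<Longrightarrow> y \<in> carrier R \<Longrightarrow> (s ^^ k) (x \<oplus> y) = (s ^^ k) x \<oplus> (s ^^ k) y"
  using pow_hom ring_hom_add by metis
lemma sp_one [simp]: "(s ^^ k) \<one> = \<one>" using pow_hom ring_hom_one by metis
lemma sp_zero [simp]: "(s ^^ k) \<zero> = \<zero>" by (induction k) auto
lemma sp_F: "x \<in> F \<Longrightarrow> (s ^^ k) x = x"
  using fixed by (induction k) auto

lemma s_inj: "x \<in> carrier R \<Longrightarrow> y \<in> carrier R \<Longrightarrow> s x = s y \<Longrightarrow> x = y"
proof -
  assume xy: "x \<in> carrier R" "y \<in> carrier R" "s x = s y"
  define u where "u = x \<ominus> y"
  have u: "u \<in> carrier R" "s u = \<zero>" using xy by (simp_all add: u_def a_minus_def r_neg)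
  have "u = \<zero>"
  proof (rule ccontr)
    assume "u \<noteq> \<zero>"
    then have uU: "u \<in> Units R" using u by (simp add: field_Units)
    have "s (u \<otimes> inv u) = s u \<otimes> s (inv u)" using uU by (intro s.hom_mult) auto
    then have "s (u \<otimes> inv u) = \<zero>" using u uU by (simp del: s.hom_mult)
    then have "s \<one> = \<zero>" by (simp only: Units_r_inv[OF uU])
    then show False by simp
  qed
  then have "x \<ominus> y = \<zero>" by (simp add: u_def)
  then show "x = y" using xy by simp
qed

lemma sp_inj: "x \<in> carrier R \<Longrightarrow> y \<in> carrier R \<Longrightarrow> (s ^^ k) x = (s ^^ k) y \<Longrightarrow> x = y"
proof (induction k)
  case (Suc k)
  then show ?case using s_inj[of "(s ^^ k) x" "(s ^^ k) y"] by simp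
qed simp

lemma sp_finsum: "f \<in> I \<rightarrow> carrier R \<Longrightarrow> (s ^^ k) (\<Oplus>i\<in>I. f i) = (\<Oplus>i\<in>I. (s ^^ k) (f i))"
proof -
  assume f: "f \<in> I \<rightarrow> carrier R"
  interpret h: ring_hom_cring R R "s ^^ k" by unfold_locales (use pow_hom in \<open>auto simp: ring_hom_def\<close>)
  show ?thesis using h.hom_finsum[OF f] by (simp add: comp_def)
qed

text \<open>With fewer basis vectors than powers of \<open>s\<close>, some nontrivial linear
  combination of the powers vanishes on a basis of E. All powers fix F, so it vanishes on E, against
  Dedekind.\<close>

lemma dedekind_bound:
  assumes E: "subfield E R" and d: "dimension d F E"
    and dist: "\<And>k l. k < j \<Longrightarrow> l < j \<Longrightarrow> k \<noteq> l \<Longrightarrow> \<exists>x\<in>E. (s ^^ k) x \<noteq> (s ^^ l) x"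
  shows "j \<le> d"
proof (rule ccontr)
  assume "\<not> j \<le> d"
  obtain Us where Us: "set Us \<subseteq> carrier R" "independent F Us" "length Us = d" "Span F Us = E"
    using exists_base[OF F d] by blast
  have Uc: "Us ! i \<in> carrier R" if "i < d" for i using Us that nth_mem by blast
  obtain c where c: "\<forall>k\<in>{..<j}. c k \<in> carrier R" "\<exists>k\<in>{..<j}. c k \<noteq> \<zero>"
     "\<forall>i\<in>{..<d}. (\<Oplus>k\<in>{..<j}. (s ^^ k) (Us ! i) \<otimes> c k) = \<zero>"
    using underdetermined_system[of "{..<d}" "{..<j}" "\<lambda>i k. (s ^^ k) (Us ! i)"] Uc \<open>\<not> j \<le> d\<close> by auto
  have Ec: "x \<in> carrier R" if "x \<in> E" for x using subfieldE(3)[OF E] that by blast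
  have "\<forall>k\<in>{..<j}. c k = \<zero>"
  proof (rule dedekind_independence[where M = E and mul = "(\<otimes>)" and u = \<one> and \<chi> = "\<lambda>k. s ^^ k"])
    fix x assume x: "x \<in> E"
    then obtain Ks where Ks: "length Ks = d" "set Ks \<subseteq> F" "x = combine Ks Us"
      using Span_eq_combine_set_length_version[OF F Us(1)] Us(3,4) by (auto simp del: Span.simps)
    have KF: "Ks ! i \<in> F" "Ks ! i \<in> carrier R" if "i < d" for i using Ks that nth_mem F_carrier by blast+
    have xs: "x = (\<Oplus>i\<in>{..<d}. Ks ! i \<otimes> Us ! i)"
      using combine_eq_finsum[of Ks Us] Ks Us F_carrier by auto
    have "(\<Oplus>k\<in>{..<j}. c k \<otimes> (s ^^ k) x) = (\<Oplus>k\<in>{..<j}. \<Oplus>i\<in>{..<d}. Ks ! i \<otimes> ((s ^^ k) (Us ! i) \<otimes> c k))"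
    proof (rule finsum_cong')
      fix k assume k: "k \<in> {..<j}"
      have ck: "c k \<in> carrier R" using c k by blast
      have "(s ^^ k) x = (\<Oplus>i\<in>{..<d}. Ks ! i \<otimes> (s ^^ k) (Us ! i))"
        unfolding xs using KF Uc by (subst sp_finsum) (auto intro!: finsum_cong' simp: sp_mult sp_F)
      then have "c k \<otimes> (s ^^ k) x = (\<Oplus>i\<in>{..<d}. c k \<otimes> (Ks ! i \<otimes> (s ^^ k) (Us ! i)))"
        using KF Uc ck by (simp add: finsum_rdistr)
      also have "\<dots> = (\<Oplus>i\<in>{..<d}. Ks ! i \<otimes> ((s ^^ k) (Us ! i) \<otimes> c k))"
        using KF Uc ck by (intro finsum_cong') (auto simp: m_ac)
      finally show "c k \<otimes> (s ^^ k) x = (\<Oplus>i\<in>{..<d}. Ks ! i \<otimes> ((s ^^ k) (Us ! i) \<otimes> c k))" .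
    qed (use KF Uc c in \<open>auto intro!: finsum_closed\<close>)
    also have "\<dots> = (\<Oplus>i\<in>{..<d}. \<Oplus>k\<in>{..<j}. Ks ! i \<otimes> ((s ^^ k) (Us ! i) \<otimes> c k))"
    proof -
      have "(\<Oplus>k\<in>A. \<Oplus>i\<in>{..<d}. g k i) = (\<Oplus>i\<in>{..<d}. \<Oplus>k\<in>A. g k i)"
        if "finite A" "\<And>k i. k \<in> A \<Longrightarrow> i < d \<Longrightarrow> g k i \<in> carrier R" for A :: "nat set" and g
        using that
      proof (induction A rule: finite_induct)
        case (insert b A)
        have "(\<Oplus>k\<in>insert b A. \<Oplus>i\<in>{..<d}. g k i) = (\<Oplus>i\<in>{..<d}. g b i) \<oplus> (\<Oplus>i\<in>{..<d}. \<Oplus>k\<in>A. g k i)"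
          using insert by (subst finsum_insert) (auto intro!: finsum_closed)
        also have "\<dots> = (\<Oplus>i\<in>{..<d}. g b i \<oplus> (\<Oplus>k\<in>A. g k i))"
          using insert by (intro finsum_addf[symmetric]) (auto intro!: finsum_closed)
        also have "\<dots> = (\<Oplus>i\<in>{..<d}. \<Oplus>k\<in>insert b A. g k i)"
          using insert by (intro finsum_cong') (auto intro!: finsum_closed simp: Pi_def)
        finally show ?case .
      qed simp
      note swap = this
      show ?thesis by (rule swap) (use KF Uc c in auto)
    qed
    also have "\<dots> = (\<Oplus>i\<in>{..<d}. \<zero>)"
    proof (rule finsum_cong')
      fix i assume i: "i \<in> {..<d}"
      have "(\<Oplus>k\<in>{..<j}. Ks ! i \<otimes> ((s ^^ k) (Us ! i) \<otimes> c k)) = Ks ! i \<otimes> (\<Oplus>k\<in>{..<j}. (s ^^ k) (Us ! i) \<otimes> c k)"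
        using KF Uc c i by (intro finsum_rdistr[symmetric]) auto
      then show "(\<Oplus>k\<in>{..<j}. Ks ! i \<otimes> ((s ^^ k) (Us ! i) \<otimes> c k)) = \<zero>" using c(3) i KF by simp
    qed auto
    finally show "(\<Oplus>k\<in>{..<j}. c k \<otimes> (s ^^ k) x) = \<zero>" by simp
  qed (use subringE(3,6)[OF subfieldE(1)[OF E]] dist c Ec in \<open>auto simp: sp_mult\<close>)
  then show False using c(2) by blast
qed

text \<open>Artin's argument. A nontrivial solution with smallest support, scaled to have an entry
  1, is mapped by \<open>s\<close> to another solution; their difference has smaller support and so
  is zero. The entries then lie in F, and the equation for k = 0 is a dependence between basis
  vectors.\<close>

lemma artin_bound:
  assumes d: "dimension d F E" and j: "j > 0" "\<And>x. x \<in> E \<Longrightarrow> (s ^^ j) x = x"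
  shows "d \<le> j"
proof (rule ccontr)
  assume "\<not> d \<le> j"
  obtain Us where Us: "set Us \<subseteq> carrier R" "independent F Us" "length Us = d" "Span F Us = E"
    using exists_base[OF F d] by blast
  have Uc: "Us ! i \<in> carrier R" "Us ! i \<in> E" if "i < d" for i
    using Us that nth_mem Span_base_incl[OF F Us(1)] by blast+
  define sol where "sol c \<longleftrightarrow> (\<forall>i\<in>{..<d}. c i \<in> carrier R) \<and>
    (\<forall>k\<in>{..<j}. (\<Oplus>i\<in>{..<d}. (s ^^ k) (Us ! i) \<otimes> c i) = \<zero>)" for c
  define supp where "supp c = {i \<in> {..<d}. c i \<noteq> \<zero>}" for c :: "nat \<Rightarrow> 'a"
  have "\<exists>c. sol c \<and> supp c \<noteq> {}"
    using underdetermined_system[of "{..<j}" "{..<d}" "\<lambda>k i. (s ^^ k) (Us ! i)"] Uc \<open>\<not> d \<le> j\<close>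
    unfolding sol_def supp_def by auto
  then obtain c where c: "sol c" "supp c \<noteq> {}"
    and minc: "\<And>b. sol b \<Longrightarrow> supp b \<noteq> {} \<Longrightarrow> card (supp c) \<le> card (supp b)"
    using ex_has_least_nat[of "\<lambda>c. sol c \<and> supp c \<noteq> {}" _ "\<lambda>c. card (supp c)"] by metis
  have cc: "c i \<in> carrier R" if "i < d" for i using c that by (auto simp: sol_def)
  obtain i0 where i0: "i0 < d" "c i0 \<noteq> \<zero>" using c by (auto simp: supp_def)
  define v where "v = inv (c i0)"
  have v: "v \<in> carrier R" "v \<otimes> c i0 = \<one>" "v \<noteq> \<zero>"
  proof -
    have "c i0 \<in> Units R" using i0 cc by (simp add: field_Units)
    then show "v \<in> carrier R" "v \<otimes> c i0 = \<one>" by (auto simp: v_def)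
    then show "v \<noteq> \<zero>" using cc i0 by auto
  qed
  define b where "b i = v \<otimes> c i" for i
  have bc: "b i \<in> carrier R" if "i < d" for i using cc v that by (simp add: b_def)
  have bsum: "(\<Oplus>i\<in>{..<d}. (s ^^ k) (Us ! i) \<otimes> b i) = \<zero>" if "k < j" for k
  proof -
    have "(\<Oplus>i\<in>{..<d}. (s ^^ k) (Us ! i) \<otimes> b i) = (\<Oplus>i\<in>{..<d}. v \<otimes> ((s ^^ k) (Us ! i) \<otimes> c i))"
      using Uc cc v by (intro finsum_cong') (auto simp: b_def m_ac)
    also have "\<dots> = v \<otimes> (\<Oplus>i\<in>{..<d}. (s ^^ k) (Us ! i) \<otimes> c i)"
      using Uc cc v by (intro finsum_rdistr[symmetric]) auto
    finally show ?thesis using c(1) that v by (simp add: sol_def)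
  qed
  have suppb: "supp b = supp c"
    using v cc by (auto simp: supp_def b_def integral_iff)
  have ssum: "(\<Oplus>i\<in>{..<d}. (s ^^ k) (Us ! i) \<otimes> s (b i)) = \<zero>" if k: "k < j" for k
  proof -
    have *: "(\<Oplus>i\<in>{..<d}. (s ^^ Suc l) (Us ! i) \<otimes> s (b i)) = \<zero>" if "l < j" for l
    proof -
      have "s (\<Oplus>i\<in>{..<d}. (s ^^ l) (Us ! i) \<otimes> b i) = (\<Oplus>i\<in>{..<d}. (s ^^ Suc l) (Us ! i) \<otimes> s (b i))"
        using sp_finsum[of "\<lambda>i. (s ^^ l) (Us ! i) \<otimes> b i" "{..<d}" 1] Uc bc
        by (auto intro!: finsum_cong')
      then show ?thesis using bsum[OF that] by simp
    qed
    show ?thesis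
    proof (cases k)
      case 0
      obtain l where l: "j = Suc l" using j(1) by (cases j) auto
      have "(\<Oplus>i\<in>{..<d}. (s ^^ 0) (Us ! i) \<otimes> s (b i)) = (\<Oplus>i\<in>{..<d}. (s ^^ Suc l) (Us ! i) \<otimes> s (b i))"
        using Uc bc j(2) unfolding l[symmetric] by (intro finsum_cong') auto
      then show ?thesis using *[of l] l 0 by simp
    next
      case (Suc l)
      then show ?thesis using *[of l] k by simp
    qed
  qed
  define e where "e i = s (b i) \<ominus> b i" for i
  have ec: "e i \<in> carrier R" if "i < d" for i using bc that by (simp add: e_def)
  have "sol e"
    unfolding sol_def
  proof (intro conjI ballI)
    fix k assume k: "k \<in> {..<j}"
    have "(\<Oplus>i\<in>{..<d}. (s ^^ k) (Us ! i) \<otimes> e i) =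
        (\<Oplus>i\<in>{..<d}. (s ^^ k) (Us ! i) \<otimes> s (b i) \<oplus> (\<ominus> \<one>) \<otimes> ((s ^^ k) (Us ! i) \<otimes> b i))"
    proof (rule finsum_cong')
      fix i assume i: "i \<in> {..<d}"
      then have "(s ^^ k) (Us ! i) \<in> carrier R" "b i \<in> carrier R" "s (b i) \<in> carrier R" using Uc bc by auto
      then show "(s ^^ k) (Us ! i) \<otimes> e i = (s ^^ k) (Us ! i) \<otimes> s (b i) \<oplus> (\<ominus> \<one>) \<otimes> ((s ^^ k) (Us ! i) \<otimes> b i)"
        unfolding e_def by algebra
    qed (use Uc bc in auto)
    also have "\<dots> = (\<Oplus>i\<in>{..<d}. (s ^^ k) (Us ! i) \<otimes> s (b i)) \<oplus> (\<Oplus>i\<in>{..<d}. (\<ominus> \<one>) \<otimes> ((s ^^ k) (Us ! i) \<otimes> b i))"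
      using Uc bc by (intro finsum_addf) auto
    also have "(\<Oplus>i\<in>{..<d}. (\<ominus> \<one>) \<otimes> ((s ^^ k) (Us ! i) \<otimes> b i)) = (\<ominus> \<one>) \<otimes> (\<Oplus>i\<in>{..<d}. (s ^^ k) (Us ! i) \<otimes> b i)"
      using Uc bc by (intro finsum_rdistr[symmetric]) auto
    finally show "(\<Oplus>i\<in>{..<d}. (s ^^ k) (Us ! i) \<otimes> e i) = \<zero>" using ssum bsum k by simp
  qed (use ec in auto)
  have "supp e \<subseteq> supp c - {i0}"
  proof
    fix i assume i: "i \<in> supp e"
    have "b i \<noteq> \<zero>" using i by (auto simp: supp_def e_def)
    moreover have "i \<noteq> i0" using i v(2) by (auto simp: supp_def e_def b_def)
    ultimately show "i \<in> supp c - {i0}" using i suppb by (auto simp: supp_def)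
  qed
  moreover have "finite (supp c)" "i0 \<in> supp c" using i0 by (auto simp: supp_def)
  ultimately have "card (supp e) < card (supp c)"
    by (metis card_mono card_Diff1_less finite_Diff order_le_less_trans)
  then have "supp e = {}" using minc[OF \<open>sol e\<close>] by auto
  then have bF: "b i \<in> F" if "i < d" for i
    using that bc[OF that] fixed by (auto simp: supp_def e_def)
  define Ks where "Ks = map b [0..<d]"
  have "combine Ks Us = (\<Oplus>i\<in>{..<d}. Us ! i \<otimes> b i)"
  proof -
    have "combine Ks Us = (\<Oplus>i\<in>{..<d}. Ks ! i \<otimes> Us ! i)"
    proof -
      have "set Ks \<subseteq> carrier R" "length Ks = length Us" using bc Us(3) by (auto simp: Ks_def)
      then show ?thesis using combine_eq_finsum[of Ks Us] Us(1,3) by simp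
    qed
    also have "\<dots> = (\<Oplus>i\<in>{..<d}. Us ! i \<otimes> b i)"
      using bc Uc by (intro finsum_cong') (auto simp: Ks_def m_comm)
    finally show ?thesis .
  qed
  also have "\<dots> = \<zero>" using bsum[of 0] j by simp
  finally have "set (take (length Us) Ks) \<subseteq> {\<zero>}"
  proof -
    assume "combine Ks Us = \<zero>"
    moreover have "set Ks \<subseteq> F" using bF by (auto simp: Ks_def)
    ultimately show ?thesis using independent_imp_trivial_combine[OF F Us(2)] by blast
  qed
  then have "b i0 = \<zero>" using i0 Us(3) by (auto simp: Ks_def image_subset_iff)
  then show False using v(2) by (simp add: b_def)
qed

lemma sp_sp: "(s ^^ a) ((s ^^ b) x) = (s ^^ (a + b)) x" by (simp add: funpow_add)

lemma sp_shift: "a < b \<Longrightarrow> x \<in> carrier R \<Longrightarrow> (s ^^ a) x = (s ^^ b) x \<Longrightarrow> (s ^^ (b - a)) x = x"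
  using sp_inj[of "(s ^^ (b - a)) x" x a] by (simp add: sp_sp)

text \<open>Dedekind's bound first shows that \<open>s\<close> has some finite order on E, since
  otherwise infinitely many powers would be distinct. Applied to that order, it gives one inequality
  with the degree, and Artin's bound gives the other.\<close>

lemma degree_eq_order:
  assumes E: "subfield E R" and d: "dimension d F E"
  shows "x \<in> E \<Longrightarrow> (s ^^ d) x = x" "\<And>k. 0 < k \<Longrightarrow> k < d \<Longrightarrow> \<exists>x\<in>E. (s ^^ k) x \<noteq> x" "d > 0"
proof -
  have Ec: "x \<in> carrier R" if "x \<in> E" for x using subfieldE(3)[OF E] that by blast
  note shift = sp_shift[OF _ Ec]
  have ex: "\<exists>k>0. \<forall>x\<in>E. (s ^^ k) x = x"
  proof (rule ccontr)
    assume no: "\<not> (\<exists>k>0. \<forall>x\<in>E. (s ^^ k) x = x)"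
    have "Suc d \<le> d"
    proof (rule dedekind_bound[OF E d])
      fix k l :: nat assume "k \<noteq> l"
      then show "\<exists>x\<in>E. (s ^^ k) x \<noteq> (s ^^ l) x"
        using no shift[of k l] shift[of l k] by (metis nat_neq_iff zero_less_diff)
    qed
    then show False by simp
  qed
  define j where "j = (LEAST k. k > 0 \<and> (\<forall>x\<in>E. (s ^^ k) x = x))"
  have j: "j > 0" "\<forall>x\<in>E. (s ^^ j) x = x" using LeastI_ex[OF ex] by (auto simp: j_def)
  have least: "\<exists>x\<in>E. (s ^^ k) x \<noteq> x" if "0 < k" "k < j" for k
    using not_less_Least[of k "\<lambda>k. k > 0 \<and> (\<forall>x\<in>E. (s ^^ k) x = x)"] that by (auto simp: j_def)
  have "j \<le> d"
  proof (rule dedekind_bound[OF E d])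
    fix k l assume kl: "k < j" "l < j" "k \<noteq> l"
    then show "\<exists>x\<in>E. (s ^^ k) x \<noteq> (s ^^ l) x"
      using least[of "k - l"] least[of "l - k"] shift[of k l] shift[of l k]
      by (metis less_imp_diff_less nat_neq_iff zero_less_diff)
  qed
  moreover have "d \<le> j" using artin_bound[OF d j(1)] j(2) by blast
  ultimately have "j = d" by simp
  then show "x \<in> E \<Longrightarrow> (s ^^ d) x = x" "\<And>k. 0 < k \<Longrightarrow> k < d \<Longrightarrow> \<exists>x\<in>E. (s ^^ k) x \<noteq> x" "d > 0"
    using j least by auto
qed

lemma pow_distinct:
  assumes E: "subfield E R" and d: "dimension d F E" and kl: "k < d" "l < d" "k \<noteq> l"
  shows "\<exists>x\<in>E. (s ^^ k) x \<noteq> (s ^^ l) x"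
proof -
  have Ec: "x \<in> carrier R" if "x \<in> E" for x using subfieldE(3)[OF E] that by blast
  show ?thesis
  proof (cases "k < l")
    case True
    then obtain x where "x \<in> E" "(s ^^ (l - k)) x \<noteq> x" using degree_eq_order(2)[OF E d, of "l - k"] kl True less_imp_diff_less[of l d k] by auto
    then show ?thesis using sp_shift[OF True, of x] Ec by auto
  next
    case False
    then have "l < k" using kl by simp
    then obtain x where "x \<in> E" "(s ^^ (k - l)) x \<noteq> x" using degree_eq_order(2)[OF E d, of "k - l"] kl \<open>l < k\<close> less_imp_diff_less[of k d l] by auto
    then have "(s ^^ k) x \<noteq> (s ^^ l) x" using sp_shift[OF \<open>l < k\<close>, of x] Ec by metis
    then show ?thesis using \<open>x \<in> E\<close> by blast
  qed
qed

lemma sp_D: "x \<in> carrier R \<Longrightarrow> (s ^^ D) x = x"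
  using degree_eq_order(1)[OF carrier_is_subfield dim] .

lemma D_pos: "D > 0" using degree_eq_order(3)[OF carrier_is_subfield dim] .

definition Fx :: "nat \<Rightarrow> 'a set" where "Fx r = {x \<in> carrier R. (s ^^ r) x = x}"

lemma sp_mono_period: "x \<in> Fx r \<Longrightarrow> (s ^^ (k * r)) x = x"
proof (induction k)
  case (Suc k)
  then have "(s ^^ r) ((s ^^ (k * r)) x) = x" by (simp add: Fx_def)
  then show ?case by (simp add: sp_sp)
qed simp

lemma Fx_sp: "x \<in> Fx r \<Longrightarrow> (s ^^ k) x \<in> Fx r"
  by (auto simp: Fx_def sp_sp add.commute) (simp flip: sp_sp)

lemma Fx_inv: "x \<in> Fx r \<Longrightarrow> x \<noteq> \<zero> \<Longrightarrow> inv x \<in> Fx r"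
proof -
  assume x: "x \<in> Fx r" "x \<noteq> \<zero>"
  then have xU: "x \<in> Units R" and xc: "x \<in> carrier R" by (auto simp: Fx_def field_Units)
  have "(s ^^ r) (inv x) \<otimes> x = (s ^^ r) (inv x \<otimes> x)"
    using x xU xc by (simp add: sp_mult Fx_def del: Units_l_inv)
  also have "\<dots> = \<one>" using xU by (simp add: Units_l_inv)
  finally have "inv x = (s ^^ r) (inv x)" using xc xU by (intro comm_inv_char) (auto simp: m_comm)
  then show ?thesis using xU by (simp add: Fx_def)
qed

lemma Fx_subfield: "subfield (Fx r) R"
proof (rule subfieldI')
  have neg: "\<ominus> x \<in> Fx r" if "x \<in> Fx r" for x
  proof -
    have x: "x \<in> carrier R" "(s ^^ r) x = x" using that by (auto simp: Fx_def)
    have "(s ^^ r) (\<ominus> x) \<oplus> x = (s ^^ r) (\<ominus> x \<oplus> x)" using x by (subst sp_add) auto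
    also have "\<dots> = \<zero>" using x by (simp add: l_neg)
    finally have "(s ^^ r) (\<ominus> x) = \<ominus> x" using x minus_equality[of "(s ^^ r) (\<ominus> x)" x] by simp
    then show ?thesis using x by (simp add: Fx_def)
  qed
  show "subring (Fx r) R"
    by (rule subringI) (use neg in \<open>auto simp: Fx_def sp_add sp_mult\<close>)
  show "\<And>k. k \<in> Fx r - {\<zero>} \<Longrightarrow> inv k \<in> Fx r" using Fx_inv by blast
qed

lemma F_Fx: "F \<subseteq> Fx r" using sp_F F_carrier by (auto simp: Fx_def)

lemma finsum_shift:
  assumes "\<And>h. f h \<in> carrier R"
  shows "f 0 \<oplus> (\<Oplus>h\<in>{..<q}. f (Suc h)) = (\<Oplus>h\<in>{..<q}. f h) \<oplus> f q"
proof (induction q)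
  case (Suc q)
  have c: "(\<Oplus>h\<in>{..<q}. f (Suc h)) \<in> carrier R" "(\<Oplus>h\<in>{..<q}. f h) \<in> carrier R"
    using assms by (auto intro!: finsum_closed)
  have "f 0 \<oplus> (\<Oplus>h\<in>{..<Suc q}. f (Suc h)) = (f 0 \<oplus> (\<Oplus>h\<in>{..<q}. f (Suc h))) \<oplus> f (Suc q)"
    using assms c by (simp add: lessThan_Suc finsum_insert Pi_def a_ac)
  also have "\<dots> = ((\<Oplus>h\<in>{..<q}. f h) \<oplus> f q) \<oplus> f (Suc q)" by (simp only: Suc)
  also have "(\<Oplus>h\<in>{..<q}. f h) \<oplus> f q = (\<Oplus>h\<in>{..<Suc q}. f h)"
    using assms c by (simp add: lessThan_Suc finsum_insert Pi_def a_ac)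
  finally show ?case .
qed (use assms in simp)

lemma Fx_finite_dim: "\<exists>d. dimension d F (Fx r)"
proof -
  have "subgroup (Fx r) (add_monoid R)"
    using subfieldE(1)[OF Fx_subfield] by (simp add: subring_def)
  moreover have "subalgebra_axioms F (Fx r) R"
    by (rule subalgebra_axioms.intro) (use F_Fx F_carrier sp_F in \<open>auto simp: Fx_def sp_mult\<close>)
  ultimately have "subalgebra F (Fx r) R" by (simp add: subalgebra_def)
  moreover have "finite_dimension F (carrier R)" using dim by (rule finite_dimensionI)
  ultimately have "finite_dimension F (Fx r)"
    using subalbegra_incl_imp_finite_dimension[OF F] by (auto simp: Fx_def)
  then show ?thesis by (auto simp: finite_dimension_def)
qed

text \<open>If \<open>Fx r\<close> had smaller degree \<open>d\<close>, then \<open>s ^^ d\<close> would fix all traces to \<open>Fx r\<close>, a linear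
  relation between distinct powers of \<open>s\<close>.\<close>

lemma Fx_dim:
  assumes r: "r dvd D" "r > 0"
  shows "dimension r F (Fx r)"
proof -
  obtain d where d: "dimension d F (Fx r)" using Fx_finite_dim by blast
  note deg = degree_eq_order[OF Fx_subfield d]
  obtain q where q: "D = q * r" using r by (auto elim!: dvdE simp: mult.commute)
  have "d \<le> r" using deg(2)[of r] r by (force simp: Fx_def)
  moreover have "\<not> d < r"
  proof
    assume dr: "d < r"
    define H where "H e = (\<lambda>h. h * r + e) ` {..<q}" for e
    have lt: "h * r + e < D" if "h < q" "e < r" for h e
    proof -
      have "h * r + e < Suc h * r" using that by simp
      also have "\<dots> \<le> q * r" using that by (intro mult_right_mono) auto
      finally show ?thesis by (simp add: q)
    qed
    have mod: "(h * r + e) mod r = e" if "e < r" for h e using that by simp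
    have Hmod: "k mod r = e" "k < D" if "k \<in> H e" "e < r" for k e using that mod lt by (auto simp: H_def)
    have disj: "H 0 \<inter> H d = {}" using Hmod(1)[of _ 0] Hmod(1)[of _ d] dr r deg(3) by fastforce
    have inj: "inj_on (\<lambda>h. h * r + e) {..<q}" for e using r by (auto simp: inj_on_def)
    have fin: "finite (H e)" for e by (simp add: H_def)
    define c where "c k = (if k \<in> H 0 then \<one> else \<ominus> \<one>)" for k
    have cc: "c k \<in> carrier R" for k by (simp add: c_def)
    have "\<forall>k\<in>H 0 \<union> H d. c k = \<zero>"
    proof (rule dedekind_independence[where M = "carrier R" and mul = "(\<otimes>)" and u = \<one> and \<chi> = "\<lambda>k. s ^^ k"])
      fix k l assume "k \<in> H 0 \<union> H d" "l \<in> H 0 \<union> H d" "k \<noteq> l"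
      then show "\<exists>x\<in>carrier R. (s ^^ k) x \<noteq> (s ^^ l) x"
        using Hmod(2) r dr by (intro pow_distinct[OF carrier_is_subfield dim]) auto
    next
      fix x assume x: "x \<in> carrier R"
      define T where "T = (\<Oplus>h\<in>{..<q}. (s ^^ (h * r)) x)"
      have T: "T \<in> carrier R" unfolding T_def using x by (intro finsum_closed) auto
      have "(s ^^ r) T = (\<Oplus>h\<in>{..<q}. (s ^^ (Suc h * r)) x)"
        unfolding T_def using x by (subst sp_finsum) (auto simp: sp_sp)
      then have "x \<oplus> (s ^^ r) T = T \<oplus> (s ^^ (q * r)) x"
        using finsum_shift[of "\<lambda>h. (s ^^ (h * r)) x" q] x by (simp add: T_def)
      then have "x \<oplus> (s ^^ r) T = x \<oplus> T" using sp_D[OF x] T x by (simp add: q a_comm)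
      then have "T \<in> Fx r" using x T by (simp add: Fx_def)
      then have Td: "(s ^^ d) T = T" by (rule deg(1))
      have "(\<Oplus>k\<in>H 0 \<union> H d. c k \<otimes> (s ^^ k) x) = (\<Oplus>k\<in>H 0. c k \<otimes> (s ^^ k) x) \<oplus> (\<Oplus>k\<in>H d. c k \<otimes> (s ^^ k) x)"
        using disj fin cc x by (intro finsum_Un_disjoint) auto
      also have "(\<Oplus>k\<in>H 0. c k \<otimes> (s ^^ k) x) = (\<Oplus>k\<in>H 0. (s ^^ k) x)"
        using x by (intro finsum_cong') (auto simp: c_def)
      also have "\<dots> = T" unfolding H_def T_def using inj[of 0] x by (subst finsum_reindex) auto
      also have "(\<Oplus>k\<in>H d. c k \<otimes> (s ^^ k) x) = (\<Oplus>k\<in>H d. (\<ominus> \<one>) \<otimes> (s ^^ k) x)"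
        using x disj by (intro finsum_cong') (auto simp: c_def)
      also have "\<dots> = (\<ominus> \<one>) \<otimes> (\<Oplus>k\<in>H d. (s ^^ k) x)"
        using x fin by (intro finsum_rdistr[symmetric]) auto
      also have "(\<Oplus>k\<in>H d. (s ^^ k) x) = (\<Oplus>h\<in>{..<q}. (s ^^ d) ((s ^^ (h * r)) x))"
        unfolding H_def using inj[of d] x by (subst finsum_reindex) (auto simp: sp_sp add.commute)
      also have "\<dots> = (s ^^ d) T" unfolding T_def using x by (subst sp_finsum) auto
      finally show "(\<Oplus>k\<in>H 0 \<union> H d. c k \<otimes> (s ^^ k) x) = \<zero>" using Td T by (simp add: l_minus r_neg)
    qed (use fin cc in \<open>auto simp: sp_mult\<close>)
    moreover have "0 \<in> H 0" using D_pos q by (force simp: H_def)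
    ultimately have "c 0 = \<zero>" by blast
    then show False using \<open>0 \<in> H 0\<close> by (simp add: c_def)
  qed
  ultimately show ?thesis using d by simp
qed

lemma Fx_unique:
  assumes r: "r dvd D" "r > 0" and E: "subfield E R" "dimension r F E"
  shows "E = Fx r"
proof -
  have sub: "E \<subseteq> Fx r" using degree_eq_order(1)[OF E] subfieldE(3)[OF E(1)] by (auto simp: Fx_def)
  obtain Us where Us: "set Us \<subseteq> carrier R" "independent F Us" "length Us = r" "Span F Us = E"
    using exists_base[OF F E(2)] by blast
  have "set Us \<subseteq> Fx r" using Span_base_incl[OF F Us(1)] Us(4) sub by blast
  then have "Span F Us = Fx r" using independent_length_eq_dimension[OF F Fx_dim[OF r] Us(2)] Us(3) by blast
  then show ?thesis using Us(4) by simp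
qed

text \<open>The classical resolvent: with the partial products P k = a s^r(a) ... of the norm,
  Dedekind yields an x in \<open>Fx t\<close> for which b, the sum of the P k s^(k r)(x), is
  nonzero. Applying s^r and multiplying by \<open>a\<close> replaces each summand by the next
  one.\<close>

lemma hilbert_90:
  assumes r: "t = q * r" "t dvd D" "t > 0" and a: "a \<in> Fx t"
    and N: "(\<Otimes>k\<in>{..<q}. (s ^^ (k * r)) a) = \<one>"
  shows "\<exists>b\<in>Fx t. b \<noteq> \<zero> \<and> a \<otimes> (s ^^ r) b = b"
proof -
  have ac: "a \<in> carrier R" using a by (simp add: Fx_def)
  define P where "P k = (\<Otimes>l\<in>{..<k}. (s ^^ (l * r)) a)" for k
  have Pc: "P k \<in> carrier R" for k unfolding P_def using ac by (intro finprod_closed) auto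
  have P_Suc: "P (Suc k) = P k \<otimes> (s ^^ (k * r)) a" for k
    unfolding P_def using ac by (simp add: lessThan_Suc finprod_insert Pi_def m_comm finprod_closed)
  have aP: "a \<otimes> (s ^^ r) (P k) = P (Suc k)" for k
  proof (induction k)
    case (Suc k)
    have "a \<otimes> (s ^^ r) (P (Suc k)) = (a \<otimes> (s ^^ r) (P k)) \<otimes> (s ^^ (Suc k * r)) a"
      using ac Pc by (simp add: P_Suc[of k] sp_mult sp_sp m_assoc)
    also have "\<dots> = P (Suc (Suc k))" by (simp only: Suc P_Suc[of "Suc k"])
    finally show ?case .
  qed (use ac in \<open>simp add: P_Suc, simp add: P_def\<close>)
  have q: "q > 0" "r > 0" using r by (auto intro!: Nat.gr0I)
  have P0: "P 0 = \<one>" by (simp add: P_def)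
  have Pq: "P q = \<one>" using N by (simp add: P_def)
  have "\<exists>x\<in>Fx t. (\<Oplus>k\<in>{..<q}. P k \<otimes> (s ^^ (k * r)) x) \<noteq> \<zero>"
  proof (rule ccontr)
    assume "\<not> ?thesis"
    then have zero: "(\<Oplus>k\<in>{..<q}. P k \<otimes> (s ^^ (k * r)) x) = \<zero>" if "x \<in> Fx t" for x using that by blast
    have "\<forall>k\<in>{..<q}. P k = \<zero>"
    proof (rule dedekind_independence[where M = "Fx t" and mul = "(\<otimes>)" and u = \<one> and \<chi> = "\<lambda>k. s ^^ (k * r)"])
      fix k l assume kl: "k \<in> {..<q}" "l \<in> {..<q}" "k \<noteq> l"
      show "\<exists>x\<in>Fx t. (s ^^ (k * r)) x \<noteq> (s ^^ (l * r)) x"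
        using kl q r by (intro pow_distinct[OF Fx_subfield Fx_dim[OF r(2,3)]]) auto
    qed (use zero Pc in \<open>auto simp: Fx_def sp_mult\<close>)
    then show False using q P0 by auto
  qed
  then obtain x where x: "x \<in> Fx t" "(\<Oplus>k\<in>{..<q}. P k \<otimes> (s ^^ (k * r)) x) \<noteq> \<zero>" by blast
  have xc: "x \<in> carrier R" "(s ^^ t) x = x" using x by (auto simp: Fx_def)
  define f where "f k = P k \<otimes> (s ^^ (k * r)) x" for k
  have fc: "f k \<in> carrier R" for k using Pc xc by (simp add: f_def)
  define b where "b = (\<Oplus>k\<in>{..<q}. f k)"
  have bc: "b \<in> carrier R" unfolding b_def using fc by (intro finsum_closed) auto
  have Pt: "(s ^^ t) (P k) = P k" for k
  proof (induction k)
    case (Suc k)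
    have "(s ^^ t) ((s ^^ (k * r)) a) = (s ^^ (k * r)) a" using Fx_sp[OF a, of "k * r"] by (simp add: Fx_def)
    then show ?case using Suc ac Pc by (simp add: P_Suc sp_mult)
  qed (simp add: P_def)
  have "(s ^^ t) (f k) = f k" for k
  proof -
    have "(s ^^ t) ((s ^^ (k * r)) x) = (s ^^ (k * r)) x" using Fx_sp[OF x(1), of "k * r"] by (simp add: Fx_def)
    then show ?thesis using Pt Pc xc by (simp add: f_def sp_mult)
  qed
  then have "(s ^^ t) b = b" unfolding b_def using fc by (subst sp_finsum) auto
  then have bF: "b \<in> Fx t" using bc by (simp add: Fx_def)
  have "a \<otimes> (s ^^ r) b = (\<Oplus>k\<in>{..<q}. a \<otimes> (s ^^ r) (f k))"
    unfolding b_def using fc ac by (subst sp_finsum) (auto simp: finsum_rdistr)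
  also have "\<dots> = (\<Oplus>k\<in>{..<q}. f (Suc k))"
  proof (rule finsum_cong')
    fix k assume "k \<in> {..<q}"
    show "a \<otimes> (s ^^ r) (f k) = f (Suc k)"
      using ac Pc xc aP[of k] by (simp add: f_def sp_mult sp_sp flip: m_assoc)
  qed (use fc in auto)
  finally have e: "a \<otimes> (s ^^ r) b = (\<Oplus>k\<in>{..<q}. f (Suc k))" .
  \<comment> \<open>The shifted sum closes up because P q is the norm, which is 1, and s^t fixes
    x.\<close>
  have "f q = f 0" using xc by (simp add: f_def Pq P0 r(1)[symmetric])
  then have "f 0 \<oplus> (a \<otimes> (s ^^ r) b) = f 0 \<oplus> b"
    using finsum_shift[of f q] fc bc by (simp add: e b_def[symmetric] a_comm)
  then have "a \<otimes> (s ^^ r) b = b" using fc bc ac by simp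
  then show ?thesis using bF x(2) by (auto simp: b_def f_def)
qed

end

text \<open>Instead of counting roots of a polynomial: a further p-th root of unity would give p + 1
  distinct characters k \<mapsto> b^k, all of period p. A linear relation between them is only p
  equations, so a nontrivial one exists, against Dedekind.\<close>

lemma (in field) roots_of_unity:
  fixes p :: nat
  assumes p: "p > 0" and x: "x \<in> carrier R" "x [^] p = \<one>" "\<And>j. 0 < j \<Longrightarrow> j < p \<Longrightarrow> x [^] j \<noteq> \<one>"
    and a: "a \<in> carrier R" "a [^] p = \<one>"
  shows "\<exists>k::nat. a = x [^] k"
proof (rule ccontr)
  assume na: "\<not> ?thesis"
  have pw: "b [^] (k::nat) = b [^] (k mod p)" if "b \<in> carrier R" "b [^] p = \<one>" for b k
  proof -
    have "b [^] k = b [^] (p * (k div p) + k mod p)" by simp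
    also have "\<dots> = (b [^] p) [^] (k div p) \<otimes> b [^] (k mod p)" using that(1)
      by (simp only: nat_pow_mult nat_pow_pow nat_pow_closed)
    finally show ?thesis using that by simp
  qed
  have "x \<noteq> \<zero>" using x(2) p by (metis nat_pow_zero neq0_conv zero_not_one)
  then have xU: "x \<in> Units R" using x by (simp add: field_Units)
  have inj: "inj_on (\<lambda>k. x [^] k) {..<p}"
  proof (rule linorder_inj_onI)
    fix k l assume kl: "k < l" "l \<in> {..<p}"
    show "x [^] k \<noteq> x [^] l"
    proof
      assume "x [^] k = x [^] l"
      also have "x [^] l = x [^] k \<otimes> x [^] (l - k)" using kl x by (simp add: nat_pow_mult)
      finally have "x [^] k \<otimes> \<one> = x [^] k \<otimes> x [^] (l - k)" using x by simp
      then have "\<one> = x [^] (l - k)" using x xU Units_l_cancel[of "x [^] k" \<one> "x [^] (l - k)"]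
        by (simp add: Units_pow_closed)
      then show False using x(3)[of "l - k"] kl less_imp_diff_less[of l p k] by simp
    qed
  qed auto
  define H where "H = insert a ((\<lambda>k. x [^] k) ` {..<p})"
  have H: "finite H" "card H = Suc p"
    using na inj by (auto simp: H_def card_image card_insert_if)
  have Hc: "b \<in> carrier R" "b [^] p = \<one>" if "b \<in> H" for b
  proof -
    show "b \<in> carrier R" using that a x by (auto simp: H_def)
    show "b [^] p = \<one>"
    proof (cases "b = a")
      case False
      then obtain k :: nat where "b = x [^] k" using \<open>b \<in> H\<close> by (auto simp: H_def)
      then have "b [^] p = (x [^] p) [^] k" using x(1) by (simp add: nat_pow_pow mult.commute)
      then show ?thesis using x by simp
    qed (use a in simp)
  qed
  obtain c where c: "\<forall>b\<in>H. c b \<in> carrier R" "\<exists>b\<in>H. c b \<noteq> \<zero>"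
    "\<forall>k\<in>{..<p}. (\<Oplus>b\<in>H. b [^] k \<otimes> c b) = \<zero>"
    using underdetermined_system[of "{..<p}" H "\<lambda>k b. b [^] k"] H Hc by auto
  have "\<forall>b\<in>H. c b = \<zero>"
  proof (rule dedekind_independence[where M = "UNIV :: nat set" and mul = "(+)" and u = 0 and \<chi> = "\<lambda>b k. b [^] k"])
    fix k :: nat
    have "(\<Oplus>b\<in>H. c b \<otimes> b [^] k) = (\<Oplus>b\<in>H. b [^] (k mod p) \<otimes> c b)"
      using Hc c by (intro finsum_cong') (auto simp: pw[of _ k] m_comm)
    then show "(\<Oplus>b\<in>H. c b \<otimes> b [^] k) = \<zero>" using c(3) p by simp
  next
    fix b b' assume b: "b \<in> H" "b' \<in> H" "b \<noteq> b'"
    then show "\<exists>k\<in>(UNIV::nat set). b [^] k \<noteq> b' [^] k" using Hc by (intro bexI[of _ "1::nat"]) auto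
  qed (use H Hc c in \<open>auto simp: nat_pow_mult\<close>)
  then show False using c(2) by blast
qed

section \<open>Cyclic Kummer extensions\<close>

context p_op_group
begin

lemma lin_indep_bij:
  assumes B: "lin_indep B" "finite B"
  shows "bij_betw (\<lambda>a. finprod A (\<lambda>b. b [^] (a b :: int)) B) (B \<rightarrow>\<^sub>E {0..int p - 1}) (lin_span B)"
proof (rule bij_betwI')
  have Bc: "b \<in> carrier A" "b \<noteq> \<one>" if "b \<in> B" for b using B that by (auto simp: lin_indep_def)
  fix f g assume f: "f \<in> B \<rightarrow>\<^sub>E {0..int p - 1}" and g: "g \<in> B \<rightarrow>\<^sub>E {0..int p - 1}"
  show "(finprod A (\<lambda>b. b [^] (f b)) B = finprod A (\<lambda>b. b [^] (g b)) B) = (f = g)"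
  proof
    assume eq: "finprod A (\<lambda>b. b [^] (f b)) B = finprod A (\<lambda>b. b [^] (g b)) B"
    have "finprod A (\<lambda>b. b [^] (f b - g b)) B \<otimes> finprod A (\<lambda>b. b [^] (g b)) B = finprod A (\<lambda>b. b [^] (f b - g b) \<otimes> b [^] (g b)) B"
      using Bc by (intro finprod_multf[symmetric]) auto
    also have "\<dots> = finprod A (\<lambda>b. b [^] (f b)) B"
      using Bc by (intro finprod_cong') (auto simp flip: int_pow_mult)
    finally have "finprod A (\<lambda>b. b [^] (f b - g b)) B \<otimes> finprod A (\<lambda>b. b [^] (g b)) B = \<one> \<otimes> finprod A (\<lambda>b. b [^] (g b)) B"
      using eq Bc by (simp add: finprod_closed)
    then have one: "finprod A (\<lambda>b. b [^] (f b - g b)) B = \<one>"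
      using Bc by (subst (asm) r_cancel) (auto intro!: finprod_closed)
    have "f b = g b" if b: "b \<in> B" for b
    proof -
      have "b [^] (f b - g b) = \<one>"
      proof (rule indep_famD[OF _ B(2) subset_refl _ one b])
        show "indep_fam B line" using B by (simp add: lin_indep_def)
        fix t assume "t \<in> B"
        then show "t [^] (f t - g t) \<in> line t" using int_pow_nat[OF Bc(1)] by (auto simp: line_def)
      qed
      then have "b [^] nat ((f b - g b) mod int p) = \<one>" using int_pow_nat[OF Bc(1)[OF b]] by simp
      then have "p dvd nat ((f b - g b) mod int p)" using pow_one_dvd Bc b by blast
      then have "int p dvd (f b - g b) mod int p"
        using prime_gt_0_nat[OF p_prime] by (metis int_dvd_int_iff int_nat_eq of_nat_0_less_iff pos_mod_sign)
      then have "int p dvd f b - g b" by (simp add: dvd_mod_iff)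
      moreover have "\<bar>f b - g b\<bar> < int p" using f g b by (auto simp: PiE_iff) force+
      ultimately show ?thesis by (metis dvd_imp_le_int eq_iff_diff_eq_0 abs_of_nat not_less)
    qed
    then show "f = g" using f g by (auto intro: PiE_ext)
  qed simp
next
  have Bc: "b \<in> carrier A" if "b \<in> B" for b using B that by (auto simp: lin_indep_def)
  fix f assume f: "f \<in> B \<rightarrow>\<^sub>E {0..int p - 1}"
  show "finprod A (\<lambda>b. b [^] (f b)) B \<in> lin_span B"
    unfolding lin_span_def using B int_pow_nat[OF Bc] by (intro fsumI) (auto simp: line_def)
next
  have Bc: "b \<in> carrier A" if "b \<in> B" for b using B that by (auto simp: lin_indep_def)
  fix v assume "v \<in> lin_span B"
  then obtain T f where T: "finite T" "T \<subseteq> B" "\<forall>t\<in>T. f t \<in> line t" "v = finprod A f T"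
    unfolding lin_span_def by (rule fsumE)
  have "\<forall>t\<in>T. \<exists>c::nat. f t = t [^] c" using T(3) by (auto simp: line_def)
  then obtain c :: "'a \<Rightarrow> nat" where c: "\<And>t. t \<in> T \<Longrightarrow> f t = t [^] c t" by metis
  define a where "a = (\<lambda>b\<in>B. if b \<in> T then int (c b) mod int p else 0)"
  have p: "int p > 0" using prime_gt_0_nat[OF p_prime] by simp
  have "a \<in> B \<rightarrow>\<^sub>E {0..int p - 1}" using p by (auto simp: a_def)
  moreover have "v = finprod A (\<lambda>b. b [^] (a b)) B"
  proof -
    have fc: "f t \<in> carrier A" if "t \<in> T" for t using c[OF that] T(2) that Bc by auto
    have "v = finprod A (\<lambda>t. if t \<in> T then f t else \<one>) B"
      unfolding T(4) using B T(2) fc by (intro finprod_pad) auto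
    also have "\<dots> = finprod A (\<lambda>b. b [^] (a b)) B"
    proof (rule finprod_cong')
      fix b assume b: "b \<in> B"
      show "(if b \<in> T then f b else \<one>) = b [^] (a b)"
      proof (cases "b \<in> T")
        case True
        have "b [^] (a b) = b [^] int (c b)"
          using int_pow_nat[OF Bc[OF b], of "a b"] int_pow_nat[OF Bc[OF b], of "int (c b)"] True b
          by (simp add: a_def)
        then show ?thesis using True c by (simp add: int_pow_int)
      qed (use b in \<open>simp add: a_def\<close>)
    qed (use Bc in auto)
    finally show ?thesis .
  qed
  ultimately show "\<exists>a\<in>B \<rightarrow>\<^sub>E {0..int p - 1}. v = finprod A (\<lambda>b. b [^] (a b)) B" by blast
qed

lemma xp_1: "v \<in> carrier A \<Longrightarrow> s v = v \<otimes> xp 1 v"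
proof -
  assume v: "v \<in> carrier A"
  have "xp 1 v = s v \<otimes> inv v" using v by (simp add: xp_def xd_def act_pCons int_pow_neg m_comm)
  moreover have "v \<otimes> (s v \<otimes> inv v) = s v" using v by (simp add: m_comm[of "s v"] flip: m_assoc)
  ultimately show ?thesis by simp
qed

text \<open>The basis is v, x v, ..., x^l v, built up from the socle: x^j kills the j vectors
  already chosen but not the next one, x^(l-j) v, so independence is preserved at each step.\<close>

lemma cyc_basis:
  assumes v: "v \<in> carrier A" and l: "xp (Suc l) v = \<one>" "xp l v \<noteq> \<one>"
  shows "\<exists>B\<subseteq>cyc v. finite B \<and> card B = Suc l \<and> lin_indep B \<and> lin_span B = cyc v"
proof -
  define B where "B j = (\<lambda>i. xp (l - i) v) ` {..<j}" for j
  have main: "lin_indep (B j) \<and> card (B j) = j" if "j \<le> Suc l" for j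
    using that
  proof (induction j)
    case 0
    show ?case by (simp add: B_def lin_indep_def indep_fam_def)
  next
    case (Suc j)
    define K where "K = {w \<in> carrier A. xp j w = \<one>}"
    have "subgroup K A" by standard (auto simp: K_def xp_mult xp_inv)
    moreover have "B j \<subseteq> K"
    proof
      fix w assume "w \<in> B j"
      then obtain i where i: "i < j" "w = xp (l - i) v" by (auto simp: B_def)
      have "xp j w = xp (j + (l - i)) v" using v by (simp add: i xp_add)
      also have "\<dots> = \<one>" using v i Suc.prems by (intro xp_le[OF v l(1)]) auto
      finally show "w \<in> K" using v i by (simp add: K_def)
    qed
    ultimately have "lin_span (B j) \<subseteq> K" by (rule lin_span_least)
    moreover have "xp (l - j) v \<notin> K" using v l Suc.prems by (simp add: K_def flip: xp_add)
    ultimately have nin: "xp (l - j) v \<notin> lin_span (B j)" by blast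
    have B: "B (Suc j) = insert (xp (l - j) v) (B j)" by (simp add: B_def lessThan_Suc)
    have "B j \<subseteq> carrier A" using v by (auto simp: B_def)
    then have "xp (l - j) v \<notin> B j" using nin lin_span_incl by blast
    moreover have "finite (B j)" by (simp add: B_def)
    ultimately show ?case using lin_indep_insert[OF _ _ nin] Suc v by (simp add: B)
  qed
  define C where "C = B (Suc l)"
  have CB: "w \<in> C \<longleftrightarrow> (\<exists>k\<le>l. w = xp k v)" for w
  proof
    assume "w \<in> C"
    then obtain i where "w = xp (l - i) v" by (auto simp: C_def B_def)
    then show "\<exists>k\<le>l. w = xp k v" by (intro exI[of _ "l - i"]) simp
  next
    assume "\<exists>k\<le>l. w = xp k v"
    then obtain k where "k \<le> l" "w = xp k v" by blast
    then show "w \<in> C" unfolding C_def B_def by (intro image_eqI[of _ _ "l - k"]) auto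
  qed
  have C: "lin_indep C" "card C = Suc l" "finite C" using main[of "Suc l"] by (auto simp: C_def B_def)
  have Cc: "C \<subseteq> carrier A" using C by (simp add: lin_indep_def)
  have Cv: "C \<subseteq> cyc v" unfolding subset_iff CB using cyc_I by (auto simp: xp_def)
  have sp: "subgroup (lin_span C) A" by (rule lin_span_subgroup[OF Cc])
  have x1: "xp 1 w \<in> lin_span C" if w: "w \<in> lin_span C" for w
  proof -
    define K where "K = {w \<in> carrier A. xp 1 w \<in> lin_span C}"
    have "subgroup K A"
      by standard (auto simp: K_def xp_mult xp_inv intro: subgroup.m_closed[OF sp]
          subgroup.m_inv_closed[OF sp] subgroup.one_closed[OF sp])
    moreover have "C \<subseteq> K"
    proof
      fix w assume "w \<in> C"
      then obtain k where k: "k \<le> l" "w = xp k v" using CB by blast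
      have e: "xp 1 w = xp (Suc k) v" using v k by (simp flip: xp_add)
      have "xp (Suc k) v \<in> lin_span C"
      proof (cases "k = l")
        case True
        then show ?thesis using l subgroup.one_closed[OF sp] by simp
      next
        case False
        then have "Suc k \<le> l" using k by simp
        then have "xp (Suc k) v \<in> C" unfolding CB by blast
        then show ?thesis using lin_span_incl[OF Cc] by blast
      qed
      then show "w \<in> K" using e v k by (simp add: K_def)
    qed
    ultimately show ?thesis using lin_span_least w by (auto simp: K_def)
  qed
  have "cyc v \<subseteq> lin_span C"
  proof
    fix u assume "u \<in> cyc v"
    then obtain f where f: "u = act f v" by (auto simp: cyc_def)
    have "v \<in> C" unfolding CB using v by (intro exI[of _ 0]) simp
    then have "v \<in> lin_span C" using lin_span_incl[OF Cc] by blast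
    moreover have "s w \<in> lin_span C" if "w \<in> lin_span C" for w
      using xp_1[OF subgroup.mem_carrier[OF sp that]] x1[OF that] that subgroup.m_closed[OF sp] by simp
    ultimately show "u \<in> lin_span C" unfolding f by (intro act_subgroup[OF sp])
  qed
  moreover have "lin_span C \<subseteq> cyc v" using cyc_subgroup[OF v] Cv by (rule lin_span_least)
  ultimately show ?thesis using C Cv by blast
qed

end

lemma (in op_group) act_sum:
  assumes "a \<in> carrier A" "finite T"
  shows "act (\<Sum>t\<in>T. f t) a = finprod A (\<lambda>t. act (f t) a) T"
  using assms(2)
proof (induction T rule: finite_induct)
  case (insert t T)
  then show ?case using assms(1) by (simp add: act_add)
qed simp

locale kummer =
  fixes K :: "('a, 'b) ring_scheme" (structure) and F :: "'a set" and p n :: nat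
    and \<sigma> :: "'a \<Rightarrow> 'a" and \<xi> :: 'a
  assumes p: "Factorial_Ring.prime p" and n: "n \<ge> 1"
    and gal: "finite_galois K F" and dimK: "ring.dimension K (p ^ n) F (carrier K)"
    and sG: "\<sigma> \<in> carrier (gal_group K F)" and gen: "generate (gal_group K F) {\<sigma>} = carrier (gal_group K F)"
    and xiF: "\<xi> \<in> F" and xi: "primitive_root_of_unity K p \<xi>"
begin

abbreviation KU :: "'a monoid" where "KU \<equiv> Multiplicative_Group.mult_of K"

abbreviation G :: "('a \<Rightarrow> 'a) monoid" where "G \<equiv> gal_group K F"

section \<open>The Galois group as the set of powers of \<sigma>\<close>

lemma K: "field K" and F: "subfield F K" using gal by (auto simp: finite_galois_def)

sublocale field K by (rule K)

lemma G_iff: "\<tau> \<in> carrier (gal_group K E) \<longleftrightarrow> \<tau> \<in> Bij (carrier K) \<and> \<tau> \<in> ring_hom K K \<and> (\<forall>x\<in>E. \<tau> x = x)"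
  by (auto simp: gal_group_def)

lemma G_mult: "\<tau> \<in> carrier (gal_group K E) \<Longrightarrow> \<upsilon> \<in> carrier (gal_group K E) \<Longrightarrow>
    \<tau> \<otimes>\<^bsub>gal_group K E\<^esub> \<upsilon> = compose (carrier K) \<tau> \<upsilon>"
  by (simp add: gal_group_def BijGroup_def)

lemma G_one: "\<one>\<^bsub>gal_group K E\<^esub> = (\<lambda>x\<in>carrier K. x)"
  by (simp add: gal_group_def BijGroup_def)

lemma G_group: assumes "E \<subseteq> carrier K" shows "group (gal_group K E)"
proof -
  let ?B = "BijGroup (carrier K)" and ?S = "{\<tau> \<in> Bij (carrier K) \<inter> ring_hom K K. \<forall>x\<in>E. \<tau> x = x}"
  have sub: "subgroup ?S ?B"
  proof (rule group.subgroupI[OF group_BijGroup])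
    show "?S \<subseteq> carrier ?B" by (auto simp: BijGroup_def)
    have "(\<lambda>x\<in>carrier K. x) \<in> ?S" using assms id_Bij by (auto simp: ring_hom_def)
    then show "?S \<noteq> {}" by blast
    fix f assume f: "f \<in> ?S"
    then have fB: "f \<in> Bij (carrier K)" and fh: "f \<in> ring_hom K K" by auto
    have i: "inv_into (carrier K) f x \<in> carrier K" if "x \<in> carrier K" for x
      using Bij_inv_into_mem[OF fB that] .
    have inj: "inj_on f (carrier K)" using fB by (simp add: Bij_def bij_betw_def)
    have fixed: "inv_into (carrier K) f x = x" if "x \<in> carrier K" "f x = x" for x
      using inv_into_f_f[OF inj that(1)] that(2) by simp
    have "inv_into (carrier K) f \<one> = \<one>" by (rule fixed) (use ring_hom_one[OF fh] in auto)
    moreover have "inv_into (carrier K) f x = x" if "x \<in> E" for x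
      by (rule fixed) (use f that assms in auto)
    moreover have "inv_into (carrier K) f (x \<otimes> y) = inv_into (carrier K) f x \<otimes> inv_into (carrier K) f y"
      "inv_into (carrier K) f (x \<oplus> y) = inv_into (carrier K) f x \<oplus> inv_into (carrier K) f y"
      if "x \<in> carrier K" "y \<in> carrier K" for x y
      using that fB ring_hom_mult[OF fh] ring_hom_add[OF fh] by (auto intro!: Bij_inv_into_lemma)
    ultimately have "(\<lambda>x\<in>carrier K. inv_into (carrier K) f x) \<in> ?S"
      using i assms restrict_inv_into_Bij[OF fB] by (auto simp: ring_hom_def)
    then show "inv\<^bsub>?B\<^esub> f \<in> ?S" by (simp add: inv_BijGroup[OF fB])
    fix g assume g: "g \<in> ?S"
    then have gB: "g \<in> Bij (carrier K)" and gh: "g \<in> ring_hom K K" by auto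
    have "compose (carrier K) f g \<in> ?S"
      using f g assms compose_Bij[OF fB gB] ring_hom_closed[OF gh] ring_hom_mult[OF gh] ring_hom_add[OF gh]
        ring_hom_one[OF gh] ring_hom_closed[OF fh] ring_hom_mult[OF fh] ring_hom_add[OF fh] ring_hom_one[OF fh]
      by (auto simp: compose_def intro!: ring_hom_memI)
    then show "f \<otimes>\<^bsub>?B\<^esub> g \<in> ?S" using fB gB by (simp add: BijGroup_def)
  qed
  show ?thesis unfolding gal_group_def by (rule subgroup.subgroup_is_group[OF sub group_BijGroup])
qed

lemma F_car: "F \<subseteq> carrier K" using subfieldE(3)[OF F] .

lemma group_G: "group G" by (rule G_group[OF F_car])

lemma sigma_hom: "\<sigma> \<in> ring_hom K K" using sG G_iff by blast

lemma fixed_by_G: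
  assumes x: "x \<in> carrier K" "\<sigma> x = x" and t: "\<tau> \<in> carrier G"
  shows "\<tau> x = x"
proof -
  have "\<tau> \<in> generate G {\<sigma>}" using t gen by simp
  then show ?thesis
  proof (induction rule: generate.induct)
    case one
    then show ?case using x by (simp add: G_one)
  next
    case (incl h)
    then show ?case using x by simp
  next
    case (inv h)
    then have h: "h \<in> carrier G" "h = \<sigma>" using sG by auto
    have "inv\<^bsub>G\<^esub> \<sigma> \<otimes>\<^bsub>G\<^esub> \<sigma> = \<one>\<^bsub>G\<^esub>" "inv\<^bsub>G\<^esub> \<sigma> \<in> carrier G" using group.l_inv[OF group_G sG] group.inv_closed[OF group_G sG] by auto
    then have "compose (carrier K) (inv\<^bsub>G\<^esub> \<sigma>) \<sigma> x = x" using x sG by (simp add: G_one flip: G_mult)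
    then show ?case using x h by (simp add: compose_def)
  next
    case (eng h1 h2)
    then have "h1 \<in> carrier G" "h2 \<in> carrier G" using gen by auto
    then show ?case using eng x by (simp add: G_mult compose_def)
  qed
qed

sublocale cyc_field K F \<sigma> "p ^ n"
proof (intro cyc_field.intro cyc_field_axioms.intro)
  show "field K" by (rule K)
  show "subfield F K" by (rule F)
  show "\<sigma> \<in> ring_hom K K" by (rule sigma_hom)
  show "dimension (p ^ n) F (carrier K)" by (rule dimK)
  have "{x \<in> carrier K. \<forall>\<tau>\<in>carrier G. \<tau> x = x} = F" using gal by (simp add: finite_galois_def)
  then show "{x \<in> carrier K. \<sigma> x = x} = F" using fixed_by_G sG by blast
qed

abbreviation D :: nat where "D \<equiv> p ^ n"

text \<open>Elements of \<open>BijGroup\<close> are \<open>undefined\<close> off the carrier, so a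
  bare iterate of \<sigma> must be restricted to belong to the group.\<close>

definition gp :: "nat \<Rightarrow> 'a \<Rightarrow> 'a" where "gp k = restrict (\<sigma> ^^ k) (carrier K)"

lemma gp_G: "gp k \<in> carrier G"
proof (induction k)
  case 0
  have "gp 0 = \<one>\<^bsub>G\<^esub>" by (simp add: gp_def G_one id_def)
  then show ?case using group.is_monoid[OF group_G] monoid.one_closed by fastforce
next
  case (Suc k)
  have "gp (Suc k) = compose (carrier K) \<sigma> (gp k)" by (auto simp: gp_def compose_def)
  also have "\<dots> = \<sigma> \<otimes>\<^bsub>G\<^esub> gp k" using Suc sG by (simp add: G_mult)
  finally show ?case using Suc sG group.is_monoid[OF group_G] monoid.m_closed by fastforce
qed

lemma gp_mult: "gp k \<otimes>\<^bsub>G\<^esub> gp l = gp (k + l)"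
  using gp_G[of k] gp_G[of l] by (auto simp: G_mult gp_def compose_def sp_sp)

lemma gp_0: "gp 0 = \<one>\<^bsub>G\<^esub>" by (simp add: gp_def G_one id_def)

lemma gp_1: "gp 1 = \<sigma>"
  using sG by (auto simp: gp_def G_iff Bij_def extensional_def)

lemma gp_mod: "gp k = gp (k mod D)"
proof -
  have "(\<sigma> ^^ k) x = (\<sigma> ^^ (k mod D)) x" if "x \<in> carrier K" for x
  proof -
    have "(\<sigma> ^^ (k div D * D)) x = x" using sp_mono_period[of x D] sp_D that by (simp add: Fx_def)
    then have "(\<sigma> ^^ (k mod D)) ((\<sigma> ^^ (k div D * D)) x) = (\<sigma> ^^ (k mod D)) x" by simp
    then show ?thesis unfolding sp_sp by (simp only: mod_div_mult_eq)
  qed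
  then show ?thesis by (auto simp: gp_def)
qed

lemma gp_inj: "inj_on gp {..<D}"
proof (rule inj_onI)
  fix k l assume kl: "k \<in> {..<D}" "l \<in> {..<D}" "gp k = gp l"
  show "k = l"
  proof (rule ccontr)
    assume "k \<noteq> l"
    then obtain x where "x \<in> carrier K" "(\<sigma> ^^ k) x \<noteq> (\<sigma> ^^ l) x"
      using pow_distinct[OF carrier_is_subfield dim _ _ \<open>k \<noteq> l\<close>] kl(1,2) by blast
    then show False using fun_cong[OF kl(3), of x] by (simp add: gp_def)
  qed
qed

lemma G_gp: "carrier G = gp ` {..<D}"
proof
  show "gp ` {..<D} \<subseteq> carrier G" using gp_G by blast
  have "\<tau> \<in> range gp" if "\<tau> \<in> generate G {\<sigma>}" for \<tau>
    using that
  proof (induction rule: generate.induct)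
    case one
    then show ?case using gp_0 by (metis rangeI)
  next
    case (incl h)
    then show ?case using gp_1 by (metis rangeI singletonD)
  next
    case (inv h)
    have "gp (D - 1) \<otimes>\<^bsub>G\<^esub> gp 1 = gp D" using D_pos by (simp add: gp_mult)
    also have "\<dots> = \<one>\<^bsub>G\<^esub>" using gp_mod[of D] gp_0 by simp
    finally have "inv\<^bsub>G\<^esub> (gp 1) = gp (D - 1)" by (rule group.inv_equality[OF group_G _ gp_G gp_G])
    then show ?case using inv gp_1 by auto
  next
    case (eng h1 h2)
    then show ?case by (auto simp: gp_mult)
  qed
  note range = this
  show "carrier G \<subseteq> gp ` {..<D}"
  proof
    fix \<tau> assume "\<tau> \<in> carrier G"
    then obtain k where "\<tau> = gp k" using range gen by blast
    then have "\<tau> = gp (k mod D)" using gp_mod by simp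
    then show "\<tau> \<in> gp ` {..<D}" using D_pos by simp
  qed
qed

lemma inter_field_Fx: "i \<le> n \<Longrightarrow> inter_field K F (p ^ i) = Fx (p ^ i)"
proof -
  assume i: "i \<le> n"
  have r: "p ^ i dvd D" "p ^ i > 0" using i p prime_gt_0_nat by (auto simp: le_imp_power_dvd)
  show ?thesis
    unfolding inter_field_def
  proof (rule the_equality)
    show "subfield (Fx (p ^ i)) K \<and> F \<subseteq> Fx (p ^ i) \<and> dimension (p ^ i) F (Fx (p ^ i))"
      using Fx_subfield F_Fx Fx_dim[OF r] by blast
  qed (use Fx_unique[OF r] in blast)
qed

text \<open>H_i is generated by \<sigma>^(p^i): if \<sigma>^k fixes K_i, so does the power with
  exponent k mod p^i, and \<sigma> has order exactly p^i on K_i.\<close>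

lemma gal_inter_field:
  assumes i: "i \<le> n"
  shows "gp (p ^ i) \<in> carrier (gal_group K (Fx (p ^ i)))"
    "\<tau> \<in> carrier (gal_group K (Fx (p ^ i))) \<Longrightarrow> \<exists>j. \<tau> = gp (j * p ^ i)"
proof -
  have r: "p ^ i dvd D" "p ^ i > 0" using i p prime_gt_0_nat by (auto simp: le_imp_power_dvd)
  show "gp (p ^ i) \<in> carrier (gal_group K (Fx (p ^ i)))"
    using gp_G[of "p ^ i"] unfolding G_iff by (auto simp: Fx_def gp_def)
  assume t: "\<tau> \<in> carrier (gal_group K (Fx (p ^ i)))"
  then have "\<tau> \<in> carrier G" using F_Fx unfolding G_iff by blast
  then obtain k where k: "\<tau> = gp k" using G_gp by blast
  have fx: "(\<sigma> ^^ (k mod p ^ i)) x = x" if x: "x \<in> Fx (p ^ i)" for x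
  proof -
    have "(\<sigma> ^^ k) x = x" using t x unfolding G_iff k by (auto simp: gp_def Fx_def)
    moreover have "(\<sigma> ^^ (k mod p ^ i)) ((\<sigma> ^^ (k div p ^ i * p ^ i)) x) = (\<sigma> ^^ k) x"
      unfolding sp_sp by (simp only: mod_div_mult_eq)
    ultimately show ?thesis using sp_mono_period[OF x, of "k div p ^ i"] by simp
  qed
  have "k mod p ^ i = 0"
  proof (rule ccontr)
    assume "k mod p ^ i \<noteq> 0"
    then obtain x where "x \<in> Fx (p ^ i)" "(\<sigma> ^^ (k mod p ^ i)) x \<noteq> x"
      using degree_eq_order(2)[OF Fx_subfield Fx_dim[OF r], of "k mod p ^ i"] r by auto
    then show False using fx by blast
  qed
  then show "\<exists>j. \<tau> = gp (j * p ^ i)" using k by (metis dvd_div_mult_self mod_0_imp_dvd)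
qed

lemma mult_of_group: "comm_group KU"
  using units_comm_group Multiplicative_Group.field.mult_of_is_Units[OF K] by simp

lemma sigma_nonzero: "x \<in> carrier K \<Longrightarrow> x \<noteq> \<zero> \<Longrightarrow> \<sigma> x \<noteq> \<zero>"
  using s_inj[of x \<zero>] by auto

sublocale U: op_group KU \<sigma>
proof -
  interpret comm_group KU by (rule mult_of_group)
  show "op_group KU \<sigma>"
    by unfold_locales (auto simp: hom_def sigma_nonzero)
qed

lemma U_sp: "x \<in> carrier KU \<Longrightarrow> (\<sigma> ^^ k) x \<in> carrier KU"
  by (induction k) (auto simp: sigma_nonzero)

lemma act_Tp: "x \<in> carrier KU \<Longrightarrow> U.act (Tp p i) x = (\<sigma> ^^ (p ^ i)) x"
  unfolding Tp_def by (rule U.act_monom)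

lemma act_Nm:
  assumes x: "x \<in> carrier KU"
  shows "U.act (Nm p i j) x = (\<Otimes>k\<in>{..<p ^ (j - i)}. (\<sigma> ^^ (k * p ^ i)) x)"
proof -
  have "Nm p i j = (\<Sum>k<p ^ (j - i). Polynomial.monom 1 (k * p ^ i))"
    by (simp add: Nm_def Tp_def monom_power mult.commute)
  then have "U.act (Nm p i j) x = U.act (\<Sum>k<p ^ (j - i). Polynomial.monom 1 (k * p ^ i)) x" by simp
  also have "\<dots> = finprod KU (\<lambda>k. U.act (Polynomial.monom 1 (k * p ^ i)) x) {..<p ^ (j - i)}"
    by (rule U.act_sum[OF x]) simp
  also have "\<dots> = finprod KU (\<lambda>k. (\<sigma> ^^ (k * p ^ i)) x) {..<p ^ (j - i)}"
    using U_sp[OF x] U.act_monom[OF x] by (intro U.finprod_cong') auto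
  also have "\<dots> = (\<Otimes>k\<in>{..<p ^ (j - i)}. (\<sigma> ^^ (k * p ^ i)) x)"
  proof -
    \<comment> \<open>The operator acts in the group of units, whereas \<open>hilbert_90\<close> and
      \<open>gal_norm\<close> use products in the field.\<close>
    have "finprod KU f T = finprod K f T" if "finite T" "\<And>t. t \<in> T \<Longrightarrow> f t \<in> carrier KU"
      for f and T :: "nat set"
      using that
    proof (induction T rule: finite_induct)
      case (insert t T)
      have "finprod KU f (insert t T) = f t \<otimes>\<^bsub>KU\<^esub> finprod KU f T"
        using insert by (intro U.finprod_insert) blast+
      also have "\<dots> = f t \<otimes> finprod K f T" using insert by simp
      also have "\<dots> = finprod K f (insert t T)"
        using insert by (intro finprod_insert[symmetric]) auto
      finally show ?case .
    qed simp
    note * = this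
    show ?thesis by (rule *) (use U_sp[OF x] in auto)
  qed
  finally show ?thesis .
qed

sublocale U: galois_units KU \<sigma> p n \<xi>
proof (intro galois_units.intro galois_units_axioms.intro U.op_group_axioms)
  show "Factorial_Ring.prime p" by (rule p)
  have xi': "\<xi> \<in> carrier K" "\<xi> [^] p = \<one>" "\<And>j. 0 < j \<Longrightarrow> j < p \<Longrightarrow> \<xi> [^] j \<noteq> \<one>"
    using xi by (auto simp: primitive_root_of_unity_def)
  have p1: "1 < p" using prime_gt_1_nat[OF p] .
  have "\<xi> \<noteq> \<zero>" using xi'(2) p1 by (metis nat_pow_zero not_one_less_zero zero_not_one)
  then show xiU: "\<xi> \<in> carrier KU" using xi' by simp
  show "\<sigma> \<xi> = \<xi>" using xiF fixed by blast
  show "\<xi> \<noteq> \<one>\<^bsub>KU\<^esub>" using xi'(3)[of 1] p1 xi'(1) by simp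
  show "\<xi> [^]\<^bsub>KU\<^esub> p = \<one>\<^bsub>KU\<^esub>" using xi' by (simp add: Multiplicative_Group.nat_pow_mult_of)
  show "\<exists>k::nat. a = \<xi> [^]\<^bsub>KU\<^esub> k" if "a \<in> carrier KU" "a [^]\<^bsub>KU\<^esub> p = \<one>\<^bsub>KU\<^esub>" for a
    using roots_of_unity[OF _ xi', of a] that p1 by (simp add: Multiplicative_Group.nat_pow_mult_of)
  show "U.act (Tp p n) a = a" if "a \<in> carrier KU" for a
    using act_Tp[OF that] sp_D that by simp
  fix i j a assume ij: "i \<le> j" "j \<le> n" and a: "a \<in> carrier KU" "U.act (Tp p j) a = a"
    and N: "U.act (Nm p i j) a = \<one>\<^bsub>KU\<^esub>"
  have "a \<in> Fx (p ^ j)" using a act_Tp[OF a(1)] by (simp add: Fx_def)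
  moreover have "(\<Otimes>k\<in>{..<p ^ (j - i)}. (\<sigma> ^^ (k * p ^ i)) a) = \<one>" using N act_Nm[OF a(1)] by simp
  moreover have "p ^ j = p ^ (j - i) * p ^ i" using ij by (simp flip: power_add)
  moreover have "p ^ j dvd D" using ij by (simp add: le_imp_power_dvd)
  moreover have "p ^ j > 0" using p1 by simp
  ultimately obtain b where b: "b \<in> Fx (p ^ j)" "b \<noteq> \<zero>" "a \<otimes> (\<sigma> ^^ (p ^ i)) b = b"
    using hilbert_90[of "p ^ j" "p ^ (j - i)" "p ^ i" a] by blast
  have bU: "b \<in> carrier KU" using b by (simp add: Fx_def)
  have Tb: "U.act (Tp p i) b = (\<sigma> ^^ (p ^ i)) b" by (rule act_Tp[OF bU])
  have TbU: "U.act (Tp p i) b \<in> carrier KU" using bU by blast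
  have "U.act (Tp p j) b = b" using b act_Tp[OF bU] by (simp add: Fx_def)
  \<comment> \<open>The witness is the inverse of \<open>b\<close>, since \<open>hilbert_90\<close>
    makes \<open>a\<close> the quotient of \<open>b\<close> by \<sigma>^(p^i) b.\<close>
  then have "U.act (Tp p j) (inv\<^bsub>KU\<^esub> b) = inv\<^bsub>KU\<^esub> b" using bU by (simp only: U.act_inv)
  moreover have "U.act (Tp p i - 1) (inv\<^bsub>KU\<^esub> b) = a"
  proof -
    have e: "b = a \<otimes>\<^bsub>KU\<^esub> U.act (Tp p i) b" using b Tb by simp
    have "U.act (Tp p i - 1) (inv\<^bsub>KU\<^esub> b) = inv\<^bsub>KU\<^esub> (U.act (Tp p i) b \<otimes>\<^bsub>KU\<^esub> inv\<^bsub>KU\<^esub> b)"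
      using bU by (simp only: U.act_inv U.act_diff U.act_1)
    also have "\<dots> = b \<otimes>\<^bsub>KU\<^esub> inv\<^bsub>KU\<^esub> (U.act (Tp p i) b)"
      using bU TbU by (simp only: U.inv_mult U.inv_closed U.inv_inv U.m_comm)
    also have "\<dots> = a" using e a(1) TbU bU U.inv_solve_right'[of a b "U.act (Tp p i) b"] by metis
    finally show ?thesis .
  qed
  ultimately show "\<exists>b\<in>carrier KU. U.act (Tp p j) b = b \<and> U.act (Tp p i - 1) b = a"
    using U.inv_closed[OF bU] by blast
qed

end

section \<open>The action of the group ring\<close>

context kummer
begin

abbreviation R :: "(('a \<Rightarrow> 'a) \<Rightarrow> int) ring" where "R \<equiv> group_ring (Fp p) G"
abbreviation JM :: "(('a \<Rightarrow> 'a) \<Rightarrow> int, 'a set) module" where "JM \<equiv> pclass_module K F p"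

lemma p_gt_1: "p > 1" using prime_gt_1_nat[OF p] .

section \<open>The module J and the group ring F_p[G]\<close>

lemma unit_powers_P: "unit_powers K p = U.P"
  by (simp add: unit_powers_def U.P_def Multiplicative_Group.nat_pow_mult_of)

lemma pclass_group_J: "pclass_group K p = U.J"
  by (simp add: pclass_group_def U.J_def unit_powers_P)

lemma pclass_cls: "pclass K p x = U.cls x"
  by (simp add: pclass_def U.cls_def unit_powers_P)

lemma carrier_JM [simp]: "carrier JM = carrier U.J"
  and add_JM [simp]: "ring.add JM = monoid.mult U.J" and zero_JM [simp]: "\<zero>\<^bsub>JM\<^esub> = \<one>\<^bsub>U.J\<^esub>"
  by (simp_all add: pclass_module_def pclass_group_J)

lemma subgroup_JM: "subgroup H (add_monoid JM) \<longleftrightarrow> subgroup H U.J"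
  by (simp add: subgroup_def m_inv_def)

lemma smult_JM: "f \<odot>\<^bsub>JM\<^esub> v = finprod U.J (\<lambda>\<tau>. (\<tau> ` v) [^]\<^bsub>U.J\<^esub> f \<tau>) (carrier G)"
  by (simp add: pclass_module_def pclass_group_J)

lemma finsum_JM: "finsum JM f T = finprod U.J f T"
  by (simp add: finsum_def finprod_def)

lemma set_add_JM: "H <+>\<^bsub>JM\<^esub> N = H <#>\<^bsub>U.J\<^esub> N"
  by (simp add: set_add_def set_mult_def)

lemma J_subset: "v \<in> carrier U.J \<Longrightarrow> v \<subseteq> carrier K"
  by (auto simp: U.carrier_J U.cls_def U.P_def r_coset_def Multiplicative_Group.nat_pow_mult_of)

lemma gp_image: "v \<in> carrier U.J \<Longrightarrow> gp k ` v = (U.sJ ^^ k) v"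
proof -
  assume v: "v \<in> carrier U.J"
  have "(U.sJ ^^ k) v = (\<sigma> ^^ k) ` v" by (induction k) (auto simp: U.sJ_def)
  moreover have "gp k ` v = (\<sigma> ^^ k) ` v" using J_subset[OF v] by (intro image_cong) (auto simp: gp_def)
  ultimately show ?thesis by simp
qed

lemma act_monom_J: "v \<in> carrier U.J \<Longrightarrow> U.J.act (Polynomial.monom c k) v = ((U.sJ ^^ k) v) [^]\<^bsub>U.J\<^esub> c"
  using U.J.act_smult[of v c "Polynomial.monom 1 k"] U.J.act_monom[of v k] by (simp add: smult_monom)

lemma sJ_D: "v \<in> carrier U.J \<Longrightarrow> (U.sJ ^^ k) v = (U.sJ ^^ (k mod D)) v"
  using gp_image[of v k] gp_image[of v "k mod D"] gp_mod[of k] by simp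

lemma act_monom_mod: "v \<in> carrier U.J \<Longrightarrow> U.J.act (Polynomial.monom c k) v = U.J.act (Polynomial.monom c (k mod D)) v"
  using sJ_D[of v k] by (simp add: act_monom_J)

text \<open>The lift to Z[x] of the group ring element whose coefficient at \<sigma>^k is
  \<open>b k\<close>.\<close>

definition S :: "(nat \<Rightarrow> int) \<Rightarrow> int poly" where "S b = (\<Sum>k<D. Polynomial.monom (b k) k)"

lemma act_S: "v \<in> carrier U.J \<Longrightarrow> U.J.act (S b) v = finprod U.J (\<lambda>k. U.J.act (Polynomial.monom (b k) k) v) {..<D}"
  unfolding S_def by (rule U.J.act_sum) auto

lemma S_mod_cong:
  assumes v: "v \<in> carrier U.J" and b: "\<And>k. k < D \<Longrightarrow> b k mod int p = b' k mod int p"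
  shows "U.J.act (S b) v = U.J.act (S b') v"
  unfolding act_S[OF v]
proof (rule U.J.finprod_cong')
  fix k assume k: "k \<in> {..<D}"
  have "(U.sJ ^^ k) v \<in> carrier U.J" using U.J.act_monom[OF v, of k] U.J.act_closed[OF v] by metis
  then show "U.J.act (Polynomial.monom (b k) k) v = U.J.act (Polynomial.monom (b' k) k) v"
    using b[of k] k v U.J.int_pow_nat[of "(U.sJ ^^ k) v" "b k"] U.J.int_pow_nat[of "(U.sJ ^^ k) v" "b' k"]
    by (simp add: act_monom_J)
qed (use v in auto)

lemma smult_S: "v \<in> carrier U.J \<Longrightarrow> f \<odot>\<^bsub>JM\<^esub> v = U.J.act (S (\<lambda>k. f (gp k))) v"
proof -
  assume v: "v \<in> carrier U.J"
  have c: "(U.sJ ^^ k) v \<in> carrier U.J" for k using U.J.act_monom[OF v, of k] U.J.act_closed[OF v] by metis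
  have "f \<odot>\<^bsub>JM\<^esub> v = finprod U.J (\<lambda>k. (gp k ` v) [^]\<^bsub>U.J\<^esub> f (gp k)) {..<D}"
    unfolding smult_JM G_gp using gp_inj c gp_image[OF v] by (subst U.J.finprod_reindex) auto
  also have "\<dots> = U.J.act (S (\<lambda>k. f (gp k))) v"
    unfolding act_S[OF v] using c by (intro U.J.finprod_cong') (auto simp: gp_image[OF v] act_monom_J[OF v])
  finally show ?thesis .
qed

lemma R_carrier: "carrier R = carrier G \<rightarrow>\<^sub>E {0..int p - 1}"
  by (simp add: group_ring_def residue_ring_def)

lemma R_add: "f \<oplus>\<^bsub>R\<^esub> g = (\<lambda>x\<in>carrier G. (f x + g x) mod int p)"
  by (simp add: group_ring_def residue_ring_def)

lemma R_zero: "\<zero>\<^bsub>R\<^esub> = (\<lambda>x\<in>carrier G. 0)"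
  by (simp add: group_ring_def residue_ring_def)

lemma Fp_zero: "\<zero>\<^bsub>Fp p\<^esub> = 0" and Fp_one: "\<one>\<^bsub>Fp p\<^esub> = 1"
  by (simp_all add: residue_ring_def)

lemma R_single: "gr_single (Fp p) G c g = (\<lambda>x\<in>carrier G. if x = g then c else 0)"
  unfolding gr_single_def Fp_zero by (rule refl)

lemma R_one: "\<one>\<^bsub>R\<^esub> = gr_single (Fp p) G 1 \<one>\<^bsub>G\<^esub>"
  unfolding group_ring_def gr_single_def Fp_one by simp

lemma R_group: "abelian_group R"
proof (rule abelian_groupI)
  fix f g h assume f: "f \<in> carrier R" and g: "g \<in> carrier R" and h: "h \<in> carrier R"
  show "f \<oplus>\<^bsub>R\<^esub> g \<in> carrier R" using p_gt_1 by (auto simp: R_carrier R_add)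
  show "f \<oplus>\<^bsub>R\<^esub> g = g \<oplus>\<^bsub>R\<^esub> f" by (simp add: R_add add.commute)
  show "f \<oplus>\<^bsub>R\<^esub> g \<oplus>\<^bsub>R\<^esub> h = f \<oplus>\<^bsub>R\<^esub> (g \<oplus>\<^bsub>R\<^esub> h)"
    by (auto simp: R_add mod_simps add.assoc)
  have fx: "f x mod int p = f x" if "x \<in> carrier G" for x
    using f that by (intro mod_pos_pos_trivial) (auto simp: R_carrier PiE_iff)
  show "\<zero>\<^bsub>R\<^esub> \<oplus>\<^bsub>R\<^esub> f = f"
    using f fx by (auto simp: R_add R_zero R_carrier PiE_iff extensional_def)
  have "(\<lambda>x\<in>carrier G. (- f x) mod int p) \<in> carrier R" using p_gt_1 by (auto simp: R_carrier)
  moreover have "(\<lambda>x\<in>carrier G. (- f x) mod int p) \<oplus>\<^bsub>R\<^esub> f = \<zero>\<^bsub>R\<^esub>" by (auto simp: R_add R_zero mod_simps)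
  ultimately show "\<exists>g\<in>carrier R. g \<oplus>\<^bsub>R\<^esub> f = \<zero>\<^bsub>R\<^esub>" by blast
qed (use p_gt_1 in \<open>auto simp: R_carrier R_zero\<close>)

text \<open>A relation in place of the surjection from Z[x] to F_p[G]: only the action on J is
  compared, so polynomials need not be reduced modulo p or modulo x^D - 1.\<close>

definition rep :: "(('a \<Rightarrow> 'a) \<Rightarrow> int) \<Rightarrow> int poly \<Rightarrow> bool" where
  "rep f g \<longleftrightarrow> f \<in> carrier R \<and> (\<forall>v\<in>carrier U.J. f \<odot>\<^bsub>JM\<^esub> v = U.J.act g v)"

lemma repD: "rep f g \<Longrightarrow> v \<in> carrier U.J \<Longrightarrow> f \<odot>\<^bsub>JM\<^esub> v = U.J.act g v" by (simp add: rep_def)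
lemma rep_carrier: "rep f g \<Longrightarrow> f \<in> carrier R" by (simp add: rep_def)

lemma rep_single: "j < D \<Longrightarrow> c \<in> {0..int p - 1} \<Longrightarrow> rep (gr_single (Fp p) G c (gp j)) (Polynomial.monom c j)"
proof -
  assume j: "j < D" and c: "c \<in> {0..int p - 1}"
  have "(\<Sum>k<D. Polynomial.monom (gr_single (Fp p) G c (gp j) (gp k)) k) = (\<Sum>k<D. if k = j then Polynomial.monom c k else 0)"
    using gp_inj j gp_G by (intro sum.cong) (auto simp: R_single inj_on_eq_iff)
  then have "S (\<lambda>k. gr_single (Fp p) G c (gp j) (gp k)) = Polynomial.monom c j"
    using j by (simp add: S_def)
  moreover have "gr_single (Fp p) G c (gp j) \<in> carrier R" using c by (auto simp: R_single R_carrier)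
  ultimately show ?thesis by (simp add: rep_def smult_S)
qed

lemma rep_one: "rep \<one>\<^bsub>R\<^esub> 1"
  using rep_single[of 0 1] D_pos p_gt_1 by (simp add: R_one gp_0 Polynomial.monom_0 one_pCons)

lemma rep_add: "rep f a \<Longrightarrow> rep g b \<Longrightarrow> rep (f \<oplus>\<^bsub>R\<^esub> g) (a + b)"
proof -
  assume r: "rep f a" "rep g b"
  have "(f \<oplus>\<^bsub>R\<^esub> g) \<odot>\<^bsub>JM\<^esub> v = U.J.act (a + b) v" if v: "v \<in> carrier U.J" for v
  proof -
    have "(f \<oplus>\<^bsub>R\<^esub> g) \<odot>\<^bsub>JM\<^esub> v = U.J.act (S (\<lambda>k. f (gp k) + g (gp k))) v"
      unfolding smult_S[OF v] using gp_G by (intro S_mod_cong v) (simp add: R_add)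
    also have "S (\<lambda>k. f (gp k) + g (gp k)) = S (\<lambda>k. f (gp k)) + S (\<lambda>k. g (gp k))"
      by (simp add: S_def sum.distrib flip: add_monom)
    finally show ?thesis using r v by (simp add: U.J.act_add repD flip: smult_S)
  qed
  moreover have "f \<oplus>\<^bsub>R\<^esub> g \<in> carrier R" using r R_group by (simp add: rep_carrier abelian_groupE(1))
  ultimately show ?thesis by (simp add: rep_def)
qed

lemma rep_minus: assumes "rep f a" "rep g b" shows "rep (f \<ominus>\<^bsub>R\<^esub> g) (a - b)"
proof -
  interpret R: abelian_group R by (rule R_group)
  note c = rep_carrier[OF assms(1)] rep_carrier[OF assms(2)]
  have fg: "f \<ominus>\<^bsub>R\<^esub> g \<in> carrier R" using c by (rule R.minus_closed)
  have e: "(f \<ominus>\<^bsub>R\<^esub> g) \<oplus>\<^bsub>R\<^esub> g = f" using c by (simp add: R.minus_eq R.a_assoc R.l_neg)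
  have "(f \<ominus>\<^bsub>R\<^esub> g) \<odot>\<^bsub>JM\<^esub> v = U.J.act (a - b) v" if v: "v \<in> carrier U.J" for v
  proof -
    let ?s = "S (\<lambda>k. (f \<ominus>\<^bsub>R\<^esub> g) (gp k))"
    have "rep (f \<ominus>\<^bsub>R\<^esub> g) ?s" using fg by (simp add: rep_def smult_S)
    then have "rep f (?s + b)" using rep_add[OF _ assms(2)] e by fastforce
    then have "U.J.act a v = U.J.act (?s + b) v" using repD assms(1) v by metis
    then have "U.J.act (a - b) v = U.J.act (?s + b - b) v" using v by (simp only: U.J.act_diff)
    then show ?thesis using v by (simp add: smult_S)
  qed
  then show ?thesis using fg by (simp add: rep_def)
qed

lemma finsum_Fp:
  assumes "finite T" "\<And>t. t \<in> T \<Longrightarrow> h t \<in> {0..int p - 1}"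
  shows "finsum (Fp p) h T = (\<Sum>t\<in>T. h t) mod int p"
proof -
  interpret r: residues "int p" "Fp p" using p_gt_1 by unfold_locales auto
  note am = abelian_group.axioms(1)[OF r.abelian_group]
  show ?thesis using assms
  proof (induction T rule: finite_induct)
    case empty
    show ?case using abelian_monoid.finsum_empty[OF am, of h] by (simp add: residue_ring_def)
  next
    case (insert t T)
    have "finsum (Fp p) h (insert t T) = h t \<oplus>\<^bsub>Fp p\<^esub> finsum (Fp p) h T"
      using insert by (intro abelian_monoid.finsum_insert[OF am]) (auto simp: residue_ring_def)
    also have "\<dots> = (h t + (\<Sum>t\<in>T. h t)) mod int p"
      using insert by (simp add: residue_ring_def mod_simps)
    finally show ?case using insert by simp
  qed
qed

lemma R_mult:
  assumes f: "f \<in> carrier R" and g: "g \<in> carrier R"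
  shows "f \<otimes>\<^bsub>R\<^esub> g \<in> carrier R"
    "k < D \<Longrightarrow> (f \<otimes>\<^bsub>R\<^esub> g) (gp k) = (\<Sum>i<D. f (gp i) * g (gp ((k + D - i) mod D))) mod int p"
proof -
  \<comment> \<open>Convolution over G becomes convolution of indices modulo \<open>D\<close>;
    adding \<open>D\<close> first keeps the difference k - i from being truncated.\<close>
  have inv_gp: "inv\<^bsub>G\<^esub> (gp i) \<otimes>\<^bsub>G\<^esub> gp k = gp ((k + D - i) mod D)" if "i < D" for i k
  proof -
    have "gp (D - i) \<otimes>\<^bsub>G\<^esub> gp i = gp D" using that by (simp add: gp_mult)
    also have "\<dots> = \<one>\<^bsub>G\<^esub>" using gp_mod[of D] gp_0 by simp
    finally have "inv\<^bsub>G\<^esub> (gp i) = gp (D - i)" by (rule group.inv_equality[OF group_G _ gp_G gp_G])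
    then show ?thesis using that gp_mod[of "k + D - i"] by (simp add: gp_mult add.commute)
  qed
  have gG: "h (gp i) \<in> {0..int p - 1}" if "h \<in> carrier R" for h i
    using that gp_G by (auto simp: R_carrier PiE_iff)
  have val: "(f \<otimes>\<^bsub>R\<^esub> g) (gp k) = (\<Sum>i<D. f (gp i) * g (gp ((k + D - i) mod D))) mod int p" for k
  proof -
    have "(f \<otimes>\<^bsub>R\<^esub> g) (gp k) = finsum (Fp p) (\<lambda>y. (f y * g (inv\<^bsub>G\<^esub> y \<otimes>\<^bsub>G\<^esub> gp k)) mod int p) (gp ` {..<D})"
      using gp_G G_gp by (simp add: group_ring_def residue_ring_def)
    also have "\<dots> = (\<Sum>y\<in>gp ` {..<D}. (f y * g (inv\<^bsub>G\<^esub> y \<otimes>\<^bsub>G\<^esub> gp k)) mod int p) mod int p"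
      using p_gt_1 by (intro finsum_Fp) auto
    also have "\<dots> = (\<Sum>i<D. (f (gp i) * g (inv\<^bsub>G\<^esub> (gp i) \<otimes>\<^bsub>G\<^esub> gp k)) mod int p) mod int p"
      using gp_inj by (subst sum.reindex) auto
    also have "\<dots> = (\<Sum>i<D. f (gp i) * g (gp ((k + D - i) mod D))) mod int p"
      by (simp add: mod_sum_eq inv_gp)
    finally show ?thesis .
  qed
  then show "(f \<otimes>\<^bsub>R\<^esub> g) (gp k) = (\<Sum>i<D. f (gp i) * g (gp ((k + D - i) mod D))) mod int p" .
  have "f \<otimes>\<^bsub>R\<^esub> g \<in> extensional (carrier G)" by (simp add: group_ring_def)
  then show "f \<otimes>\<^bsub>R\<^esub> g \<in> carrier R" using val p_gt_1 by (auto simp: R_carrier PiE_iff G_gp)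
qed

text \<open>Convolution is polynomial multiplication with exponents reduced modulo \<open>D\<close>,
  and the reduction is invisible because \<sigma>^D acts trivially on J.\<close>

lemma rep_mult: assumes r: "rep f a" "rep g b" shows "rep (f \<otimes>\<^bsub>R\<^esub> g) (a * b)"
proof -
  note c = rep_carrier[OF r(1)] rep_carrier[OF r(2)]
  have "(f \<otimes>\<^bsub>R\<^esub> g) \<odot>\<^bsub>JM\<^esub> v = U.J.act (a * b) v" if v: "v \<in> carrier U.J" for v
  proof -
    let ?f = "\<lambda>i. f (gp i)" and ?g = "\<lambda>i. g (gp i)"
    have "(f \<otimes>\<^bsub>R\<^esub> g) \<odot>\<^bsub>JM\<^esub> v = U.J.act (S (\<lambda>k. \<Sum>i<D. ?f i * ?g ((k + D - i) mod D))) v"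
      unfolding smult_S[OF v] by (intro S_mod_cong v) (simp add: R_mult[OF c])
    also have "S (\<lambda>k. \<Sum>i<D. ?f i * ?g ((k + D - i) mod D)) =
        (\<Sum>i<D. \<Sum>k<D. Polynomial.monom (?f i * ?g ((k + D - i) mod D)) k)"
      unfolding S_def by (subst sum.swap) (simp add: monom_sum)
    also have "\<dots> = (\<Sum>i<D. \<Sum>j<D. Polynomial.monom (?f i * ?g j) ((i + j) mod D))"
    proof (rule sum.cong[OF refl])
      fix i assume i: "i \<in> {..<D}"
      show "(\<Sum>k<D. Polynomial.monom (?f i * ?g ((k + D - i) mod D)) k) = (\<Sum>j<D. Polynomial.monom (?f i * ?g j) ((i + j) mod D))"
      proof (rule sum.reindex_bij_witness[where i = "\<lambda>j. (i + j) mod D" and j = "\<lambda>k. (k + D - i) mod D"])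
        fix k assume k: "k \<in> {..<D}"
        have "(i + (k + D - i) mod D) mod D = (i + (k + D - i)) mod D" by (simp only: mod_add_right_eq)
        also have "\<dots> = k" using i k by simp
        finally show e: "(i + (k + D - i) mod D) mod D = k" .
        show "(k + D - i) mod D \<in> {..<D}" using D_pos by simp
        show "Polynomial.monom (?f i * ?g ((k + D - i) mod D)) ((i + (k + D - i) mod D) mod D) = Polynomial.monom (?f i * ?g ((k + D - i) mod D)) k"
          by (simp only: e)
      next
        fix j assume j: "j \<in> {..<D}"
        have "((i + j) mod D + D - i) mod D = ((i + j) mod D + (D - i)) mod D" using i by simp
        also have "\<dots> = (i + j + (D - i)) mod D" by (simp only: mod_add_left_eq)
        also have "\<dots> = j" using i j by simp
        finally show "((i + j) mod D + D - i) mod D = j" .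
        show "(i + j) mod D \<in> {..<D}" using D_pos by simp
      qed
    qed
    also have "U.J.act \<dots> v = finprod U.J (\<lambda>i. U.J.act (\<Sum>j<D. Polynomial.monom (?f i * ?g j) ((i + j) mod D)) v) {..<D}"
      by (rule U.J.act_sum[OF v]) simp
    also have "\<dots> = finprod U.J (\<lambda>i. U.J.act (Polynomial.monom (?f i) i * S ?g) v) {..<D}"
    proof (rule U.J.finprod_cong')
      fix i assume "i \<in> {..<D}"
      have "U.J.act (\<Sum>j<D. Polynomial.monom (?f i * ?g j) ((i + j) mod D)) v =
          finprod U.J (\<lambda>j. U.J.act (Polynomial.monom (?f i * ?g j) ((i + j) mod D)) v) {..<D}"
        by (rule U.J.act_sum[OF v]) simp
      also have "\<dots> = finprod U.J (\<lambda>j. U.J.act (Polynomial.monom (?f i * ?g j) (i + j)) v) {..<D}"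
        using v by (intro U.J.finprod_cong') (auto simp flip: act_monom_mod)
      also have "\<dots> = U.J.act (\<Sum>j<D. Polynomial.monom (?f i * ?g j) (i + j)) v"
        by (rule U.J.act_sum[OF v, symmetric]) simp
      also have "(\<Sum>j<D. Polynomial.monom (?f i * ?g j) (i + j)) = Polynomial.monom (?f i) i * S ?g"
        by (simp add: S_def sum_distrib_left mult_monom)
      finally show "U.J.act (\<Sum>j<D. Polynomial.monom (?f i * ?g j) ((i + j) mod D)) v = U.J.act (Polynomial.monom (?f i) i * S ?g) v" .
    qed (use v in auto)
    also have "\<dots> = U.J.act (\<Sum>i<D. Polynomial.monom (?f i) i * S ?g) v"
      by (rule U.J.act_sum[OF v, symmetric]) simp
    also have "(\<Sum>i<D. Polynomial.monom (?f i) i * S ?g) = S ?f * S ?g"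
      by (simp add: S_def sum_distrib_right)
    also have "U.J.act (S ?f * S ?g) v = f \<odot>\<^bsub>JM\<^esub> (g \<odot>\<^bsub>JM\<^esub> v)"
      using v by (simp add: U.J.act_comp smult_S)
    also have "\<dots> = U.J.act (a * b) v" using r v by (simp add: repD U.J.act_comp)
    finally show ?thesis .
  qed
  then show ?thesis using R_mult(1)[OF c] by (simp add: rep_def)
qed

lemma rep_pow: "rep f a \<Longrightarrow> rep (f [^]\<^bsub>R\<^esub> (k::nat)) (a ^ k)"
proof (induction k)
  case 0
  then show ?case using rep_one by (simp add: nat_pow_def)
next
  case (Suc k)
  have "f [^]\<^bsub>R\<^esub> Suc k = f [^]\<^bsub>R\<^esub> k \<otimes>\<^bsub>R\<^esub> f" by (simp add: nat_pow_def)
  then show ?case using rep_mult[OF Suc.IH[OF Suc.prems] Suc.prems] by (simp add: mult.commute)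
qed

lemma rep_tau: "j < D \<Longrightarrow> rep (tau_minus_one K F p (gp j)) (Polynomial.monom 1 j - 1)"
  unfolding tau_minus_one_def
  using rep_minus[OF rep_single[of j 1] rep_one] p_gt_1 by (simp add: residue_ring_def)

text \<open>Multiplying by x shifts the coefficients by one; the top coefficient, now at x^D,
  returns to the constant term.\<close>

lemma act_eq_S: "\<exists>b. \<forall>v\<in>carrier U.J. U.J.act g v = U.J.act (S b) v"
proof (induction g)
  case 0
  show ?case by (intro exI[of _ "\<lambda>_. 0"]) (simp add: S_def)
next
  case (pCons a g)
  then obtain b where b: "\<And>v. v \<in> carrier U.J \<Longrightarrow> U.J.act g v = U.J.act (S b) v" by blast
  obtain q where q: "D = Suc q" using D_pos by (metis gr0_implies_Suc)
  define b' where "b' k = (case k of 0 \<Rightarrow> a + b q | Suc k \<Rightarrow> b k)" for k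
  have sh: "pCons 0 (\<Sum>k<m. Polynomial.monom (b k) k) = (\<Sum>k<m. Polynomial.monom (b k) (Suc k))" for m
  proof (induction m)
    case (Suc m)
    have "pCons 0 ((\<Sum>k<m. Polynomial.monom (b k) k) + Polynomial.monom (b m) m) =
      pCons 0 (\<Sum>k<m. Polynomial.monom (b k) k) + pCons 0 (Polynomial.monom (b m) m)" by simp
    then show ?case using Suc by (simp add: Polynomial.monom_Suc)
  qed simp
  have "S b' = [:a + b q:] + (\<Sum>k<q. Polynomial.monom (b k) (Suc k))"
    unfolding S_def q by (subst sum.lessThan_Suc_shift) (simp add: b'_def Polynomial.monom_0)
  moreover have "pCons a (S b) = [:a:] + ((\<Sum>k<q. Polynomial.monom (b k) (Suc k)) + Polynomial.monom (b q) D)"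
  proof -
    have "pCons a (S b) = [:a:] + pCons 0 (S b)" by simp
    then show ?thesis unfolding S_def sh by (simp add: q)
  qed
  ultimately have e: "pCons a (S b) + [:b q:] = S b' + Polynomial.monom (b q) D" by simp
  have "U.J.act (pCons a g) v = U.J.act (S b') v" if v: "v \<in> carrier U.J" for v
  proof -
    have "U.J.act (pCons a g) v = U.J.act (pCons a (S b)) v" using b[OF v] by (simp add: U.J.act_pCons)
    also have "pCons a (S b) = S b' + Polynomial.monom (b q) D - [:b q:]" using e by (simp add: algebra_simps)
    also have "U.J.act \<dots> v = U.J.act (S b') v \<otimes>\<^bsub>U.J\<^esub> U.J.act (Polynomial.monom (b q) D) v \<otimes>\<^bsub>U.J\<^esub> inv\<^bsub>U.J\<^esub> U.J.act [:b q:] v"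
      using v by (simp only: U.J.act_diff U.J.act_add)
    also have "U.J.act (Polynomial.monom (b q) D) v = U.J.act [:b q:] v"
      using act_monom_mod[OF v, of "b q" D] by (simp add: Polynomial.monom_0)
    finally show ?thesis using v by (simp add: U.J.m_assoc)
  qed
  then show ?case by blast
qed

lemma rep_exists: "\<exists>f. rep f g"
proof -
  obtain b where b: "\<And>v. v \<in> carrier U.J \<Longrightarrow> U.J.act g v = U.J.act (S b) v" using act_eq_S by blast
  define f where "f = (\<lambda>\<tau>\<in>carrier G. b (the_inv_into {..<D} gp \<tau>) mod int p)"
  have "f (gp k) = b k mod int p" if "k < D" for k
    using that gp_G the_inv_into_f_f[OF gp_inj, of k] by (simp add: f_def)
  then have "f \<odot>\<^bsub>JM\<^esub> v = U.J.act g v" if "v \<in> carrier U.J" for v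
    unfolding smult_S[OF that] b[OF that] by (intro S_mod_cong that) simp
  moreover have "f \<in> carrier R" using p_gt_1 by (auto simp: R_carrier f_def)
  ultimately show ?thesis by (auto simp: rep_def)
qed

lemma smult_act: "f \<in> carrier R \<Longrightarrow> \<exists>g. rep f g"
  by (auto simp: rep_def smult_S)

lemma cyclic_submodule_cyc: "v \<in> carrier U.J \<Longrightarrow> cyclic_submodule R JM v = U.J.cyc v"
  unfolding cyclic_submodule_def U.J.cyc_def
  using smult_act rep_exists repD rep_carrier by (auto simp: image_iff) metis+

lemma submoduleI_J:
  assumes H: "subgroup H U.J" and s: "\<And>v. v \<in> H \<Longrightarrow> U.sJ v \<in> H"
  shows "submodule H R JM"
proof (rule submodule.intro)
  show "subgroup H (add_monoid JM)" using H by (simp only: subgroup_JM)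
  show "submodule_axioms H R JM"
  proof
    fix f v assume f: "f \<in> carrier R" and v: "v \<in> H"
    obtain g where "rep f g" using smult_act[OF f] by blast
    then show "f \<odot>\<^bsub>JM\<^esub> v \<in> H"
      using U.J.act_subgroup[OF H s v] subgroup.mem_carrier[OF H v] by (simp add: repD)
  qed
qed

lemma has_dim_cyc:
  assumes v: "v \<in> carrier U.J" and l: "U.J.xp (Suc l) v = \<one>\<^bsub>U.J\<^esub>" "U.J.xp l v \<noteq> \<one>\<^bsub>U.J\<^esub>"
  shows "has_dim (Fp p) G JM (U.J.cyc v) (Suc l)"
proof -
  obtain B where B: "B \<subseteq> U.J.cyc v" "finite B" "card B = Suc l" "U.J.lin_indep B" "U.J.lin_span B = U.J.cyc v"
    using U.J.cyc_basis[OF v l] by blast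
  have Bc: "b \<in> carrier U.J" if "b \<in> B" for b using B(4) that by (auto simp: U.J.lin_indep_def)
  have "bij_betw (\<lambda>a. finprod U.J (\<lambda>b. b [^]\<^bsub>U.J\<^esub> (a b :: int)) B) (B \<rightarrow>\<^sub>E {0..int p - 1}) (U.J.cyc v)"
    using U.J.lin_indep_bij[OF B(4,2)] B(5) by simp
  moreover have "(\<Oplus>\<^bsub>JM\<^esub>b\<in>B. gr_single (Fp p) G (a b) \<one>\<^bsub>G\<^esub> \<odot>\<^bsub>JM\<^esub> b) = finprod U.J (\<lambda>b. b [^]\<^bsub>U.J\<^esub> (a b :: int)) B"
    if a: "a \<in> B \<rightarrow>\<^sub>E {0..int p - 1}" for a
    unfolding finsum_JM
  proof (rule U.J.finprod_cong')
    fix b assume b: "b \<in> B"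
    have "rep (gr_single (Fp p) G (a b) (gp 0)) (Polynomial.monom (a b) 0)"
      using a b D_pos by (intro rep_single) auto
    then show "gr_single (Fp p) G (a b) \<one>\<^bsub>G\<^esub> \<odot>\<^bsub>JM\<^esub> b = b [^]\<^bsub>U.J\<^esub> a b"
      using Bc[OF b] repD[of _ _ b] U.J.act_const[of b "a b"] by (simp add: gp_0 Polynomial.monom_0)
  qed (use Bc in auto)
  ultimately have "bij_betw (\<lambda>a. \<Oplus>\<^bsub>JM\<^esub>b\<in>B. gr_single (Fp p) G (a b) \<one>\<^bsub>G\<^esub> \<odot>\<^bsub>JM\<^esub> b) (B \<rightarrow>\<^sub>E {0..int p - 1}) (U.J.cyc v)"
    by (subst bij_betw_cong) auto
  then show ?thesis unfolding has_dim_def using B by (auto simp: residue_ring_def)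
qed

lemma is_direct_sum_family_fsum:
  assumes N: "\<And>i. i \<in> I \<Longrightarrow> subgroup (N i) U.J" "\<And>i v. i \<in> I \<Longrightarrow> v \<in> N i \<Longrightarrow> U.sJ v \<in> N i"
    and ind: "U.J.indep_fam I N"
  shows "is_direct_sum_family R JM I N (U.J.fsum I N)"
  unfolding is_direct_sum_family_def finsum_JM zero_JM
  using U.J.indep_fam_bij[OF N(1) ind] submoduleI_J[OF N] by blast

section \<open>Norm classes, exceptional elements and fixed classes\<close>

lemma L_Fx: "U.L i = Fx (p ^ i) - {\<zero>}"
  unfolding U.L_def by (auto simp: Fx_def act_Tp)

lemma inter_units_E: "i \<le> n \<Longrightarrow> pclass K p ` inter_units K F p (Fin i) = U.E i"
  by (simp add: inter_units_def inter_field_Fx U.E_def L_Fx pclass_cls)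

lemma norm_act: "x \<in> carrier KU \<Longrightarrow> gal_norm K F x = U.act (Nm p 0 n) x"
proof -
  assume x: "x \<in> carrier KU"
  have c: "(\<sigma> ^^ k) x \<in> carrier K" for k using x by simp
  have "gal_norm K F x = (\<Otimes>k\<in>{..<D}. gp k x)"
    unfolding gal_norm_def G_gp using gp_inj c x by (subst finprod_reindex) (auto simp: gp_def)
  also have "\<dots> = (\<Otimes>k\<in>{..<D}. (\<sigma> ^^ k) x)" using x c by (intro finprod_cong') (auto simp: gp_def)
  finally show ?thesis using act_Nm[OF x, of 0 n] by simp
qed

lemma norm_class:
  assumes x: "x \<in> carrier KU"
  shows "pclass (K\<lparr>carrier := F\<rparr>) p (gal_norm K F x) = pclass (K\<lparr>carrier := F\<rparr>) p \<one> \<longleftrightarrow> U.pnorm x"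
proof -
  let ?y = "gal_norm K F x"
  have pw: "a [^]\<^bsub>K\<lparr>carrier := F\<rparr>\<^esub> (k::nat) = a [^] k" for a k by (simp add: nat_pow_def)
  have y: "?y \<in> U.L 0" unfolding norm_act[OF x] using U.Nm_L[of x n 0] U.L_n x by simp
  have F0: "U.L 0 = F - {\<zero>}" using fixed by (auto simp: L_Fx Fx_def)
  have P: "unit_powers (K\<lparr>carrier := F\<rparr>) p = (\<lambda>a. a [^] p) ` (F - {\<zero>})"
    by (simp add: unit_powers_def pw)
  have cl: "pclass (K\<lparr>carrier := F\<rparr>) p a = (\<lambda>h. h \<otimes> a) ` unit_powers (K\<lparr>carrier := F\<rparr>) p" for a
    by (auto simp: pclass_def r_coset_def)
  have FU: "a \<in> carrier KU" if "a \<in> F - {\<zero>}" for a using that F_carrier by auto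
  have one: "pclass (K\<lparr>carrier := F\<rparr>) p \<one> = unit_powers (K\<lparr>carrier := F\<rparr>) p"
    unfolding cl P using F_carrier by (auto simp: image_image)
  have np: "U.pnorm x \<longleftrightarrow> ?y \<in> unit_powers (K\<lparr>carrier := F\<rparr>) p"
    unfolding U.pnorm_def P F0[symmetric] norm_act[OF x] by (auto simp: Multiplicative_Group.nat_pow_mult_of)
  show ?thesis
  proof
    assume "pclass (K\<lparr>carrier := F\<rparr>) p ?y = pclass (K\<lparr>carrier := F\<rparr>) p \<one>"
    moreover have "\<one> \<in> unit_powers (K\<lparr>carrier := F\<rparr>) p"
      unfolding P using subringE(3)[OF subfieldE(1)[OF F]] by (intro image_eqI[of _ _ \<one>]) auto
    then have "\<one> \<otimes> ?y \<in> pclass (K\<lparr>carrier := F\<rparr>) p ?y" unfolding cl by blast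
    moreover have "?y \<in> carrier K" using y U.L_closed by auto
    ultimately show "U.pnorm x" using np one by simp
  next
    assume "U.pnorm x"
    then obtain f where f: "f \<in> F - {\<zero>}" "?y = f [^] p" using np P by auto
    have fU: "f \<in> carrier KU" using FU f by blast
    show "pclass (K\<lparr>carrier := F\<rparr>) p ?y = pclass (K\<lparr>carrier := F\<rparr>) p \<one>"
      unfolding one unfolding cl P f(2)
    proof
      show "(\<lambda>h. h \<otimes> f [^] p) ` (\<lambda>a. a [^] p) ` (F - {\<zero>}) \<subseteq> (\<lambda>a. a [^] p) ` (F - {\<zero>})"
      proof
        fix z assume "z \<in> (\<lambda>h. h \<otimes> f [^] p) ` (\<lambda>a. a [^] p) ` (F - {\<zero>})"
        then obtain a where a: "a \<in> F" "a \<noteq> \<zero>" "z = a [^] p \<otimes> f [^] p" by blast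
        have "a \<otimes> f \<in> F - {\<zero>}"
          using a f subringE(6)[OF subfieldE(1)[OF F]] F_carrier by (simp add: integral_iff)
        moreover have "a [^] p \<otimes> f [^] p = (a \<otimes> f) [^] p" using a f F_carrier by (simp add: nat_pow_distrib)
        ultimately show "z \<in> (\<lambda>a. a [^] p) ` (F - {\<zero>})" unfolding a(3) by blast
      qed
      show "(\<lambda>a. a [^] p) ` (F - {\<zero>}) \<subseteq> (\<lambda>h. h \<otimes> f [^] p) ` (\<lambda>a. a [^] p) ` (F - {\<zero>})"
      proof
        fix z assume "z \<in> (\<lambda>a. a [^] p) ` (F - {\<zero>})"
        then obtain a where a: "a \<in> F" "a \<noteq> \<zero>" "z = a [^] p" by blast
        have fi: "inv f \<in> F - {\<zero>}" using subfield_m_inv(1)[OF F f(1)] .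
        have fU': "f \<in> Units K" using f F_carrier by (auto simp: field_Units)
        have "a \<otimes> inv f \<in> F - {\<zero>}"
          using a fi subringE(6)[OF subfieldE(1)[OF F]] F_carrier by (simp add: integral_iff)
        moreover have "a [^] p = (a \<otimes> inv f) [^] p \<otimes> f [^] p"
        proof -
          have "(a \<otimes> inv f) [^] p \<otimes> f [^] p = (a \<otimes> inv f \<otimes> f) [^] p"
            using a f fi F_carrier by (simp add: nat_pow_distrib)
          also have "a \<otimes> inv f \<otimes> f = a" using fU' F_carrier[OF a(1)] by (simp add: m_assoc Units_closed)
          finally show ?thesis by simp
        qed
        ultimately show "z \<in> (\<lambda>h. h \<otimes> f [^] p) ` (\<lambda>a. a [^] p) ` (F - {\<zero>})" unfolding a(3) by blast
      qed
    qed
  qed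
qed

lemma tau_cls:
  assumes x: "x \<in> carrier KU" and j: "j < D"
  shows "tau_minus_one K F p (gp j) \<odot>\<^bsub>JM\<^esub> pclass K p x = U.cls (U.act (Polynomial.monom 1 j - 1) x)"
  using repD[OF rep_tau[OF j], of "U.cls x"] x by (simp add: pclass_cls U.act_cls)

lemma D_gt_1: "1 < D" using one_less_power[OF p_gt_1, of n] n by simp

lemma monom_1: "Polynomial.monom 1 1 - 1 = Tp p 0 - 1" by (simp add: Tp_def)

lemma rep_sigma: "rep (tau_minus_one K F p \<sigma>) xd"
  using rep_tau[OF D_gt_1] by (simp only: gp_1 monom_1 xd_Tp)

lemma class_target_subgroup:
  assumes j: "j \<in> insert Minf (Fin ` {0..n})"
  shows "subgroup (case j of Fin i \<Rightarrow> U.E i | _ \<Rightarrow> {U.cls \<one>\<^bsub>KU\<^esub>}) U.J"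
    "\<And>v. v \<in> (case j of Fin i \<Rightarrow> U.E i | _ \<Rightarrow> {U.cls \<one>\<^bsub>KU\<^esub>}) \<Longrightarrow> U.sJ v \<in> (case j of Fin i \<Rightarrow> U.E i | _ \<Rightarrow> {U.cls \<one>\<^bsub>KU\<^esub>})"
proof -
  have one: "{U.cls \<one>\<^bsub>KU\<^esub>} = {\<one>\<^bsub>U.J\<^esub>}" using U.J_one by simp
  have s1: "U.sJ \<one>\<^bsub>U.J\<^esub> = \<one>\<^bsub>U.J\<^esub>" by (rule U.J.s_one)
  show "subgroup (case j of Fin i \<Rightarrow> U.E i | _ \<Rightarrow> {U.cls \<one>\<^bsub>KU\<^esub>}) U.J"
    unfolding one using U.E_subgroup U.J.triv_subgroup by (cases j) auto
  show "\<And>v. v \<in> (case j of Fin i \<Rightarrow> U.E i | _ \<Rightarrow> {U.cls \<one>\<^bsub>KU\<^esub>}) \<Longrightarrow> U.sJ v \<in> (case j of Fin i \<Rightarrow> U.E i | _ \<Rightarrow> {U.cls \<one>\<^bsub>KU\<^esub>})"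
    unfolding one using U.E_sJ s1 by (cases j) auto
qed

text \<open>Testing \<sigma> alone suffices: for \<tau> = \<sigma>^k the element \<tau> - 1 is a
  multiple of \<sigma> - 1, and the target [K_j^x] is stable under \<sigma>.\<close>

lemma exceptional_at_iff:
  assumes j: "j \<in> insert Minf (Fin ` {0..n})"
  shows "exceptional_at K F p j x \<longleftrightarrow> U.exc_at j x"
proof (cases "x \<in> carrier KU")
  case x: True
  define T where "T = (case j of Fin i \<Rightarrow> U.E i | _ \<Rightarrow> {U.cls \<one>\<^bsub>KU\<^esub>})"
  note T = class_target_subgroup[OF j, folded T_def]
  have TT: "pclass K p ` inter_units K F p j = T"
  proof (cases j)
    case (Fin i)
    then have "i \<le> n" using j by auto
    then show ?thesis using inter_units_E[of i] Fin by (simp add: T_def)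
  qed (auto simp: T_def inter_units_def pclass_cls)
  have "(\<forall>\<tau>\<in>carrier G. tau_minus_one K F p \<tau> \<odot>\<^bsub>JM\<^esub> pclass K p x \<in> T) \<longleftrightarrow> U.cls (U.act (Tp p 0 - 1) x) \<in> T"
  proof
    assume "\<forall>\<tau>\<in>carrier G. tau_minus_one K F p \<tau> \<odot>\<^bsub>JM\<^esub> pclass K p x \<in> T"
    then have "tau_minus_one K F p (gp 1) \<odot>\<^bsub>JM\<^esub> pclass K p x \<in> T" using gp_G by blast
    then show "U.cls (U.act (Tp p 0 - 1) x) \<in> T" by (simp only: tau_cls[OF x D_gt_1] monom_1)
  next
    assume t: "U.cls (U.act (Tp p 0 - 1) x) \<in> T"
    show "\<forall>\<tau>\<in>carrier G. tau_minus_one K F p \<tau> \<odot>\<^bsub>JM\<^esub> pclass K p x \<in> T"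
    proof
      fix \<tau> assume "\<tau> \<in> carrier G"
      then obtain k where k: "\<tau> = gp k" "k < D" using G_gp by auto
      have "Tp p 0 ^ k = Polynomial.monom 1 k" by (simp add: Tp_def monom_power)
      then obtain g where g: "Polynomial.monom 1 k - 1 = g * (Tp p 0 - 1)"
        using power_diff_1_eq[of "Tp p 0" k] by (auto simp: mult.commute)
      have "tau_minus_one K F p \<tau> \<odot>\<^bsub>JM\<^esub> pclass K p x = U.J.act g (U.cls (U.act (Tp p 0 - 1) x))"
        using x by (simp only: k(1) tau_cls[OF x k(2)] g U.act_comp U.act_cls U.act_closed)
      also have "\<dots> \<in> T" by (rule U.J.act_subgroup[OF T t])
      finally show "tau_minus_one K F p \<tau> \<odot>\<^bsub>JM\<^esub> pclass K p x \<in> T" .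
    qed
  qed
  then show ?thesis
    unfolding exceptional_at_def U.exc_at_def TT norm_class[OF x] using x by (simp add: T_def)
qed (auto simp: exceptional_at_def U.exc_at_def)

text \<open>The minimum must first be shown to exist. Whatever value \<open>Min\<close> takes,
  \<open>\<delta>\<close> has a norm that is not a p-th power in F, and so satisfies the condition
  at index n, where [K_n^x] is all of J.\<close>

lemma exc_index_minimal:
  assumes "exceptional K F p n \<delta>"
  shows "exc_index K F p n \<in> insert Minf (Fin ` {0..n})" "U.exc_at (exc_index K F p n) \<delta>"
    "\<And>j a. j \<in> insert Minf (Fin ` {0..n}) \<Longrightarrow> U.exc_at j a \<Longrightarrow> exc_index K F p n \<le> j"
proof -
  define I where "I = {i \<in> insert Minf (Fin ` {0..n}). \<exists>\<delta>. exceptional_at K F p i \<delta>}"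
  have m: "exc_index K F p n = Min I" by (simp add: exc_index_def I_def)
  have fin: "finite I" by (simp add: I_def)
  have ex: "exceptional_at K F p (Min I) \<delta>" using assms by (simp add: exceptional_def m)
  then have d: "\<delta> \<in> carrier KU" "\<not> U.pnorm \<delta>" using norm_class by (auto simp: exceptional_at_def)
  have "U.exc_at (Fin n) \<delta>"
    unfolding U.exc_at_def U.E_def using d U.L_n U.act_closed[OF d(1)] by simp
  then have "Fin n \<in> I" using exceptional_at_iff[of "Fin n" \<delta>] by (auto simp: I_def)
  then have mI: "Min I \<in> I" using Min_in[OF fin] by blast
  show "exc_index K F p n \<in> insert Minf (Fin ` {0..n})" using mI by (simp add: m I_def)
  then show "U.exc_at (exc_index K F p n) \<delta>" using ex exceptional_at_iff m by simp
  show "exc_index K F p n \<le> j" if "j \<in> insert Minf (Fin ` {0..n})" "U.exc_at j a" for j a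
    unfolding m using that exceptional_at_iff by (intro Min_le[OF fin]) (auto simp: I_def)
qed

text \<open>H_i is generated by \<sigma>^(p^i), and on J the operator \<sigma>^(p^i) - 1 is the
  power p^i of \<sigma> - 1.\<close>

lemma fixed_classes_xp:
  assumes i: "i \<le> n" and Y: "Y \<subseteq> carrier U.J"
  shows "fixed_classes (carrier (gal_group K (inter_field K F (p ^ i)))) Y = {v \<in> Y. U.J.xp (p ^ i) v = \<one>\<^bsub>U.J\<^esub>}"
proof -
  have iff: "U.J.xp (p ^ i) v = \<one>\<^bsub>U.J\<^esub> \<longleftrightarrow> gp (p ^ i) ` v = v" if v: "v \<in> carrier U.J" for v
  proof -
    obtain a where a: "a \<in> carrier KU" "v = U.cls a" using v U.carrier_J by auto
    have "U.J.xp (p ^ i) v = U.J.act (Tp p i - 1) v" using a U.xp_cls[OF a(1)] by (simp only: U.act_cls)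
    also have "\<dots> = U.J.act (Tp p i) v \<otimes>\<^bsub>U.J\<^esub> inv\<^bsub>U.J\<^esub> v" using v by (simp add: U.J.act_diff)
    also have "U.J.act (Tp p i) v = gp (p ^ i) ` v" using v by (simp add: Tp_def U.J.act_monom gp_image)
    finally have e: "U.J.xp (p ^ i) v = gp (p ^ i) ` v \<otimes>\<^bsub>U.J\<^esub> inv\<^bsub>U.J\<^esub> v" .
    have c: "gp (p ^ i) ` v \<in> carrier U.J"
      using U.J.act_closed[OF v, of "Polynomial.monom 1 (p ^ i)"] U.J.act_monom[OF v, of "p ^ i"] by (simp add: gp_image[OF v])
    show ?thesis unfolding e using v c U.J.inv_solve_right'[of "\<one>\<^bsub>U.J\<^esub>" "gp (p ^ i) ` v" v] by auto
  qed
  have "(\<forall>\<tau>\<in>carrier (gal_group K (Fx (p ^ i))). \<tau> ` v = v) \<longleftrightarrow> gp (p ^ i) ` v = v" if v: "v \<in> carrier U.J" for v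
  proof
    assume "\<forall>\<tau>\<in>carrier (gal_group K (Fx (p ^ i))). \<tau> ` v = v"
    then show "gp (p ^ i) ` v = v" using gal_inter_field(1)[OF i] by blast
  next
    assume g: "gp (p ^ i) ` v = v"
    show "\<forall>\<tau>\<in>carrier (gal_group K (Fx (p ^ i))). \<tau> ` v = v"
    proof
      fix \<tau> assume "\<tau> \<in> carrier (gal_group K (Fx (p ^ i)))"
      then obtain j where "\<tau> = gp (j * p ^ i)" using gal_inter_field(2)[OF i] by blast
      moreover have "(U.sJ ^^ (j * p ^ i)) v = v" for j
      proof (induction j)
        case (Suc j)
        have "(U.sJ ^^ (Suc j * p ^ i)) v = (U.sJ ^^ (p ^ i)) ((U.sJ ^^ (j * p ^ i)) v)" by (simp add: funpow_add)
        then show ?case using Suc g gp_image[OF v] by simp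
      qed simp
      ultimately show "\<tau> ` v = v" using gp_image[OF v] by simp
    qed
  qed
  note stab = this
  show ?thesis
    unfolding fixed_classes_def inter_field_Fx[OF i]
  proof (rule Collect_cong)
    fix v
    show "(v \<in> Y \<and> (\<forall>\<tau>\<in>carrier (gal_group K (Fx (p ^ i))). \<tau> ` v = v)) = (v \<in> Y \<and> U.J.xp (p ^ i) v = \<one>\<^bsub>U.J\<^esub>)"
      using stab[of v] iff[of v] Y by (simp only: subset_iff cong: conj_cong)
  qed
qed

theorem module_structure:
  assumes c: "p = 2 \<Longrightarrow> n > 1 \<or> \<ominus> \<one> \<in> gal_norm K F ` (carrier K - {\<zero>})"
    and m: "m = exc_index K F p n" and exc: "exceptional K F p n \<delta>"
    and Xd: "Xd = cyclic_submodule R JM (pclass K p \<delta>)"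
  shows "\<exists>Y Ys.
    is_direct_sum R JM Xd Y (carrier JM) \<and>
    is_direct_sum_family R JM {0..n} Ys Y \<and>
    has_dim (Fp p) G JM Xd (power_ext p m + 1) \<and>
    (\<forall>i\<in>{0..n}. \<exists>\<C>. is_direct_sum_family R JM \<C> (\<lambda>C. C) (Ys i) \<and>
       (\<forall>C\<in>\<C>. (\<exists>c\<in>carrier JM. C = cyclic_submodule R JM c) \<and> has_dim (Fp p) G JM C (p ^ i))) \<and>
    (\<forall>i<n. m \<le> Fin i \<longrightarrow>
       is_direct_sum R JM
         ((\<lambda>x. tau_minus_one K F p \<sigma> \<odot>\<^bsub>JM\<^esub> x) ` Xd)
         (fixed_classes (carrier (gal_group K (inter_field K F (p ^ i)))) Y)
         (pclass K p ` inter_units K F p (Fin i))) \<and>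
    (\<forall>i<n. \<forall>k. m = Fin k \<and> i < k \<longrightarrow>
       is_direct_sum R JM
         ((\<lambda>x. (tau_minus_one K F p \<sigma> \<otimes>\<^bsub>R\<^esub>
                 tau_minus_one K F p (\<sigma> [^]\<^bsub>G\<^esub> (p ^ i)) [^]\<^bsub>R\<^esub> (p ^ (k - i) - 1)) \<odot>\<^bsub>JM\<^esub> x) ` Xd)
         (fixed_classes (carrier (gal_group K (inter_field K F (p ^ i)))) Y)
         (pclass K p ` inter_units K F p (Fin i)))"
proof -
  note em = exc_index_minimal[OF exc, folded m]
  have c': "p = 2 \<Longrightarrow> n > 1 \<or> (\<exists>e\<in>carrier KU. U.act (Nm p 0 n) e = \<xi>)"
  proof -
    assume p2: "p = 2"
    \<comment> \<open>For p = 2 the root of unity is -1, so the hypothesis on -1 is one about the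
      norm of an element being \<xi>.\<close>
    have "\<ominus> \<one> = \<xi>"
    proof -
      have x: "\<xi> \<in> carrier K" "\<xi> \<otimes> \<xi> = \<one>" "\<xi> \<noteq> \<one>"
        using xi p2 by (auto simp: primitive_root_of_unity_def numeral_2_eq_2 dest!: spec[of _ "1::nat"])
      have "(\<xi> \<ominus> \<one>) \<otimes> (\<xi> \<oplus> \<one>) = \<xi> \<otimes> \<xi> \<ominus> \<one>" using x(1) by algebra
      also have "\<dots> = \<zero>" using x by (simp add: r_neg a_minus_def)
      finally have "\<xi> \<ominus> \<one> = \<zero> \<or> \<xi> \<oplus> \<one> = \<zero>" using x(1) integral by blast
      then have "\<xi> \<oplus> \<one> = \<zero>" using x by simp
      then show ?thesis using x(1) minus_equality by blast
    qed
    then have "n > 1 \<or> \<xi> \<in> gal_norm K F ` (carrier K - {\<zero>})" using c[OF p2] by simp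
    then show "n > 1 \<or> (\<exists>e\<in>carrier KU. U.act (Nm p 0 n) e = \<xi>)" using norm_act by auto
  qed
  interpret M: pclass_mod U.J U.sJ p n U.E U.Q "U.cls \<delta>" m
    by (rule U.pclass_mod[OF n c' em(2,1,3)])
  obtain I gen lev where dec: "M.s0 \<notin> I" "gen M.s0 = U.cls \<delta>"
    "\<forall>w\<in>insert M.s0 I. gen w \<in> carrier U.J"
    "\<forall>w\<in>I. lev w \<le> n \<and> U.J.xp (p ^ lev w) (gen w) = \<one>\<^bsub>U.J\<^esub> \<and> U.J.xp (p ^ lev w - 1) (gen w) \<noteq> \<one>\<^bsub>U.J\<^esub>"
    "U.J.indep_fam (insert M.s0 I) (\<lambda>w. U.J.cyc (gen w))"
    "U.J.fsum (insert M.s0 I) (\<lambda>w. U.J.cyc (gen w)) = carrier U.J"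
    "\<forall>i<n. U.E i = U.J.xp (M.expX i) ` U.J.cyc (U.cls \<delta>) <#>\<^bsub>U.J\<^esub> {v \<in> U.J.fsum I (\<lambda>w. U.J.cyc (gen w)). U.J.xp (p ^ i) v = \<one>\<^bsub>U.J\<^esub>}"
    using M.decomposition by (elim exE conjE)
  let ?N = "\<lambda>w. U.J.cyc (gen w)"
  have genc: "gen w \<in> carrier U.J" if "w \<in> insert M.s0 I" for w using dec(3) that by blast
  have N: "subgroup (?N w) U.J" if "w \<in> insert M.s0 I" for w by (rule U.J.cyc_subgroup[OF genc[OF that]])
  have cyc_s: "U.sJ v \<in> U.J.cyc u" if "v \<in> U.J.cyc u" "u \<in> carrier U.J" for u v
    using U.J.cyc_act[OF that(2,1), of "[:0, 1:]"] U.J.cyc_carrier[OF that(2,1)] by (simp add: U.J.act_pCons)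
  have Ns: "U.sJ v \<in> ?N w" if "w \<in> insert M.s0 I" "v \<in> ?N w" for w v
    using cyc_s[OF that(2) genc[OF that(1)]] .
  have fsum_s: "U.sJ v \<in> U.J.fsum T ?N" if T: "T \<subseteq> insert M.s0 I" and v: "v \<in> U.J.fsum T ?N" for T v
  proof -
    obtain S' g where S': "finite S'" "S' \<subseteq> T" "\<forall>t\<in>S'. g t \<in> ?N t" "v = finprod U.J g S'"
      using v by (rule U.J.fsumE)
    have gc: "g t \<in> carrier U.J" if "t \<in> S'" for t using S' that T U.J.cyc_carrier[OF genc] by blast
    have "U.sJ v = U.J.act [:0, 1:] v" using S' gc by (simp add: U.J.act_pCons U.J.finprod_closed)
    also have "\<dots> = finprod U.J (\<lambda>t. U.J.act [:0, 1:] (g t)) S'"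
      unfolding S'(4) by (rule U.J.act_finprod[OF S'(1) gc])
    also have "\<dots> \<in> U.J.fsum T ?N"
    proof (rule U.J.fsumI[OF S'(1,2)])
      fix t assume t: "t \<in> S'"
      show "U.J.act [:0, 1:] (g t) \<in> ?N t" using S' t T by (intro U.J.cyc_act genc) auto
    qed
    finally show ?thesis .
  qed
  define d where "d = U.cls \<delta>"
  have dc: "d \<in> carrier U.J" unfolding d_def by (rule M.d_closed)
  have XN: "Xd = ?N M.s0" unfolding Xd pclass_cls dec(2) using dc by (intro cyclic_submodule_cyc) (simp add: d_def)
  define Y where "Y = U.J.fsum I ?N"
  define P where "P i = {w \<in> I. lev w = i}" for i
  define Ys where "Ys i = U.J.fsum (P i) ?N" for i
  have Ysub: "subgroup Y U.J" unfolding Y_def by (rule U.J.fsum_subgroup) (use N in blast)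
  have Yss: "U.sJ v \<in> Y" if "v \<in> Y" for v using fsum_s[of I v] that by (auto simp: Y_def)
  have XY: "Xd \<inter> Y = {\<one>\<^bsub>U.J\<^esub>}" unfolding XN Y_def by (rule U.J.indep_fam_disjoint[OF N dec(5,1)])
  have XYs: "Xd <#>\<^bsub>U.J\<^esub> Y = carrier U.J" unfolding XN Y_def dec(6)[symmetric]
    by (rule U.J.fsum_insert[symmetric]) (rule N)
  have subX: "submodule Xd R JM" unfolding XN by (rule submoduleI_J) (use N Ns in auto)
  have subY: "submodule Y R JM" by (rule submoduleI_J[OF Ysub Yss])
  have 1: "is_direct_sum R JM Xd Y (carrier JM)"
    unfolding is_direct_sum_def set_add_JM using subX subY XY XYs by simp
  have indI: "U.J.indep_fam I ?N" by (rule U.J.indep_fam_mono[OF dec(5)]) blast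
  have NI: "subgroup (?N w) U.J" if "w \<in> I" for w using N that by blast
  have PI: "P i \<subseteq> I" for i by (auto simp: P_def)
  have PU: "(\<Union>i\<in>{0..n}. P i) = I" using dec(4) by (auto simp: P_def)
  have 2: "is_direct_sum_family R JM {0..n} Ys Y"
  proof -
    have "U.J.indep_fam {0..n} Ys"
      unfolding Ys_def by (rule U.J.indep_fam_regroup[OF NI indI PI]) (auto simp: P_def disjoint_family_on_def)
    moreover have "U.J.fsum {0..n} Ys = Y"
      unfolding Ys_def Y_def by (rule U.J.fsum_regroup[OF NI PU])
    moreover have "subgroup (Ys i) U.J" for i unfolding Ys_def by (rule U.J.fsum_subgroup) (use NI PI in blast)
    moreover have "U.sJ v \<in> Ys i" if "v \<in> Ys i" for v i using fsum_s[of "P i" v] PI that by (auto simp: Ys_def)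
    ultimately show ?thesis using is_direct_sum_family_fsum[of "{0..n}" Ys] by simp
  qed
  have 3: "has_dim (Fp p) G JM Xd (power_ext p m + 1)"
  proof -
    have "power_ext p m = M.lenX" by (simp add: power_ext_def M.lenX_def)
    moreover have "U.J.xp M.lenX (U.cls \<delta>) \<noteq> \<one>\<^bsub>U.J\<^esub>" using M.s0_neq unfolding M.s0_def .
    ultimately show ?thesis
      using has_dim_cyc[OF M.d_closed M.xp_SlenX] XN dec(2) by simp
  qed
  have 4: "\<exists>\<C>. is_direct_sum_family R JM \<C> (\<lambda>C. C) (Ys i) \<and>
       (\<forall>C\<in>\<C>. (\<exists>c\<in>carrier JM. C = cyclic_submodule R JM c) \<and> has_dim (Fp p) G JM C (p ^ i))" for i
  proof -
    have nontriv: "gen w \<noteq> \<one>\<^bsub>U.J\<^esub>" if "w \<in> I" for w using dec(4) that by auto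
    \<comment> \<open>Summands are about to be indexed by themselves, so different labels must give
      different modules; equal ones would meet in a nontrivial generator.\<close>
    have inj: "inj_on ?N (P i)"
    proof (rule inj_onI, rule ccontr)
      fix w w' assume w: "w \<in> P i" "w' \<in> P i" "?N w = ?N w'" "w \<noteq> w'"
      have gw: "gen w \<in> carrier U.J" using genc w PI by blast
      have "w \<notin> {w'}" using w by simp
      moreover have "U.J.indep_fam (insert w {w'}) ?N" by (rule U.J.indep_fam_mono[OF indI]) (use w PI in auto)
      ultimately have "?N w \<inter> U.J.fsum {w'} ?N = {\<one>\<^bsub>U.J\<^esub>}"
        using w PI by (intro U.J.indep_fam_disjoint NI) auto
      moreover have "?N w' \<subseteq> U.J.fsum {w'} ?N" using w PI by (intro U.J.fsum_incl NI) auto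
      ultimately have "gen w = \<one>\<^bsub>U.J\<^esub>" using U.J.cyc_self[OF gw] w(3) by blast
      then show False using nontriv w PI by blast
    qed
    have NP: "subgroup (?N w) U.J" if "w \<in> P i" for w using NI PI that by blast
    have "U.J.indep_fam (?N ` P i) (\<lambda>C. C)"
      by (rule U.J.indep_fam_image[OF inj _ NP U.J.indep_fam_mono[OF indI PI]]) simp_all
    moreover have "U.J.fsum (?N ` P i) (\<lambda>C. C) = Ys i"
      unfolding Ys_def by (rule U.J.fsum_image[OF _ NP]) simp_all
    moreover have "U.sJ v \<in> C" if "C \<in> ?N ` P i" "v \<in> C" for C v using that Ns PI by blast
    moreover have "subgroup C U.J" if "C \<in> ?N ` P i" for C using that NP by blast
    ultimately have "is_direct_sum_family R JM (?N ` P i) (\<lambda>C. C) (Ys i)"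
      using is_direct_sum_family_fsum[of "?N ` P i" "\<lambda>C. C"] by simp
    moreover have "(\<exists>c\<in>carrier JM. C = cyclic_submodule R JM c) \<and> has_dim (Fp p) G JM C (p ^ i)" if "C \<in> ?N ` P i" for C
    proof -
      obtain w where w: "w \<in> I" "lev w = i" "C = ?N w" using \<open>C \<in> ?N ` P i\<close> by (auto simp: P_def)
      have gw: "gen w \<in> carrier U.J" using genc w by blast
      have pi: "Suc (p ^ i - 1) = p ^ i" using p_gt_1 by simp
      have "has_dim (Fp p) G JM (?N w) (Suc (p ^ i - 1))"
        using dec(4) w pi by (intro has_dim_cyc[OF gw]) auto
      then show ?thesis using w gw pi cyclic_submodule_cyc[OF gw] by auto
    qed
    ultimately show ?thesis by blast
  qed
  \<comment> \<open>Both cases of part (3) at once: \<open>f\<close> is either operator, and only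
    its effect as a power of \<sigma> - 1 matters.\<close>
  have E_sum: "is_direct_sum R JM (f ` Xd) (fixed_classes (carrier (gal_group K (inter_field K F (p ^ i)))) Y)
      (pclass K p ` inter_units K F p (Fin i))"
    if i: "i < n" and f: "\<And>v. v \<in> carrier U.J \<Longrightarrow> f v = U.J.xp (M.expX i) v" for i f
  proof -
    have Xc: "v \<in> carrier U.J" if "v \<in> Xd" for v using that XN U.J.cyc_carrier[OF genc] by auto
    have fX: "f ` Xd = U.J.cyc (U.J.xp (M.expX i) d)"
    proof -
      have "f ` Xd = U.J.xp (M.expX i) ` U.J.cyc d" using f Xc XN dec(2) by (intro image_cong) (auto simp: d_def)
      also have "\<dots> = U.J.cyc (U.J.xp (M.expX i) d)" using dc by (auto simp: U.J.cyc_def image_image U.J.xp_act)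
      finally show ?thesis .
    qed
    have fX': "f ` Xd = U.J.xp (M.expX i) ` U.J.cyc (U.cls \<delta>)"
      using fX dc by (auto simp: U.J.cyc_def image_image U.J.xp_act d_def)
    have xc: "U.J.xp (M.expX i) d \<in> carrier U.J" using dc by blast
    define Z where "Z = {v \<in> Y. U.J.xp (p ^ i) v = \<one>\<^bsub>U.J\<^esub>}"
    have Yc: "v \<in> carrier U.J" if "v \<in> Y" for v using subgroup.mem_carrier[OF Ysub that] .
    have fc: "fixed_classes (carrier (gal_group K (inter_field K F (p ^ i)))) Y = Z"
      unfolding Z_def using i Yc by (intro fixed_classes_xp) auto
    have Zs: "subgroup Z U.J"
    proof
      show "Z \<subseteq> carrier U.J" using Yc by (auto simp: Z_def)
      show "\<one>\<^bsub>U.J\<^esub> \<in> Z" using subgroup.one_closed[OF Ysub] by (simp add: Z_def)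
      show "x \<otimes>\<^bsub>U.J\<^esub> y \<in> Z" if "x \<in> Z" "y \<in> Z" for x y
        using that Yc subgroup.m_closed[OF Ysub] by (auto simp: Z_def U.J.xp_mult)
      show "inv\<^bsub>U.J\<^esub> x \<in> Z" if "x \<in> Z" for x
        using that Yc subgroup.m_inv_closed[OF Ysub] by (auto simp: Z_def U.J.xp_inv)
    qed
    have Zsj: "U.sJ v \<in> Z" if v: "v \<in> Z" for v
    proof -
      have vY: "v \<in> Y" "v \<in> carrier U.J" using v Yc by (auto simp: Z_def)
      have "U.sJ v = U.J.act [:0, 1:] v" using vY by (simp add: U.J.act_pCons)
      then have "U.J.xp (p ^ i) (U.sJ v) = \<one>\<^bsub>U.J\<^esub>" using v vY by (simp add: U.J.xp_act Z_def)
      then show ?thesis using Yss[OF vY(1)] by (simp add: Z_def)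
    qed
    have "submodule (f ` Xd) R JM" unfolding fX
      by (rule submoduleI_J[OF U.J.cyc_subgroup[OF xc]]) (rule cyc_s[OF _ xc])
    moreover have "submodule Z R JM" by (rule submoduleI_J[OF Zs Zsj])
    moreover have "f ` Xd <#>\<^bsub>U.J\<^esub> Z = pclass K p ` inter_units K F p (Fin i)"
      using dec(7) i inter_units_E[of i] unfolding fX' Z_def Y_def by simp
    moreover have "f ` Xd \<inter> Z = {\<one>\<^bsub>U.J\<^esub>}"
    proof
      have "Xd = U.J.cyc d" using XN dec(2) by (simp only: d_def)
      moreover have "U.J.act f (U.J.xp (M.expX i) d) \<in> U.J.cyc d" for f
        unfolding U.J.xp_def by (intro U.J.cyc_act U.J.cyc_self dc)
      ultimately have "U.J.cyc (U.J.xp (M.expX i) d) \<subseteq> Xd"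
        by (auto simp: U.J.cyc_def[of "U.J.xp (M.expX i) d"])
      then show "f ` Xd \<inter> Z \<subseteq> {\<one>\<^bsub>U.J\<^esub>}" using XY fX by (auto simp: Z_def)
      show "{\<one>\<^bsub>U.J\<^esub>} \<subseteq> f ` Xd \<inter> Z"
        using subgroup.one_closed[OF Zs] subgroup.one_closed[OF U.J.cyc_subgroup[OF xc]] fX by simp
    qed
    ultimately show ?thesis unfolding is_direct_sum_def set_add_JM fc by simp
  qed
  have t1: "tau_minus_one K F p \<sigma> \<odot>\<^bsub>JM\<^esub> v = U.J.xp 1 v" if v: "v \<in> carrier U.J" for v
    using repD[OF rep_sigma v] by (simp add: U.J.xp_def)
  have 5: "is_direct_sum R JM ((\<lambda>x. tau_minus_one K F p \<sigma> \<odot>\<^bsub>JM\<^esub> x) ` Xd)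
         (fixed_classes (carrier (gal_group K (inter_field K F (p ^ i)))) Y)
         (pclass K p ` inter_units K F p (Fin i))" if i: "i < n" "m \<le> Fin i" for i
  proof (rule E_sum[OF i(1)])
    have "M.expX i = 1" unfolding M.expX_def using i(2) by (cases m) auto
    then show "tau_minus_one K F p \<sigma> \<odot>\<^bsub>JM\<^esub> v = U.J.xp (M.expX i) v" if "v \<in> carrier U.J" for v
      using t1[OF that] by simp
  qed
  have 6: "is_direct_sum R JM
         ((\<lambda>x. (tau_minus_one K F p \<sigma> \<otimes>\<^bsub>R\<^esub>
                 tau_minus_one K F p (\<sigma> [^]\<^bsub>G\<^esub> (p ^ i)) [^]\<^bsub>R\<^esub> (p ^ (k - i) - 1)) \<odot>\<^bsub>JM\<^esub> x) ` Xd)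
         (fixed_classes (carrier (gal_group K (inter_field K F (p ^ i)))) Y)
         (pclass K p ` inter_units K F p (Fin i))" if i: "i < n" and k: "m = Fin k" "i < k" for i k
  proof (rule E_sum[OF i])
    fix v assume v: "v \<in> carrier U.J"
    have pi: "p ^ i < D" using power_strict_increasing[OF i p_gt_1] .
    have sp: "\<sigma> [^]\<^bsub>G\<^esub> j = gp j" for j :: nat
    proof (induction j)
      case (Suc j)
      have "\<sigma> [^]\<^bsub>G\<^esub> Suc j = \<sigma> [^]\<^bsub>G\<^esub> j \<otimes>\<^bsub>G\<^esub> \<sigma>" by (simp add: nat_pow_def)
      also have "\<dots> = gp j \<otimes>\<^bsub>G\<^esub> gp 1" by (simp only: Suc gp_1)
      finally show ?case by (simp add: gp_mult)
    qed (simp add: nat_pow_def gp_0)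
    have xT: "U.J.act (Tp p i - 1) v = U.J.xp (p ^ i) v" if v: "v \<in> carrier U.J" for v
    proof -
      obtain a where a: "a \<in> carrier KU" "v = U.cls a" using v U.carrier_J by auto
      then show ?thesis using U.xp_cls[OF a(1)] by (simp only: U.act_cls)
    qed
    have pw: "U.J.act ((Tp p i - 1) ^ e) v = U.J.xp (p ^ i * e) v" for e
    proof (induction e)
      case (Suc e)
      have "U.J.act ((Tp p i - 1) ^ Suc e) v = U.J.act (Tp p i - 1) (U.J.xp (p ^ i * e) v)"
        using v by (simp add: U.J.act_comp Suc)
      also have "\<dots> = U.J.xp (p ^ i + p ^ i * e) v" using v by (simp add: xT U.J.xp_add)
      finally show ?case by simp
    qed (use v in simp)
    have "rep (tau_minus_one K F p \<sigma> \<otimes>\<^bsub>R\<^esub> tau_minus_one K F p (\<sigma> [^]\<^bsub>G\<^esub> (p ^ i)) [^]\<^bsub>R\<^esub> (p ^ (k - i) - 1))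
      (xd * (Tp p i - 1) ^ (p ^ (k - i) - 1))"
      using rep_mult[OF rep_sigma rep_pow[OF rep_tau[OF pi]]] by (simp only: sp Tp_def)
    then have "(tau_minus_one K F p \<sigma> \<otimes>\<^bsub>R\<^esub> tau_minus_one K F p (\<sigma> [^]\<^bsub>G\<^esub> (p ^ i)) [^]\<^bsub>R\<^esub> (p ^ (k - i) - 1)) \<odot>\<^bsub>JM\<^esub> v
      = U.J.act (xd * (Tp p i - 1) ^ (p ^ (k - i) - 1)) v" using v by (rule repD)
    also have "\<dots> = U.J.xp 1 (U.J.xp (p ^ i * (p ^ (k - i) - 1)) v)"
      using v by (simp add: U.J.act_comp pw) (simp add: U.J.xp_def)
    also have "\<dots> = U.J.xp (1 + p ^ i * (p ^ (k - i) - 1)) v" using v by (simp only: U.J.xp_add)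
    also have "1 + p ^ i * (p ^ (k - i) - 1) = M.expX i"
    proof -
      have "p ^ i * p ^ (k - i) = p ^ k" using k by (simp flip: power_add)
      then show ?thesis unfolding M.expX_def using k by (simp add: diff_mult_distrib2)
    qed
    finally show "(tau_minus_one K F p \<sigma> \<otimes>\<^bsub>R\<^esub> tau_minus_one K F p (\<sigma> [^]\<^bsub>G\<^esub> (p ^ i)) [^]\<^bsub>R\<^esub> (p ^ (k - i) - 1)) \<odot>\<^bsub>JM\<^esub> v
      = U.J.xp (M.expX i) v" .
  qed
  show ?thesis using 1 2 3 4 5 6 by blast
qed

end

theorem theorem2:
  fixes K :: "('a, 'b) ring_scheme" and F :: "'a set" and p n :: nat
    and \<sigma> :: "'a \<Rightarrow> 'a" and \<xi> \<delta> :: 'a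
    and G :: "('a \<Rightarrow> 'a) monoid" and R :: "(('a \<Rightarrow> 'a) \<Rightarrow> int) ring"
    and J :: "(('a \<Rightarrow> 'a) \<Rightarrow> int, 'a set) module"
    and X\<^sub>\<delta> :: "'a set set" and m :: "nat extended"
  assumes "Factorial_Ring.prime p" and "n \<ge> 1"
    and "finite_galois K F" and "ring.dimension K (p ^ n) F (carrier K)"
    and "ring_char (K\<lparr>carrier := F\<rparr>) \<noteq> p"
    and "G = gal_group K F"
    and "\<sigma> \<in> carrier G" and "generate G {\<sigma>} = carrier G"
    and "\<xi> \<in> F" and "primitive_root_of_unity K p \<xi>"
    and "p = 2 \<Longrightarrow> n > 1 \<or> \<ominus>\<^bsub>K\<^esub> \<one>\<^bsub>K\<^esub> \<in> gal_norm K F ` (carrier K - {\<zero>\<^bsub>K\<^esub>})"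
    and "R = group_ring (Fp p) G" and "J = pclass_module K F p"
    and "m = exc_index K F p n" and "exceptional K F p n \<delta>"
    and "X\<^sub>\<delta> = cyclic_submodule R J (pclass K p \<delta>)"
  shows "\<exists>Y Ys.
    is_direct_sum R J X\<^sub>\<delta> Y (carrier J) \<and>
    is_direct_sum_family R J {0..n} Ys Y \<and>
    has_dim (Fp p) G J X\<^sub>\<delta> (power_ext p m + 1) \<and>
    (\<forall>i\<in>{0..n}. \<exists>\<C>. is_direct_sum_family R J \<C> (\<lambda>C. C) (Ys i) \<and>
       (\<forall>C\<in>\<C>. (\<exists>c\<in>carrier J. C = cyclic_submodule R J c) \<and> has_dim (Fp p) G J C (p ^ i))) \<and>
    (\<forall>i<n. m \<le> Fin i \<longrightarrow>
       is_direct_sum R J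
         ((\<lambda>x. tau_minus_one K F p \<sigma> \<odot>\<^bsub>J\<^esub> x) ` X\<^sub>\<delta>)
         (fixed_classes (carrier (gal_group K (inter_field K F (p ^ i)))) Y)
         (pclass K p ` inter_units K F p (Fin i))) \<and>
    (\<forall>i<n. \<forall>k. m = Fin k \<and> i < k \<longrightarrow>
       is_direct_sum R J
         ((\<lambda>x. (tau_minus_one K F p \<sigma> \<otimes>\<^bsub>R\<^esub>
                 tau_minus_one K F p (\<sigma> [^]\<^bsub>G\<^esub> (p ^ i)) [^]\<^bsub>R\<^esub> (p ^ (k - i) - 1)) \<odot>\<^bsub>J\<^esub> x) ` X\<^sub>\<delta>)
         (fixed_classes (carrier (gal_group K (inter_field K F (p ^ i)))) Y)
         (pclass K p ` inter_units K F p (Fin i)))"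
proof -
  interpret kummer K F p n \<sigma> \<xi>
    using assms(1-4,6-10) by (intro kummer.intro) simp_all
  show ?thesis
    using module_structure[OF _ assms(14,15), of X\<^sub>\<delta>] assms(11,16)
    unfolding assms(6,12,13) by blast
qed

end
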